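(* (i) Let $n\ge 2$ be an integer. If $n\notin\{3,5,9,25\}$, then every $\mathcal{S}(1,n)$ jigsaw group is non-arithmetic. Conversely, if $n\in\{3,5,9,25\}$, then there exist arithmetic $\mathcal{S}(1,n)$ jigsaw groups, and these arise only as finite index subgroups of the star jigsaw group when $n=3$ or $9$, and only as finite index subgroups of the diamond jigsaw group when $n=5$ or $25$. (ii) For $n\in\mathbb{N}$ (positive integers), the Weierstrass group $\Gamma(1,1/n,n)$ is arithmetic if and only if $n\in\{1,2,4\}$.
   Context: $\mathbb{H}^2$ is the upper half plane. For $k_1,k_2,k_3>0$ with $k_1k_2k_3=1$, $\triangle(k_1,k_2,k_3)$ denotes, up to orientation-preserving isometry of $\mathbb{H}^2$, the ideal triangle with vertices $\infty,-1,0$, whose sides $[\infty,-1],[-1,0],[0,\infty]$ carry the labels $k_1,k_2,k_3$ and the marked points $x_1=-1+\frac{i}{\sqrt{k_1}}$, $x_2=\frac{-1+\sqrt{k_2}\,i}{1+k_2}$, $x_3=\sqrt{k_3}\,i$ respectively. The Weierstrass group $\Gamma(k_1,k_2,k_3)<\mathrm{PSL}(2,\mathbb{R})$ is the group generated by the $\pi$-rotations about $x_1,x_2,x_3$. For a positive integer $n$ let $\triangle^{(n)}:=\triangle(1,1/n,n)$ (an integral jigsaw tile). For $n\ge2$ let $\mathcal{S}(1,n)=\{\triangle^{(1)},\triangle^{(n)}\}$. An $\mathcal{S}(1,n)$-jigsaw $J$ is an ideal polygon in $\mathbb{H}^2$ assembled from finitely many isometric (orientation-preserving) copies of these tiles by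 gluing tiles along sides with the same label, so that the marked points on the glued sides match up, and such that both kinds of tiles are used at least once; if $N$ tiles are used, $J$ is an ideal $(N+2)$-gon. Each side of $J$ inherits a marked point from the tile it belongs to. The jigsaw is in normalized position if $(\infty,-1,0)$ is one of its $\triangle^{(1)}$ tiles; jigsaws are always taken in normalized position. The jigsaw group $\Gamma_J<\mathrm{PSL}(2,\mathbb{R})$ is the group generated by the $\pi$-rotations about the $N+2$ marked points on the sides of $J$; it is a lattice with fundamental domain $J$. A group of the form $\Gamma_J$ with $J$ an $\mathcal{S}(1,n)$-jigsaw is called an $\mathcal{S}(1,n)$ jigsaw group. The diamond jigsaw (for $\mathcal{S}(1,n)$) consists of one $\triangle^{(1)}$ tile glued to one $\triangle^{(n)}$ tile. The star jigsaw consists of one $\triangle^{(1)}$ tile with three $\triangle^{(n)}$ tiles glued to its three sides. Their jigsaw groups are the diamond and star jigsaw groups. Jigsaws and their groups are regarded up to orientation-preserving isometry of $\mathbb{H}^2$, so "subgroup of" is understood up to conjugation in $\mathrm{PSL}(2,\mathbb{R})$. Arithmetic has the usual meaning for Fuchsian groups; for the (non-cocompact) lattices here it means that some conjugate of the group in $\mathrm{PSL}(2,\mathbb{R})$ is commensurable with $\mathrm{PSL}(2,\mathbb{Z})$. *)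

theory Defs
  imports "HOL-Analysis.Analysis" "HOL-Algebra.Generated_Groups"
begin

section \<open>The group PSL(2,R), commensurability and arithmeticity\<close>

definition mat2 :: "real \<Rightarrow> real \<Rightarrow> real \<Rightarrow> real \<Rightarrow> real^2^2" where
  "mat2 a b c d = vector [vector [a, b], vector [c, d]]"

definition SL2R :: "(real^2^2) monoid" where
  "SL2R = \<lparr>carrier = {A. det A = 1}, mult = (**), one = mat 1\<rparr>"

definition PSL2R :: "(real^2^2) set monoid" where
  "PSL2R = SL2R Mod {mat 1, - mat 1}"

definition psl :: "real^2^2 \<Rightarrow> (real^2^2) set" where
  "psl A = {mat 1, - mat 1} #>\<^bsub>SL2R\<^esub> A"

definition PSL2Z :: "(real^2^2) set set" where
  "PSL2Z = psl ` {A. det A = 1 \<and> (\<forall>i j. A $ i $ j \<in> \<int>)}"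

definition finite_index_subgroup :: "(real^2^2) set set \<Rightarrow> (real^2^2) set set \<Rightarrow> bool" where
  "finite_index_subgroup K H \<longleftrightarrow>
     subgroup H PSL2R \<and> subgroup K PSL2R \<and> K \<subseteq> H \<and>
     finite (rcosets\<^bsub>PSL2R\<lparr>carrier := H\<rparr>\<^esub> K)"

definition commensurable :: "(real^2^2) set set \<Rightarrow> (real^2^2) set set \<Rightarrow> bool" where
  "commensurable H K \<longleftrightarrow>
     finite_index_subgroup (H \<inter> K) H \<and> finite_index_subgroup (H \<inter> K) K"

definition conjugate_by :: "(real^2^2) set \<Rightarrow> (real^2^2) set set \<Rightarrow> (real^2^2) set set" where
  "conjugate_by g H = g <#\<^bsub>PSL2R\<^esub> H #>\<^bsub>PSL2R\<^esub> inv\<^bsub>PSL2R\<^esub> g"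

text \<open>Arithmeticity, in the form it takes for non-cocompact Fuchsian groups of finite covolume;
  all the groups considered below are of this kind.\<close>

definition arithmetic :: "(real^2^2) set set \<Rightarrow> bool" where
  "arithmetic H \<longleftrightarrow> (\<exists>g\<in>carrier PSL2R. commensurable (conjugate_by g H) PSL2Z)"

definition finite_index_subgroup_up_to_conj ::
    "(real^2^2) set set \<Rightarrow> (real^2^2) set set \<Rightarrow> bool" where
  "finite_index_subgroup_up_to_conj K H \<longleftrightarrow>
     (\<exists>g\<in>carrier PSL2R. finite_index_subgroup (conjugate_by g K) H)"


section \<open>Action on the upper half plane\<close>

definition moebius :: "real^2^2 \<Rightarrow> complex \<Rightarrow> complex" where
  "moebius A z = (of_real (A$1$1) * z + of_real (A$1$2)) / (of_real (A$2$1) * z + of_real (A$2$2))"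

text \<open>The matrix of the rotation by \<open>\<pi>\<close> about a point of the upper half plane:
  it fixes the point and squares to minus the identity.\<close>

definition half_turn_matrix :: "complex \<Rightarrow> real^2^2" where
  "half_turn_matrix z =
     mat2 (Re z / Im z) (- ((Re z)\<^sup>2 + (Im z)\<^sup>2) / Im z) (1 / Im z) (- Re z / Im z)"

definition half_turn :: "complex \<Rightarrow> (real^2^2) set" where
  "half_turn z = psl (half_turn_matrix z)"


section \<open>Ideal triangles with labelled and marked sides\<close>

datatype side = S1 | S2 | S3

type_synonym labels = "side \<Rightarrow> real"

definition labels :: "real \<Rightarrow> real \<Rightarrow> real \<Rightarrow> labels" where
  "labels k1 k2 k3 = (\<lambda>s. case s of S1 \<Rightarrow> k1 | S2 \<Rightarrow> k2 | S3 \<Rightarrow> k3)"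

text \<open>The ideal triangle with vertices \<open>\<infinity>\<close>, \<open>-1\<close>, \<open>0\<close> as a closed subset of the upper half plane
  (without its ideal vertices), and its sides \<open>[\<infinity>,-1]\<close>, \<open>[-1,0]\<close>, \<open>[0,\<infinity>]\<close>.\<close>

definition ideal_triangle :: "complex set" where
  "ideal_triangle = {z. Im z > 0 \<and> -1 \<le> Re z \<and> Re z \<le> 0 \<and> cmod (z + 1/2) \<ge> 1/2}"

fun triangle_side :: "side \<Rightarrow> complex set" where
  "triangle_side S1 = {z. Im z > 0 \<and> Re z = -1}"
| "triangle_side S2 = {z. Im z > 0 \<and> cmod (z + 1/2) = 1/2}"
| "triangle_side S3 = {z. Im z > 0 \<and> Re z = 0}"

fun triangle_mark :: "labels \<Rightarrow> side \<Rightarrow> complex" where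
  "triangle_mark k S1 = Complex (-1) (1 / sqrt (k S1))"
| "triangle_mark k S2 = Complex (-1 / (1 + k S2)) (sqrt (k S2) / (1 + k S2))"
| "triangle_mark k S3 = Complex 0 (sqrt (k S3))"

definition weierstrass_group :: "real \<Rightarrow> real \<Rightarrow> real \<Rightarrow> (real^2^2) set set" where
  "weierstrass_group k1 k2 k3 =
     generate PSL2R (range (\<lambda>s. half_turn (triangle_mark (labels k1 k2 k3) s)))"


section \<open>Jigsaws\<close>

text \<open>A tile \<open>(k, A)\<close> is the image of the triangle with labels \<open>k\<close> under the orientation-preserving
  isometry given by \<open>A\<close>.\<close>

type_synonym tile = "labels \<times> (real^2^2)"

definition tile_region :: "tile \<Rightarrow> complex set" where
  "tile_region t = moebius (snd t) ` ideal_triangle"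

definition tile_side :: "tile \<Rightarrow> side \<Rightarrow> complex set" where
  "tile_side t s = moebius (snd t) ` triangle_side s"

definition tile_mark :: "tile \<Rightarrow> side \<Rightarrow> complex" where
  "tile_mark t s = moebius (snd t) (triangle_mark (fst t) s)"

text \<open>The last condition says that the two tiles lie on different sides of the common geodesic.\<close>

definition glued :: "tile \<Rightarrow> side \<Rightarrow> tile \<Rightarrow> side \<Rightarrow> bool" where
  "glued t s t' s' \<longleftrightarrow>
     fst t s = fst t' s' \<and> tile_side t s = tile_side t' s' \<and> tile_mark t s = tile_mark t' s' \<and>
     tile_region t \<inter> tile_region t' = tile_side t s"

text \<open>Since an ideal polygon is simply connected, tiles can be added one at a time, each along a
  single side of the polygon obtained so far; with \<open>N\<close> tiles this gives an ideal \<open>(N+2)\<close>-gon.\<close>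

inductive assembled :: "labels set \<Rightarrow> tile set \<Rightarrow> bool" for K where
  single: "k \<in> K \<Longrightarrow> A \<in> carrier SL2R \<Longrightarrow> assembled K {(k, A)}"
| glue: "assembled K J \<Longrightarrow> t \<in> J \<Longrightarrow> k \<in> K \<Longrightarrow> A \<in> carrier SL2R \<Longrightarrow> glued t s (k, A) s' \<Longrightarrow>
    (\<Union>u\<in>J. tile_region u) \<inter> tile_region (k, A) = tile_side t s \<Longrightarrow>
    assembled K (insert (k, A) J)"

definition integral_labels :: "nat \<Rightarrow> labels" where
  "integral_labels n = labels 1 (1 / real n) (real n)"

definition normalized :: "tile set \<Rightarrow> bool" where
  "normalized J \<longleftrightarrow> (\<exists>A. (integral_labels 1, A) \<in> J \<and> tile_region (integral_labels 1, A) = ideal_triangle)"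

definition jigsaw :: "nat \<Rightarrow> tile set \<Rightarrow> bool" where
  "jigsaw n J \<longleftrightarrow>
     assembled {integral_labels 1, integral_labels n} J \<and>
     (\<forall>k\<in>{integral_labels 1, integral_labels n}. \<exists>A. (k, A) \<in> J) \<and>
     normalized J"

text \<open>The marked points on the boundary, i.e. on the sides that belong to one tile only.\<close>

definition boundary_marks :: "tile set \<Rightarrow> complex set" where
  "boundary_marks J =
     {tile_mark t s | t s. t \<in> J \<and> (\<forall>t'\<in>J. \<forall>s'. t' \<noteq> t \<longrightarrow> tile_side t' s' \<noteq> tile_side t s)}"

definition jigsaw_group :: "tile set \<Rightarrow> (real^2^2) set set" where
  "jigsaw_group J = generate PSL2R (half_turn ` boundary_marks J)"

definition is_jigsaw_group :: "nat \<Rightarrow> (real^2^2) set set \<Rightarrow> bool" where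
  "is_jigsaw_group n H \<longleftrightarrow> (\<exists>J. jigsaw n J \<and> H = jigsaw_group J)"

definition diamond_jigsaw :: "nat \<Rightarrow> tile set \<Rightarrow> bool" where
  "diamond_jigsaw n J \<longleftrightarrow> jigsaw n J \<and>
     (\<exists>A B s s'. J = {(integral_labels 1, A), (integral_labels n, B)} \<and>
        glued (integral_labels 1, A) s (integral_labels n, B) s')"

definition star_jigsaw :: "nat \<Rightarrow> tile set \<Rightarrow> bool" where
  "star_jigsaw n J \<longleftrightarrow> jigsaw n J \<and>
     (\<exists>A B. J = insert (integral_labels 1, A) (range (\<lambda>s. (integral_labels n, B s))) \<and>
        (\<forall>s. \<exists>s'. glued (integral_labels 1, A) s (integral_labels n, B s) s'))"


section \<open>Basic facts\<close>

lemma mat2_nth [simp]: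
  "mat2 a b c d $ 1 $ 1 = a" "mat2 a b c d $ 1 $ 2 = b"
  "mat2 a b c d $ 2 $ 1 = c" "mat2 a b c d $ 2 $ 2 = d"
  by (simp_all add: mat2_def)

lemma group_SL2R: "group SL2R"
proof (rule groupI)
  fix A assume "A \<in> carrier SL2R"
  hence d: "det A = 1" by (simp add: SL2R_def)
  hence inv: "invertible A" by (simp add: invertible_det_nz)
  then obtain B where B: "A ** B = mat 1" "B ** A = mat 1"
    unfolding invertible_def by blast
  have "det B = 1" using B(2) d by (metis det_I det_mul mult.right_neutral)
  thus "\<exists>B\<in>carrier SL2R. B \<otimes>\<^bsub>SL2R\<^esub> A = \<one>\<^bsub>SL2R\<^esub>"
    using B by (auto simp: SL2R_def)
qed (auto simp: SL2R_def det_mul matrix_mul_assoc)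

lemma center_normal: "{mat 1, - mat 1} \<lhd> SL2R"
proof -
  interpret group SL2R by (rule group_SL2R)
  have [simp]: "(- mat 1 :: real^2^2) ** A = - A" "A ** (- mat 1) = - A" for A :: "real^2^2"
    by (simp_all add: vec_eq_iff matrix_matrix_mult_def sum_2 mat_def forall_2)
  have [simp]: "det (- mat 1 :: real^2^2) = 1" by (simp add: det_2 mat_def)
  have inv1: "inv\<^bsub>SL2R\<^esub> (- mat 1) = - mat 1"
    by (rule inv_equality) (auto simp: SL2R_def)
  have "subgroup {mat 1, - mat 1} SL2R"
  proof (rule subgroupI)
    fix A assume "A \<in> {mat 1, - mat 1 :: real^2^2}"
    moreover have "inv\<^bsub>SL2R\<^esub> (mat 1) = mat 1" using inv_one by (simp add: SL2R_def)
    ultimately show "inv\<^bsub>SL2R\<^esub> A \<in> {mat 1, - mat 1}" using inv1 by auto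
  qed (auto simp: SL2R_def)
  thus ?thesis
    by (rule normalI) (auto simp: r_coset_def l_coset_def SL2R_def)
qed

lemma group_PSL2R: "group PSL2R"
  unfolding PSL2R_def using center_normal by (rule normal.factorgroup_is_group)

lemma half_turn_matrix:
  assumes "Im z > 0"
  shows "half_turn_matrix z \<in> carrier SL2R"
    and "half_turn_matrix z ** half_turn_matrix z = - mat 1"
    and "moebius (half_turn_matrix z) z = z"
proof -
  show "half_turn_matrix z \<in> carrier SL2R"
    using assms by (simp add: SL2R_def half_turn_matrix_def det_2 field_simps power2_eq_square)
  show "half_turn_matrix z ** half_turn_matrix z = - mat 1"
    using assms by (simp add: vec_eq_iff matrix_matrix_mult_def sum_2 forall_2 mat_def
        half_turn_matrix_def field_simps power2_eq_square)
  let ?D = "of_real (1 / Im z) * z + of_real (- Re z / Im z)"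
  have "Im ?D = 1" using assms by simp
  hence ne: "?D \<noteq> 0" by (metis zero_complex.sel(2) zero_neq_one)
  have "of_real (Re z / Im z) * z + of_real (- ((Re z)\<^sup>2 + (Im z)\<^sup>2) / Im z) = z * ?D"
    using assms by (simp add: complex_eq_iff power2_eq_square field_simps)
  thus "moebius (half_turn_matrix z) z = z"
    using ne by (simp only: moebius_def half_turn_matrix_def mat2_nth) simp
qed

lemma moebius_mat_1: "moebius (mat 1) z = z"
  by (simp add: moebius_def mat_def)

text \<open>Gluing the side \<open>[\<infinity>,-1]\<close> of a translated second tile to the side \<open>[0,\<infinity>]\<close> of the first
  gives a diamond jigsaw.\<close>

lemma diamond_jigsaw_example:
  assumes "n \<ge> 2"
  shows "diamond_jigsaw n {(integral_labels 1, mat 1), (integral_labels n, mat2 1 1 0 1)}"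
proof -
  let ?t = "(integral_labels 1, mat 1) :: tile" and ?t' = "(integral_labels n, mat2 1 1 0 1) :: tile"
  have M: "moebius (mat2 1 1 0 1) = (\<lambda>z. z + 1)" by (simp add: moebius_def fun_eq_iff)
  have I: "moebius (mat 1) = (\<lambda>z. z)" by (simp add: moebius_mat_1 fun_eq_iff)
  have shift: "x \<in> (\<lambda>z. z + 1) ` X \<longleftrightarrow> x - 1 \<in> X" for x :: complex and X
    by (force simp: image_iff)
  have half: "1 \<le> cmod (z + 1/2) * 2" "1 \<le> cmod (z - 1/2) * 2" if "Re z = 0" for z
    using that abs_Re_le_cmod[of "z + 1/2"] abs_Re_le_cmod[of "z - 1/2"] by auto
  have reg: "tile_region ?t \<inter> tile_region ?t' = tile_side ?t S3"
    by (auto simp: tile_region_def tile_side_def M I shift ideal_triangle_def half)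
  have side: "tile_side ?t S3 = tile_side ?t' S1"
    by (auto simp: tile_side_def M I shift)
  have mark: "tile_mark ?t S3 = tile_mark ?t' S1"
    by (simp add: tile_mark_def M I integral_labels_def labels_def complex_eq_iff)
  have g: "glued ?t S3 ?t' S1"
    using reg side mark by (simp add: glued_def integral_labels_def labels_def)
  have SL: "mat 1 \<in> carrier SL2R" "mat2 1 1 0 1 \<in> carrier SL2R"
    by (simp_all add: SL2R_def det_2 mat_def)
  have "assembled {integral_labels 1, integral_labels n} (insert ?t' {?t})"
    by (rule assembled.glue[OF assembled.single _ _ _ g]) (use SL reg in auto)
  moreover have "normalized {?t', ?t}"
    by (auto simp: normalized_def tile_region_def I)
  ultimately have "jigsaw n {?t, ?t'}"
    by (auto simp: jigsaw_def insert_commute)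
  thus ?thesis using g by (auto simp: diamond_jigsaw_def)
qed

end

theory Submission
  imports Defs
begin

text \<open>Unroll the horocycle of a jigsaw at a vertex through its whole boundary, with horocycles scaled so
  that the sides with label \<open>1\<close> have their mark at height \<open>1\<close>; the marks of the other boundary sides
  then have height \<open>sqrt n\<close>, all marks lie at integer positions, and the jigsaw group is generated by
  the half-turns about these points. If the group is arithmetic, then the squares of its traces are
  integers, so distances \<open>w\<close> between marks satisfy \<open>n dvd w\<^sup>2\<close> for two marks of height \<open>sqrt n\<close> and
  \<open>n dvd (w\<^sup>2 + 1)\<^sup>2\<close> for marks of different height. With \<open>m\<close> the least positive number such that
  \<open>n dvd m\<^sup>2\<close>, this makes the positions modulo \<open>m\<close> of the two ends of every side, also of the inner
  ones, determined by its label up to very few choices. They leave room for tiles of both kinds only if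
  \<open>m = 3\<close> or \<open>m = 5\<close>; for \<open>m = 3\<close> the choices force the tiles to group into stars, for \<open>m = 5\<close> into
  diamonds. Crossing the sides of the jigsaw then enumerates the cosets of its group in the star or
  diamond group. That the exceptional groups are arithmetic is seen by enumerating cosets in the
  modular group.\<close>

section \<open>Two by two matrices\<close>

text \<open>Crossing a glued side is the half-turn about its mark, and across one tile the crossings
  of the two far sides multiply to the crossing of the near side. So the crossing of every inner
  side is a product of boundary half-turns, and the geometry reduces to positions on one line. The
  moduli 3 and 5 come from the two far sides of a \<open>(1,1,1)\<close> tile, whose facing ends are
  at distance 1. For general \<open>m\<close> such an end is a root of \<open>y^2 = -1\<close>
  modulo \<open>m\<close>, or one of the ends -1 and 1 of an n-tile entered through its label-1
  side; the possible neighbours force \<open>m dvd 5\<close> or \<open>m dvd 3\<close>, and parity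
  excludes \<open>m = 2\<close>. Traces are integral for an elementary reason: a power of each
  element lies in a conjugate of SL(2,Z), and if \<open>tr A = a/b\<close> in lowest terms, then
  \<open>b^k * tr (A^k)\<close> is congruent to \<open>a^k\<close> modulo \<open>b\<close>. For the
  examples with \<open>n\<close> prime, the group sits in Gamma^0(n) extended by its Fricke
  involution, and two cusps appear in the enumeration of cosets; for square \<open>n\<close>,
  division of all positions by \<open>sqrt n\<close> makes the group integral, with a single
  cusp.\<close>

abbreviation SL2 :: "(real^2^2) set" where
  "SL2 \<equiv> carrier SL2R"

lemma mat_1_nth [simp]:
  "(mat 1 :: real^2^2)$1$1 = 1" "(mat 1 :: real^2^2)$1$2 = 0"
  "(mat 1 :: real^2^2)$2$1 = 0" "(mat 1 :: real^2^2)$2$2 = 1"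
  by (simp_all add: mat_def)

definition adj :: "real^2^2 \<Rightarrow> real^2^2" where
  "adj A = mat2 (A$2$2) (- A$1$2) (- A$2$1) (A$1$1)"

lemma mat2_eta: "mat2 (A$1$1) (A$1$2) (A$2$1) (A$2$2) = A"
  by (simp add: vec_eq_iff forall_2)

lemma mat2_cases: obtains a b c d where "A = mat2 a b c d"
  using mat2_eta[of A] by metis

lemma mat2_eq_iff [simp]:
  "mat2 a b c d = mat2 a' b' c' d' \<longleftrightarrow> a = a' \<and> b = b' \<and> c = c' \<and> d = d'"
  by (simp add: vec_eq_iff forall_2)

lemma mat2_mult [simp]:
  "mat2 a b c d ** mat2 a' b' c' d' = mat2 (a*a' + b*c') (a*b' + b*d') (c*a' + d*c') (c*b' + d*d')"
  by (simp add: vec_eq_iff forall_2 matrix_matrix_mult_def sum_2)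

lemma mat2_uminus [simp]: "- mat2 a b c d = mat2 (- a) (- b) (- c) (- d)"
  by (simp add: vec_eq_iff forall_2)

lemma mat_1_mat2: "mat 1 = mat2 1 0 0 1"
  by (simp add: vec_eq_iff forall_2 mat_def)

lemma adj_mat2 [simp]: "adj (mat2 a b c d) = mat2 d (- b) (- c) a"
  by (simp add: adj_def)

lemma SL2_mat2 [simp]: "mat2 a b c d \<in> SL2 \<longleftrightarrow> a * d - b * c = 1"
  by (simp add: SL2R_def det_2)

lemma SL2_iff: "A \<in> SL2 \<longleftrightarrow> A$1$1 * A$2$2 - A$1$2 * A$2$1 = 1"
  by (simp add: SL2R_def det_2)

lemma neg_mult_left [simp]: "(- A) ** B = - (A ** B)" for A B :: "real^2^2"
  by (simp add: vec_eq_iff matrix_matrix_mult_def sum_2)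

lemma neg_mult_right [simp]: "A ** (- B) = - (A ** B)" for A B :: "real^2^2"
  by (simp add: vec_eq_iff matrix_matrix_mult_def sum_2)

lemma adj_neg [simp]: "adj (- A) = - adj A"
  by (cases A rule: mat2_cases) simp

lemma adj_adj [simp]: "adj (adj A) = A"
  by (cases A rule: mat2_cases) simp

lemma adj_1 [simp]: "adj (mat 1) = mat 1"
  by (simp add: mat_1_mat2)

lemma adj_mult: "adj (A ** B) = adj B ** adj A"
  by (cases A rule: mat2_cases; cases B rule: mat2_cases) (simp add: algebra_simps)

lemma adj_left: "A \<in> SL2 \<Longrightarrow> adj A ** A = mat 1"
  by (cases A rule: mat2_cases) (simp add: mat_1_mat2 algebra_simps)

lemma adj_right: "A \<in> SL2 \<Longrightarrow> A ** adj A = mat 1"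
  by (cases A rule: mat2_cases) (simp add: mat_1_mat2 algebra_simps)

lemma adj_left_assoc: "A \<in> SL2 \<Longrightarrow> adj A ** (A ** B) = B"
  by (simp add: matrix_mul_assoc adj_left)

lemma adj_right_assoc: "A \<in> SL2 \<Longrightarrow> A ** (adj A ** B) = B"
  by (simp add: matrix_mul_assoc adj_right)

lemma SL2_adj [simp]: "A \<in> SL2 \<Longrightarrow> adj A \<in> SL2"
  by (cases A rule: mat2_cases) (simp add: algebra_simps)

lemma SL2_neg [simp]: "A \<in> SL2 \<Longrightarrow> - A \<in> SL2"
  by (cases A rule: mat2_cases) (simp add: algebra_simps)

lemma SL2_one [simp]: "mat 1 \<in> SL2"
  by (simp add: mat_1_mat2)

lemma SL2_mult [simp]: "A \<in> SL2 \<Longrightarrow> B \<in> SL2 \<Longrightarrow> A ** B \<in> SL2"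
  by (simp add: SL2R_def det_mul)

lemma mult_SL2R [simp]: "A \<otimes>\<^bsub>SL2R\<^esub> B = A ** B"
  by (simp add: SL2R_def)

text \<open>Equality in PSL(2,R), expressed on matrices so that later computations can ignore
  signs.\<close>

definition pm_eq :: "real^2^2 \<Rightarrow> real^2^2 \<Rightarrow> bool" (infix "\<doteq>" 50) where
  "A \<doteq> B \<longleftrightarrow> A = B \<or> A = - B"

lemma pm_eq_refl [simp]: "A \<doteq> A"
  and pm_eq_sym: "A \<doteq> B \<Longrightarrow> B \<doteq> A"
  and pm_eq_trans [trans]: "A \<doteq> B \<Longrightarrow> B \<doteq> C \<Longrightarrow> A \<doteq> C"
  and pm_eq_mult: "A \<doteq> B \<Longrightarrow> C \<doteq> D \<Longrightarrow> A ** C \<doteq> B ** D"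
  and pm_eq_neg [simp]: "- A \<doteq> B \<longleftrightarrow> A \<doteq> B" "A \<doteq> - B \<longleftrightarrow> A \<doteq> B"
  and pm_eq_adj: "A \<doteq> B \<Longrightarrow> adj A \<doteq> adj B"
  by (auto simp: pm_eq_def minus_equation_iff[of A B])

section \<open>Subgroups of PSL(2,R) as groups of matrices\<close>

lemma psl_eq: "psl A = {A, - A}"
  by (auto simp: psl_def r_coset_def SL2R_def)

lemma psl_eq_iff: "psl A = psl B \<longleftrightarrow> A \<doteq> B"
  by (auto simp: psl_eq pm_eq_def doubleton_eq_iff)

lemma carrier_PSL2R: "carrier PSL2R = psl ` SL2"
  by (simp add: PSL2R_def carrier_FactGroup psl_def)

lemma psl_mult: "A \<in> SL2 \<Longrightarrow> B \<in> SL2 \<Longrightarrow> psl A \<otimes>\<^bsub>PSL2R\<^esub> psl B = psl (A ** B)"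
  unfolding PSL2R_def psl_def using normal.rcos_sum[OF center_normal, of A B] by simp

lemma psl_one: "\<one>\<^bsub>PSL2R\<^esub> = psl (mat 1)"
  by (simp add: PSL2R_def psl_eq)

lemma psl_inv: "A \<in> SL2 \<Longrightarrow> inv\<^bsub>PSL2R\<^esub> (psl A) = psl (adj A)"
  by (rule group.inv_equality[OF group_PSL2R])
    (auto simp: psl_mult psl_one adj_left carrier_PSL2R)

text \<open>These are the full preimages in SL(2,R) of subgroups of PSL(2,R): closure under negation
  ensures that \<open>psl\<close> loses no information about membership.\<close>

definition matrix_group :: "(real^2^2) set \<Rightarrow> bool" where
  "matrix_group G \<longleftrightarrow> G \<subseteq> SL2 \<and> mat 1 \<in> G \<and> (\<forall>A\<in>G. - A \<in> G \<and> adj A \<in> G) \<and>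
     (\<forall>A\<in>G. \<forall>B\<in>G. A ** B \<in> G)"

lemma matrix_groupD:
  assumes "matrix_group G"
  shows "A \<in> G \<Longrightarrow> A \<in> SL2" "mat 1 \<in> G" "A \<in> G \<Longrightarrow> - A \<in> G" "A \<in> G \<Longrightarrow> adj A \<in> G"
    "A \<in> G \<Longrightarrow> B \<in> G \<Longrightarrow> A ** B \<in> G"
  using assms by (auto simp: matrix_group_def)

lemma matrix_group_pm_eq: "matrix_group G \<Longrightarrow> A \<doteq> B \<Longrightarrow> A \<in> G \<longleftrightarrow> B \<in> G"
  using matrix_groupD(3)[of G B] matrix_groupD(3)[of G A] by (auto simp: pm_eq_def)

lemma psl_mem_iff: "matrix_group G \<Longrightarrow> psl A \<in> psl ` G \<longleftrightarrow> A \<in> G"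
  using matrix_group_pm_eq psl_eq_iff by (metis imageE imageI)

lemma matrix_group_SL2: "matrix_group SL2"
  by (auto simp: matrix_group_def)

lemma subgroup_psl:
  assumes "matrix_group G"
  shows "subgroup (psl ` G) PSL2R"
proof (rule group.subgroupI[OF group_PSL2R])
  show "psl ` G \<subseteq> carrier PSL2R" "psl ` G \<noteq> {}"
    using matrix_groupD[OF assms] by (auto simp: carrier_PSL2R)
  show "inv\<^bsub>PSL2R\<^esub> a \<in> psl ` G" if "a \<in> psl ` G" for a
    using that matrix_groupD[OF assms] by (auto simp: psl_inv)
  show "a \<otimes>\<^bsub>PSL2R\<^esub> b \<in> psl ` G" if "a \<in> psl ` G" "b \<in> psl ` G" for a b
    using that matrix_groupD[OF assms] by (auto simp: psl_mult)
qed

text \<open>Negation is among the rules so that the result is the whole preimage of the subgroup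
  generated in PSL(2,R).\<close>

inductive_set mgen :: "(real^2^2) set \<Rightarrow> (real^2^2) set" for X where
  one: "mat 1 \<in> mgen X"
| incl: "A \<in> X \<Longrightarrow> A \<in> mgen X"
| neg: "A \<in> mgen X \<Longrightarrow> - A \<in> mgen X"
| adj: "A \<in> mgen X \<Longrightarrow> adj A \<in> mgen X"
| mult: "A \<in> mgen X \<Longrightarrow> B \<in> mgen X \<Longrightarrow> A ** B \<in> mgen X"

lemma mgen_subset: "matrix_group G \<Longrightarrow> X \<subseteq> G \<Longrightarrow> mgen X \<subseteq> G"
proof
  show "A \<in> G" if "A \<in> mgen X" "matrix_group G" "X \<subseteq> G" for A
    using that by induction (auto intro: matrix_groupD)
qed

lemma matrix_group_mgen: "X \<subseteq> SL2 \<Longrightarrow> matrix_group (mgen X)"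
  using mgen_subset[OF matrix_group_SL2, of X]
  by (auto simp: matrix_group_def intro: mgen.intros)

lemma generate_psl:
  assumes "X \<subseteq> SL2"
  shows "generate PSL2R (psl ` X) = psl ` mgen X"
proof
  show "generate PSL2R (psl ` X) \<subseteq> psl ` mgen X"
    by (rule group.generate_subgroup_incl[OF group_PSL2R])
      (auto intro: mgen.incl subgroup_psl[OF matrix_group_mgen[OF assms]])
  have "psl A \<in> generate PSL2R (psl ` X)" if "A \<in> mgen X" for A
    using that
  proof induction
    case one
    show ?case using generate.one[of PSL2R] by (simp add: psl_one)
  next
    case (neg A)
    thus ?case by (simp add: psl_eq insert_commute)
  next
    case (adj A)
    have "A \<in> SL2" using adj mgen_subset[OF matrix_group_SL2 assms] by auto
    moreover have "inv\<^bsub>PSL2R\<^esub> (psl A) \<in> generate PSL2R (psl ` X)"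
      using assms by (intro group.generate_m_inv_closed[OF group_PSL2R]) (auto simp: carrier_PSL2R adj)
    ultimately show ?case by (simp add: psl_inv)
  next
    case (mult A B)
    have "A \<in> SL2" "B \<in> SL2" using mult mgen_subset[OF matrix_group_SL2 assms] by auto
    thus ?case using generate.eng[OF mult.IH] by (simp add: psl_mult)
  qed (auto intro: generate.incl)
  thus "psl ` mgen X \<subseteq> generate PSL2R (psl ` X)" by auto
qed

definition conj_set :: "real^2^2 \<Rightarrow> (real^2^2) set \<Rightarrow> (real^2^2) set" where
  "conj_set F G = (\<lambda>A. F ** A ** adj F) ` G"

lemma conj_set_iff: "F \<in> SL2 \<Longrightarrow> A \<in> conj_set F G \<longleftrightarrow> adj F ** A ** F \<in> G"
proof -
  assume F: "F \<in> SL2"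
  have "F ** (adj F ** A ** F) ** adj F = A"
    using F by (metis adj_right matrix_mul_assoc matrix_mul_lid matrix_mul_rid)
  moreover have "adj F ** (F ** B ** adj F) ** F = B" for B
    using F by (metis adj_left matrix_mul_assoc matrix_mul_lid matrix_mul_rid)
  ultimately show ?thesis unfolding conj_set_def by (force simp: image_iff)
qed

lemma conj_set_matrix_group:
  assumes F: "F \<in> SL2" and G: "matrix_group G"
  shows "matrix_group (conj_set F G)"
  unfolding matrix_group_def conj_set_def
proof (intro conjI ballI)
  show "(\<lambda>A. F ** A ** adj F) ` G \<subseteq> SL2" using F matrix_groupD[OF G] by auto
  show "mat 1 \<in> (\<lambda>A. F ** A ** adj F) ` G"
    using F matrix_groupD[OF G] by (auto simp: adj_right intro!: image_eqI[of _ _ "mat 1"])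
next
  fix A assume "A \<in> (\<lambda>A. F ** A ** adj F) ` G"
  then obtain B where B: "B \<in> G" "A = F ** B ** adj F" by auto
  have "- A = F ** (- B) ** adj F" "adj A = F ** adj B ** adj F"
    using B by (simp_all add: adj_mult matrix_mul_assoc)
  thus "- A \<in> (\<lambda>A. F ** A ** adj F) ` G" "adj A \<in> (\<lambda>A. F ** A ** adj F) ` G"
    using B(1) matrix_groupD[OF G] by blast+
next
  fix A B assume "A \<in> (\<lambda>A. F ** A ** adj F) ` G" "B \<in> (\<lambda>A. F ** A ** adj F) ` G"
  then obtain A' B' where *: "A' \<in> G" "B' \<in> G" "A = F ** A' ** adj F" "B = F ** B' ** adj F" by auto
  have "A ** B = F ** (A' ** (adj F ** F) ** B') ** adj F"
    using * by (simp add: matrix_mul_assoc)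
  thus "A ** B \<in> (\<lambda>A. F ** A ** adj F) ` G"
    using F * matrix_groupD[OF G] by (auto simp: adj_left)
qed

lemma conj_set_one [simp]: "conj_set (mat 1) G = G"
  by (simp add: conj_set_def)

lemma conj_set_conj_set: "conj_set F (conj_set F' G) = conj_set (F ** F') G"
  by (simp add: conj_set_def image_image adj_mult matrix_mul_assoc)

lemma conj_set_mono: "G \<subseteq> G' \<Longrightarrow> conj_set F G \<subseteq> conj_set F G'"
  by (auto simp: conj_set_def)

lemma conjugate_by_psl:
  assumes F: "F \<in> SL2" and G: "matrix_group G"
  shows "conjugate_by (psl F) (psl ` G) = psl ` conj_set F G"
proof -
  have "psl F <#\<^bsub>PSL2R\<^esub> (psl ` G) #>\<^bsub>PSL2R\<^esub> psl (adj F) = (\<lambda>A. psl (F ** A ** adj F)) ` G"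
    using F matrix_groupD(1)[OF G]
    by (auto simp: l_coset_def r_coset_def psl_mult intro!: bexI)
  thus ?thesis using F by (simp add: conjugate_by_def psl_inv conj_set_def image_image)
qed

section \<open>Finite index and arithmeticity\<close>

text \<open>Finite index in the form in which it gets proved: a finite set of right factors is
  exhibited, and it bounds the number of right cosets.\<close>

definition finite_cover :: "(real^2^2) set \<Rightarrow> (real^2^2) set \<Rightarrow> bool" where
  "finite_cover K G \<longleftrightarrow> (\<exists>C. finite C \<and> C \<subseteq> SL2 \<and> (\<forall>A\<in>G. \<exists>B\<in>K. \<exists>D\<in>C. A = B ** D))"

lemma rcoset_psl:
  assumes "matrix_group K" "A \<in> SL2"
  shows "psl ` K #>\<^bsub>PSL2R\<lparr>carrier := H\<rparr>\<^esub> psl A = (\<lambda>B. psl (B ** A)) ` K"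
  using assms matrix_groupD(1)[OF assms(1)] by (auto simp: r_coset_def psl_mult intro!: bexI)

lemma finite_index_psl:
  assumes K: "matrix_group K" and G: "matrix_group G" and sub: "K \<subseteq> G" and c: "finite_cover K G"
  shows "finite_index_subgroup (psl ` K) (psl ` G)"
proof -
  obtain C where C: "finite C" "C \<subseteq> SL2" "\<And>A. A \<in> G \<Longrightarrow> \<exists>B\<in>K. \<exists>D\<in>C. A = B ** D"
    using c unfolding finite_cover_def by blast
  let ?M = "PSL2R\<lparr>carrier := psl ` G\<rparr>"
  have "rcosets\<^bsub>?M\<^esub> (psl ` K) \<subseteq> (\<lambda>D. (\<lambda>B. psl (B ** D)) ` K) ` C"
  proof
    fix X assume "X \<in> rcosets\<^bsub>?M\<^esub> (psl ` K)"
    then obtain A where A: "A \<in> G" "X = psl ` K #>\<^bsub>?M\<^esub> psl A"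
      by (auto simp: RCOSETS_def)
    then obtain B D where BD: "B \<in> K" "D \<in> C" "A = B ** D" using C(3) by blast
    have "X = (\<lambda>E. psl (E ** A)) ` K"
      using A rcoset_psl[OF K] matrix_groupD(1)[OF G] by auto
    also have "\<dots> = (\<lambda>E. psl (E ** D)) ` K"
    proof (intro equalityI subsetI; clarsimp)
      fix E assume "E \<in> K"
      thus "psl (E ** A) \<in> (\<lambda>E. psl (E ** D)) ` K"
        using BD matrix_groupD(5)[OF K, of E B] by (auto simp: matrix_mul_assoc)
    next
      fix E assume E: "E \<in> K"
      have "E ** D = (E ** adj B) ** A"
        using BD adj_left_assoc[of B D] matrix_groupD(1)[OF K]
        by (metis matrix_mul_assoc)
      thus "psl (E ** D) \<in> (\<lambda>E. psl (E ** A)) ` K"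
        using E BD matrix_groupD[OF K] by auto
    qed
    finally show "X \<in> (\<lambda>D. (\<lambda>B. psl (B ** D)) ` K) ` C" using BD by blast
  qed
  hence "finite (rcosets\<^bsub>?M\<^esub> (psl ` K))" using C(1) finite_subset by blast
  thus ?thesis using subgroup_psl[OF K] subgroup_psl[OF G] sub
    by (auto simp: finite_index_subgroup_def)
qed

section \<open>Powers, traces and integrality\<close>

fun mpow :: "real^2^2 \<Rightarrow> nat \<Rightarrow> real^2^2" where
  "mpow A 0 = mat 1"
| "mpow A (Suc k) = A ** mpow A k"

lemma mpow_add: "mpow A (i + j) = mpow A i ** mpow A j"
  by (induction i) (auto simp: matrix_mul_assoc)

lemma mpow_mem: "matrix_group G \<Longrightarrow> A \<in> G \<Longrightarrow> mpow A k \<in> G"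
  by (induction k) (auto intro: matrix_groupD)

lemma mpow_conj:
  assumes "F \<in> SL2"
  shows "mpow (F ** A ** adj F) k = F ** mpow A k ** adj F"
proof (induction k)
  case 0
  show ?case using assms by (simp add: adj_right)
next
  case (Suc k)
  have "mpow (F ** A ** adj F) (Suc k) = F ** A ** (adj F ** F) ** mpow A k ** adj F"
    unfolding mpow.simps Suc by (simp add: matrix_mul_assoc)
  thus ?case using assms by (simp add: adj_left matrix_mul_assoc)
qed

text \<open>Pigeonhole: two of the cosets of the powers of \<open>A\<close> coincide.\<close>

lemma finite_index_mpow:
  assumes K: "matrix_group K" and G: "matrix_group G"
    and fi: "finite_index_subgroup (psl ` K) (psl ` G)" and A: "A \<in> G"
  shows "\<exists>k>0. mpow A k \<in> K"
proof -
  let ?M = "PSL2R\<lparr>carrier := psl ` G\<rparr>"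
  define f where "f i = psl ` K #>\<^bsub>?M\<^esub> psl (mpow A i)" for i
  have "range f \<subseteq> rcosets\<^bsub>?M\<^esub> (psl ` K)"
    unfolding f_def RCOSETS_def using mpow_mem[OF G A] by auto
  hence "finite (range f)" using fi finite_subset unfolding finite_index_subgroup_def by blast
  hence "\<not> inj f" using finite_imageD infinite_UNIV_nat by blast
  then obtain i j where ij: "i < j" "f i = f j"
    by (metis inj_onI linorder_neqE_nat)
  have mem: "mpow A i \<in> SL2" for i using mpow_mem[OF G A] matrix_groupD(1)[OF G] by blast
  have "psl (mat 1 ** mpow A j) \<in> f j"
    unfolding f_def using rcoset_psl[OF K mem, of "psl ` G" j] matrix_groupD(2)[OF K] by (metis imageI)
  hence "psl (mpow A j) \<in> (\<lambda>B. psl (B ** mpow A i)) ` K"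
    using ij rcoset_psl[OF K mem, of "psl ` G" i] unfolding f_def by simp
  then obtain B where B: "B \<in> K" "mpow A j \<doteq> B ** mpow A i" by (auto simp: psl_eq_iff)
  have "mpow A (j - i) ** mpow A i = mpow A j" using ij mpow_add[of A "j - i" i] by simp
  hence "mpow A (j - i) ** mpow A i ** adj (mpow A i) \<doteq> B ** mpow A i ** adj (mpow A i)"
    using B by (simp add: pm_eq_mult)
  hence "mpow A (j - i) \<doteq> B"
    using adj_right[OF mem] by (metis matrix_mul_assoc matrix_mul_rid)
  thus ?thesis using B matrix_group_pm_eq[OF K] ij by (metis zero_less_diff)
qed

definition SL2Z :: "(real^2^2) set" where
  "SL2Z = {A \<in> SL2. \<forall>i j. A $ i $ j \<in> \<int>}"

lemma SL2Z_mat2 [simp]: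
  "mat2 a b c d \<in> SL2Z \<longleftrightarrow> a * d - b * c = 1 \<and> a \<in> \<int> \<and> b \<in> \<int> \<and> c \<in> \<int> \<and> d \<in> \<int>"
  by (simp add: SL2Z_def forall_2)

lemma PSL2Z_eq: "PSL2Z = psl ` SL2Z"
  by (simp add: PSL2Z_def SL2Z_def SL2R_def)

lemma matrix_group_SL2Z: "matrix_group SL2Z"
proof -
  have "A ** B \<in> SL2Z" if "A \<in> SL2Z" "B \<in> SL2Z" for A B
    using that SL2_mult[of A B] unfolding SL2Z_def
    by (auto simp: forall_2 matrix_matrix_mult_def sum_2)
  moreover have "adj A \<in> SL2Z" "- A \<in> SL2Z" if "A \<in> SL2Z" for A
    using that by (cases A rule: mat2_cases; simp add: algebra_simps)+
  ultimately show ?thesis by (auto simp: matrix_group_def SL2Z_def forall_2 mat_1_mat2)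
qed

lemma matrix_group_Int: "matrix_group G \<Longrightarrow> matrix_group G' \<Longrightarrow> matrix_group (G \<inter> G')"
  by (auto simp: matrix_group_def)

lemma psl_Int: "matrix_group G \<Longrightarrow> matrix_group G' \<Longrightarrow> psl ` G \<inter> psl ` G' = psl ` (G \<inter> G')"
  using psl_mem_iff by blast

lemma arithmeticI:
  assumes F: "F \<in> SL2" and G: "matrix_group G"
    and "finite_cover (conj_set F G \<inter> SL2Z) (conj_set F G)" "finite_cover (conj_set F G \<inter> SL2Z) SL2Z"
  shows "arithmetic (psl ` G)"
proof -
  have "commensurable (conjugate_by (psl F) (psl ` G)) PSL2Z"
    unfolding commensurable_def conjugate_by_psl[OF F G] PSL2Z_eq
      psl_Int[OF conj_set_matrix_group[OF F G] matrix_group_SL2Z]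
    using assms conj_set_matrix_group[OF F G] matrix_group_SL2Z
    by (auto intro!: finite_index_psl matrix_group_Int)
  thus ?thesis unfolding arithmetic_def carrier_PSL2R using F by blast
qed

lemma trace_conj:
  assumes "F \<in> SL2"
  shows "(F ** A ** adj F)$1$1 + (F ** A ** adj F)$2$2 = A$1$1 + A$2$2"
proof -
  obtain a b c d where F: "F = mat2 a b c d" by (rule mat2_cases)
  obtain x y z w where A: "A = mat2 x y z w" by (rule mat2_cases)
  have 1: "a * d = 1 + b * c" using assms F by simp
  have "(F ** A ** adj F)$1$1 + (F ** A ** adj F)$2$2 = (a * d - b * c) * (x + w)"
    unfolding F A by (simp add: algebra_simps)
  thus ?thesis using 1 A by simp
qed

text \<open>Some power of the conjugate of \<open>A\<close> is integral, and conjugation does not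
  change the trace.\<close>

lemma arithmetic_trace_power:
  assumes G: "matrix_group G" and ar: "arithmetic (psl ` G)" and A: "A \<in> G"
  shows "\<exists>k>0. (mpow A k)$1$1 + (mpow A k)$2$2 \<in> \<int>"
proof -
  obtain F where F: "F \<in> SL2" "commensurable (conjugate_by (psl F) (psl ` G)) PSL2Z"
    using ar by (auto simp: arithmetic_def carrier_PSL2R)
  note C = conj_set_matrix_group[OF F(1) G]
  have "finite_index_subgroup (psl ` (conj_set F G \<inter> SL2Z)) (psl ` conj_set F G)"
    using F(2) unfolding commensurable_def conjugate_by_psl[OF F(1) G] PSL2Z_eq
      psl_Int[OF C matrix_group_SL2Z] by blast
  then obtain k where k: "k > 0" "mpow (F ** A ** adj F) k \<in> SL2Z"
    using finite_index_mpow[OF matrix_group_Int[OF C matrix_group_SL2Z] C, of "F ** A ** adj F"] A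
    by (auto simp: conj_set_def)
  hence "(F ** mpow A k ** adj F)$1$1 + (F ** mpow A k ** adj F)$2$2 \<in> \<int>"
    by (simp add: SL2Z_def mpow_conj[OF F(1)])
  thus ?thesis using k F trace_conj by metis
qed

text \<open>The trace form of the Cayley-Hamilton theorem.\<close>

lemma mpow_trace_rec:
  assumes "A \<in> SL2"
  shows "(mpow A (Suc (Suc k)))$1$1 + (mpow A (Suc (Suc k)))$2$2 =
    (A$1$1 + A$2$2) * ((mpow A (Suc k))$1$1 + (mpow A (Suc k))$2$2) - ((mpow A k)$1$1 + (mpow A k)$2$2)"
proof -
  obtain a b c d where F: "A = mat2 a b c d" by (rule mat2_cases)
  obtain x y z w where M: "mpow A k = mat2 x y z w" by (rule mat2_cases)
  have 1: "b * c = a * d - 1" using assms F by simp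
  show ?thesis unfolding mpow.simps M unfolding F
    by (simp add: algebra_simps) (use 1 in algebra)
qed

text \<open>Let \<open>tr A = a/b\<close> in lowest terms. Then \<open>b^k * tr (A^k)\<close> is
  congruent to \<open>a^k\<close> modulo \<open>b\<close>, so an integral \<open>tr (A^k)\<close>
  makes \<open>b\<close> a divisor of \<open>a^k\<close>, and \<open>b = 1\<close>.\<close>

lemma arithmetic_trace_integral:
  assumes G: "matrix_group G" and ar: "arithmetic (psl ` G)" and A: "A \<in> G"
    and rat: "A$1$1 + A$2$2 \<in> \<rat>"
  shows "A$1$1 + A$2$2 \<in> \<int>"
proof -
  obtain a b :: int where ab: "b > 0" "coprime a b" "A$1$1 + A$2$2 = of_int a / of_int b"
    using Rats_cases'[OF rat] by metis
  define e where "e k = (mpow A k)$1$1 + (mpow A k)$2$2" for k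
  have SL: "A \<in> SL2" using A matrix_groupD(1)[OF G] by blast
  have e0: "e 0 = 2" and e1: "e (Suc 0) = of_int a / of_int b"
    using ab by (simp_all add: e_def)
  have rec: "e (Suc (Suc k)) = of_int a / of_int b * e (Suc k) - e k" for k
    using mpow_trace_rec[OF SL, of k] ab by (simp only: e_def)
  \<comment> \<open>The congruence is claimed from exponent 1 on only, because it fails for
    \<open>e 0 = 2\<close>; of the preceding value the recurrence needs integrality alone.\<close>
  have E: "\<exists>x y. of_int b ^ Suc k * e (Suc k) = of_int (a ^ Suc k + b * x) \<and> of_int b ^ k * e k = of_int y" for k
  proof (induction k)
    case 0
    show ?case using ab e0 e1 by (auto intro!: exI[of _ 0] exI[of _ 2])
  next
    case (Suc k)
    then obtain x y where xy: "of_int b ^ Suc k * e (Suc k) = of_int (a ^ Suc k + b * x)"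
      "of_int b ^ k * e k = of_int y" by blast
    have "of_int b ^ Suc (Suc k) * e (Suc (Suc k))
      = of_int a * (of_int b ^ Suc k * e (Suc k)) - of_int b ^ 2 * (of_int b ^ k * e k)"
      using ab unfolding rec by (simp add: field_simps power2_eq_square)
    also have "\<dots> = of_int (a ^ Suc (Suc k) + b * (a * x - b * y))"
      unfolding xy by (simp add: algebra_simps power2_eq_square)
    finally show ?case using xy by blast
  qed
  obtain k where k: "k > 0" "e k \<in> \<int>"
    using arithmetic_trace_power[OF G ar A] unfolding e_def by blast
  then obtain j z where j: "k = Suc j" "e k = of_int z" by (metis Ints_cases gr0_implies_Suc)
  obtain x where x: "of_int b ^ k * of_int z = (of_int (a ^ k + b * x) :: real)"
    using E[of j] j by auto
  have "(of_int (b ^ k * z) :: real) = of_int (a ^ k + b * x)" using x by simp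
  hence "b ^ k * z = a ^ k + b * x" by (simp only: of_int_eq_iff)
  hence "a ^ k = b * (b ^ j * z - x)" using j by (simp add: algebra_simps)
  hence "b dvd a ^ k" by simp
  moreover have "coprime (a ^ k) b" using ab by simp
  ultimately have "is_unit b" using coprime_common_divisor[of "a ^ k" b b] by simp
  hence "b = 1" using ab by simp
  thus ?thesis using ab by simp
qed

text \<open>The height \<open>sqrt n\<close> brings in irrational traces with rational squares;
  \<open>tr (A^2) = (tr A)^2 - 2\<close> reduces them to the rational case.\<close>

lemma arithmetic_trace_square_integral:
  assumes G: "matrix_group G" and ar: "arithmetic (psl ` G)" and A: "A \<in> G"
    and rat: "(A$1$1 + A$2$2)\<^sup>2 \<in> \<rat>"
  shows "(A$1$1 + A$2$2)\<^sup>2 \<in> \<int>"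
proof -
  have SL: "A \<in> SL2" using A matrix_groupD(1)[OF G] by blast
  have eq: "(A ** A)$1$1 + (A ** A)$2$2 = (A$1$1 + A$2$2)\<^sup>2 - 2"
    using mpow_trace_rec[OF SL, of 0] by (simp add: power2_eq_square)
  have "(A ** A)$1$1 + (A ** A)$2$2 \<in> \<int>"
    using A matrix_groupD(5)[OF G] rat by (intro arithmetic_trace_integral[OF G ar]) (auto simp: eq)
  hence "((A$1$1 + A$2$2)\<^sup>2 - 2) + 2 \<in> \<int>" unfolding eq using Ints_add Ints_numeral by blast
  thus ?thesis by simp
qed

lemma arithmetic_conj_set:
  assumes F: "F \<in> SL2" and G: "matrix_group G" and ar: "arithmetic (psl ` conj_set F G)"
  shows "arithmetic (psl ` G)"
proof -
  obtain F' where F': "F' \<in> SL2" "commensurable (conjugate_by (psl F') (psl ` conj_set F G)) PSL2Z"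
    using ar by (auto simp: arithmetic_def carrier_PSL2R)
  hence "commensurable (conjugate_by (psl (F' ** F)) (psl ` G)) PSL2Z"
    using F G by (simp add: conjugate_by_psl conj_set_matrix_group conj_set_conj_set)
  thus ?thesis using F F' unfolding arithmetic_def carrier_PSL2R by (blast intro: SL2_mult)
qed

section \<open>Frames of the sides of a tile\<close>

definition shift :: "real \<Rightarrow> real^2^2" where "shift x = mat2 1 x 0 1"

text \<open>The half-turn about \<open>i h\<close>; it exchanges the cusps infinity and 0.\<close>

definition turn :: "real \<Rightarrow> real^2^2" where "turn h = mat2 0 (- h) (1 / h) 0"

text \<open>\<open>crossing h x x\<close> is the half-turn about \<open>x + i h\<close>. In general \<open>crossing h x y\<close> crosses a side
  which, on the unrolled horocycle at \<open>\<infinity>\<close>, starts at the position \<open>x\<close> and ends at the position \<open>y\<close>.\<close>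

definition crossing :: "real \<Rightarrow> real \<Rightarrow> real \<Rightarrow> real^2^2" where
  "crossing h x y = shift x ** turn h ** shift (- y)"

lemma crossing_mat2: "crossing h x y = mat2 (x / h) (- (x * y / h) - h) (1 / h) (- y / h)"
  by (simp add: crossing_def shift_def turn_def)

lemma half_turn_matrix_Complex: "h \<noteq> 0 \<Longrightarrow> half_turn_matrix (Complex x h) = crossing h x x"
  by (simp add: half_turn_matrix_def crossing_mat2 power2_eq_square field_simps)

lemma SL2_shift [simp]: "shift x \<in> SL2"
  by (simp add: shift_def)

lemma SL2_turn [simp]: "h \<noteq> 0 \<Longrightarrow> turn h \<in> SL2"
  by (simp add: turn_def)

lemma SL2_crossing [simp]: "h \<noteq> 0 \<Longrightarrow> crossing h x y \<in> SL2"
  by (simp add: crossing_def)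

lemma shift_add: "shift x ** shift y = shift (x + y)"
  by (simp add: shift_def)

lemma adj_shift: "adj (shift x) = shift (- x)"
  by (simp add: shift_def)

lemma turn_turn: "h \<noteq> 0 \<Longrightarrow> turn h ** turn h = - mat 1"
  by (simp add: turn_def mat_1_mat2)

lemma adj_crossing: "adj (crossing h x y) \<doteq> crossing h y x"
  by (simp add: crossing_mat2 pm_eq_def algebra_simps)

section \<open>The action on the upper half plane\<close>

definition upper :: "complex set" where "upper = {z. Im z > 0}"

lemma moebius_denom:
  assumes "A \<in> SL2" "Im z > 0"
  shows "of_real (A$2$1) * z + of_real (A$2$2) \<noteq> 0"
proof
  assume 0: "of_real (A$2$1) * z + of_real (A$2$2) = 0"
  hence "A$2$1 * Im z = 0" by (simp add: complex_eq_iff)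
  hence "A$2$1 = 0" using assms by simp
  moreover hence "A$2$2 = 0" using 0 by simp
  ultimately show False using assms by (simp add: SL2_iff)
qed

lemma moebius_mult:
  assumes "A \<in> SL2" "B \<in> SL2" "z \<in> upper"
  shows "moebius (A ** B) z = moebius A (moebius B z)"
proof -
  obtain a b c d where A: "A = mat2 a b c d" by (rule mat2_cases)
  obtain x y u v where B: "B = mat2 x y u v" by (rule mat2_cases)
  let ?D = "of_real u * z + of_real v :: complex"
  have D: "?D \<noteq> 0" using moebius_denom[OF assms(2), of z] assms(3) B by (simp add: upper_def)
  have frac: "p * (w / ?D) + q = (p * w + q * ?D) / ?D" for p q w
    using D by (simp add: add_divide_distrib)
  have "moebius A (moebius B z) = ((of_real a * (of_real x * z + of_real y) + of_real b * ?D) / ?D) /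
     ((of_real c * (of_real x * z + of_real y) + of_real d * ?D) / ?D)"
    by (simp only: moebius_def A B mat2_nth frac)
  also have "\<dots> = (of_real a * (of_real x * z + of_real y) + of_real b * ?D) /
     (of_real c * (of_real x * z + of_real y) + of_real d * ?D)"
    using D by simp
  also have "\<dots> = moebius (A ** B) z"
    by (simp add: moebius_def A B algebra_simps)
  finally show ?thesis by simp
qed

lemma moebius_neg [simp]: "moebius (- A) = moebius A"
proof
  fix z
  obtain a b c d where A: "A = mat2 a b c d" by (rule mat2_cases)
  have "moebius (- A) z = (- (of_real a * z + of_real b)) / (- (of_real c * z + of_real d))"
    by (simp add: moebius_def A)
  also have "\<dots> = moebius A z"
    unfolding minus_divide_divide by (simp add: moebius_def A)
  finally show "moebius (- A) z = moebius A z" .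
qed

lemma moebius_pm_eq: "A \<doteq> B \<Longrightarrow> moebius A = moebius B"
  by (auto simp: pm_eq_def)

lemma Im_moebius:
  assumes "A \<in> SL2" "z \<in> upper"
  shows "Im (moebius A z) = Im z / (cmod (of_real (A$2$1) * z + of_real (A$2$2)))\<^sup>2"
proof -
  have "A$1$1 * A$2$2 - A$1$2 * A$2$1 = 1" using assms by (simp add: SL2_iff)
  moreover have "(A$1$1 * Re z + A$1$2) * - (A$2$1 * Im z) + A$1$1 * Im z * (A$2$1 * Re z + A$2$2)
     = (A$1$1 * A$2$2 - A$1$2 * A$2$1) * Im z" by (simp add: algebra_simps)
  ultimately show ?thesis
    by (simp add: moebius_def Im_divide cmod_power2 algebra_simps)
qed

lemma moebius_upper: "A \<in> SL2 \<Longrightarrow> z \<in> upper \<Longrightarrow> moebius A z \<in> upper"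
  using moebius_denom[of A z] by (simp add: Im_moebius upper_def)

lemma moebius_adj:
  assumes "A \<in> SL2" "z \<in> upper"
  shows "moebius (adj A) (moebius A z) = z" "moebius A (moebius (adj A) z) = z"
  using assms moebius_mult[of "adj A" A z] moebius_mult[of A "adj A" z]
  by (simp_all add: adj_left adj_right moebius_mat_1)

lemma mem_moebius_image:
  assumes "A \<in> SL2" "X \<subseteq> upper"
  shows "z \<in> moebius A ` X \<longleftrightarrow> z \<in> upper \<and> moebius (adj A) z \<in> X"
proof
  assume "z \<in> moebius A ` X"
  thus "z \<in> upper \<and> moebius (adj A) z \<in> X"
    using assms by (auto simp: moebius_adj moebius_upper subset_iff)
next
  assume "z \<in> upper \<and> moebius (adj A) z \<in> X"
  thus "z \<in> moebius A ` X" using moebius_adj(2)[OF assms(1), of z] by (metis imageI)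
qed

lemma moebius_image_mult:
  assumes "A \<in> SL2" "B \<in> SL2" "X \<subseteq> upper"
  shows "moebius (A ** B) ` X = moebius A ` (moebius B ` X)"
  using assms by (auto simp: moebius_mult subset_iff image_image)

section \<open>The model triangle in real coordinates\<close>

definition imag_axis :: "complex set" where "imag_axis = {z. Im z > 0 \<and> Re z = 0}"

lemma imag_axis_upper: "imag_axis \<subseteq> upper"
  by (auto simp: imag_axis_def upper_def)

lemma ideal_triangle_upper: "ideal_triangle \<subseteq> upper"
  by (auto simp: ideal_triangle_def upper_def)

lemma cmod_half_iff:
  "cmod (z + 1/2) \<ge> 1/2 \<longleftrightarrow> (Re z)\<^sup>2 + (Im z)\<^sup>2 + Re z \<ge> 0"
  "cmod (z + 1/2) = 1/2 \<longleftrightarrow> (Re z)\<^sup>2 + (Im z)\<^sup>2 + Re z = 0"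
proof -
  have c: "(cmod (z + 1/2))\<^sup>2 = (Re z)\<^sup>2 + (Im z)\<^sup>2 + Re z + 1/4"
    unfolding cmod_power2 by (simp add: power2_eq_square algebra_simps)
  have "cmod (z + 1/2) \<ge> 1/2 \<longleftrightarrow> (cmod (z + 1/2))\<^sup>2 \<ge> (1/2)\<^sup>2"
    by (intro iffI power_mono) (auto dest: power2_le_imp_le)
  thus "cmod (z + 1/2) \<ge> 1/2 \<longleftrightarrow> (Re z)\<^sup>2 + (Im z)\<^sup>2 + Re z \<ge> 0"
    unfolding c by (simp add: power2_eq_square)
  have "cmod (z + 1/2) = 1/2 \<longleftrightarrow> (cmod (z + 1/2))\<^sup>2 = (1/2)\<^sup>2"
    by (subst power2_eq_iff_nonneg) auto
  thus "cmod (z + 1/2) = 1/2 \<longleftrightarrow> (Re z)\<^sup>2 + (Im z)\<^sup>2 + Re z = 0"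
    unfolding c by (auto simp: power2_eq_square field_simps)
qed

lemma ideal_triangle_iff:
  "z \<in> ideal_triangle \<longleftrightarrow> Im z > 0 \<and> -1 \<le> Re z \<and> Re z \<le> 0 \<and> (Re z)\<^sup>2 + (Im z)\<^sup>2 + Re z \<ge> 0"
  unfolding ideal_triangle_def mem_Collect_eq cmod_half_iff ..

lemma triangle_side_S2_iff:
  "z \<in> triangle_side S2 \<longleftrightarrow> Im z > 0 \<and> (Re z)\<^sup>2 + (Im z)\<^sup>2 + Re z = 0"
  unfolding triangle_side.simps mem_Collect_eq cmod_half_iff ..

lemma triangle_side_upper: "triangle_side s \<subseteq> upper"
  by (cases s) (auto simp: upper_def)

lemma triangle_side_subset: "triangle_side s \<subseteq> ideal_triangle"
proof
  fix z assume z: "z \<in> triangle_side s"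
  show "z \<in> ideal_triangle"
  proof (cases s)
    case S2
    hence *: "Im z > 0" "(Re z)\<^sup>2 + (Im z)\<^sup>2 + Re z = 0" using z triangle_side_S2_iff by auto
    hence "Re z * (Re z + 1) = - (Im z)\<^sup>2" by (simp add: power2_eq_square algebra_simps)
    hence "Re z * (Re z + 1) \<le> 0" by simp
    hence "-1 \<le> Re z \<and> Re z \<le> 0" by (auto simp: mult_le_0_iff)
    thus ?thesis using * by (simp add: ideal_triangle_iff)
  qed (use z in \<open>auto simp: ideal_triangle_iff\<close>)
qed

lemma triangle_side_disjoint:
  assumes "s \<noteq> s'"
  shows "triangle_side s \<inter> triangle_side s' = {}"
proof -
  have "z \<notin> triangle_side S2" if "z \<in> triangle_side S1 \<union> triangle_side S3" for z
    unfolding triangle_side_S2_iff using that by auto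
  moreover have "triangle_side S1 \<inter> triangle_side S3 = {}" by auto
  ultimately show ?thesis using assms by (cases s; cases s') blast+
qed

text \<open>Sides are classified by their labels: \<open>S1\<close>, \<open>S2\<close>, \<open>S3\<close> stand for the labels
  \<open>1\<close>, \<open>1/n\<close>, \<open>n\<close>. A tile of kind \<open>True\<close> has the labels \<open>(1, 1/n, n)\<close>, a tile of kind \<open>False\<close>
  the labels \<open>(1, 1, 1)\<close>.\<close>

definition side_class :: "bool \<Rightarrow> side \<Rightarrow> side" where
  "side_class q s = (if q then s else S1)"

definition tile_labels :: "nat \<Rightarrow> bool \<Rightarrow> labels" where
  "tile_labels n q = integral_labels (if q then n else 1)"

text \<open>With the horocycles at the two ends of a side scaled so that the sides with label \<open>1\<close> have
  their mark at height 1, the mark of any side has the same height seen from either end.\<close>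

definition height :: "nat \<Rightarrow> side \<Rightarrow> real" where
  "height n c = (if c = S1 then 1 else sqrt (real n))"

text \<open>The clockwise successor of a side: the vertices are passed in the order infinity, 0,
  -1.\<close>

fun nx :: "side \<Rightarrow> side" where
  "nx S3 = S2" | "nx S2 = S1" | "nx S1 = S3"

text \<open>The horocyclic length of the tile at the vertex between \<open>s\<close> and
  \<open>nx s\<close>, in the scaling of \<open>height\<close>. The long corner is at the vertex 0
  of an n-tile, where both sides have marks of height \<open>sqrt n\<close>.\<close>

definition corner :: "nat \<Rightarrow> bool \<Rightarrow> side \<Rightarrow> nat" where
  "corner n q s = (if q \<and> s = S3 then n else 1)"

text \<open>The frame of a side takes \<open>\<infinity>\<close> and \<open>0\<close> to its two ends, in clockwise order.\<close>

fun side_frame :: "nat \<Rightarrow> bool \<Rightarrow> side \<Rightarrow> real^2^2" where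
  "side_frame n q S3 = mat 1"
| "side_frame n q S2 = (let h = height n (side_class q S3) in mat2 0 (- h) (1 / h) h)"
| "side_frame n q S1 = mat2 (-1) (-1) 1 0"

lemma height_pos [simp]: "n \<ge> 1 \<Longrightarrow> height n c > 0"
  by (simp add: height_def)

lemma height_ne [simp]: "n \<ge> 1 \<Longrightarrow> height n c \<noteq> 0"
  by (simp add: height_def)

lemma height_square: "(height n c)\<^sup>2 = (if c = S1 then 1 else real n)"
  by (simp add: height_def)

lemma SL2_side_frame [simp]: "n \<ge> 1 \<Longrightarrow> side_frame n q s \<in> SL2"
  by (cases s) (auto simp: Let_def)

text \<open>The half-turn about the mark reverses the side, and the shift by the corner then turns
  it into the next side. At the long corner this rests on \<open>n / h = h\<close> for
  \<open>h = sqrt n\<close>.\<close>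

lemma side_frame_nx:
  assumes "n \<ge> 1"
  shows "side_frame n q (nx s) \<doteq>
    side_frame n q s ** turn (height n (side_class q s)) ** shift (corner n q s)"
proof -
  have "sqrt (real n) * sqrt (real n) = real n" by simp
  thus ?thesis using assms
    by (cases s; cases q)
      (auto simp: turn_def shift_def mat_1_mat2 pm_eq_def corner_def height_def side_class_def Let_def field_simps)
qed

lemma Re_div_eq_0: "z \<noteq> 0 \<Longrightarrow> Re (w / z) = 0 \<longleftrightarrow> Re w * Re z + Im w * Im z = 0"
  by (auto simp: Re_divide sum_power2_eq_zero_iff complex_eq_iff)

lemma triangle_side_frame:
  assumes "n \<ge> 1"
  shows "triangle_side s = moebius (side_frame n q s) ` imag_axis"
proof (subst set_eq_iff, rule allI)
  fix z
  have "z \<in> moebius (side_frame n q s) ` imag_axis \<longleftrightarrow>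
      z \<in> upper \<and> Re (moebius (adj (side_frame n q s)) z) = 0"
    using assms moebius_upper[of "adj (side_frame n q s)" z]
    by (subst mem_moebius_image) (auto simp: imag_axis_upper imag_axis_def upper_def)
  also have "\<dots> \<longleftrightarrow> z \<in> triangle_side s"
  proof (cases s)
    case S1
    thus ?thesis
      by (auto simp: upper_def moebius_def Re_div_eq_0 complex_eq_iff algebra_simps)
  next
    case S2
    define h where "h = height n (side_class q S3)"
    have h: "h > 0" using assms by (simp add: h_def)
    have "Re (moebius (adj (side_frame n q s)) z) = 0 \<longleftrightarrow> (Re z)\<^sup>2 + (Im z)\<^sup>2 + Re z = 0" if "Im z > 0"
    proof -
      have ne: "of_real (- (1 / h)) * z \<noteq> 0" using that h by (auto simp: complex_eq_iff)
      have "Re (moebius (adj (side_frame n q s)) z) = 0 \<longleftrightarrow>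
          - ((h * Re z + h) * (Re z / h)) - (h * Im z) * (Im z / h) = 0"
        using S2 Re_div_eq_0[OF ne, of "of_real h * z + of_real h"]
        by (simp add: moebius_def Let_def flip: h_def)
      also have "- ((h * Re z + h) * (Re z / h)) - (h * Im z) * (Im z / h) = - ((Re z)\<^sup>2 + (Im z)\<^sup>2 + Re z)"
        using h by (simp add: field_simps power2_eq_square)
      finally show ?thesis by auto
    qed
    thus ?thesis using S2 unfolding S2 triangle_side_S2_iff by (auto simp: upper_def)
  next
    case S3
    thus ?thesis by (auto simp: upper_def moebius_mat_1)
  qed
  finally show "z \<in> triangle_side s \<longleftrightarrow> z \<in> moebius (side_frame n q s) ` imag_axis" by simp
qed

lemma triangle_mark_frame:
  assumes "n \<ge> 1"
  shows "triangle_mark (tile_labels n q) s =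
    moebius (side_frame n q s) (Complex 0 (height n (side_class q s)))"
proof (cases "s = S2")
  case True
  define h where "h = height n (side_class q S3)"
  define k where "k = tile_labels n q S2"
  have h: "h > 0" using assms by (simp add: h_def)
  have hk: "height n (side_class q S2) = h" "k = 1 / h\<^sup>2"
    using assms by (auto simp: h_def k_def height_def side_class_def tile_labels_def integral_labels_def labels_def)
  have sk: "sqrt k = 1 / h" using h by (simp add: hk real_sqrt_divide)
  have k1: "1 + k = (h\<^sup>2 + 1) / h\<^sup>2" using h by (simp add: hk field_simps)
  have p: "h\<^sup>2 + 1 > 0" by (smt (verit) zero_le_power2)
  have "triangle_mark (tile_labels n q) S2 = Complex (- (h\<^sup>2 / (h\<^sup>2 + 1))) (h / (h\<^sup>2 + 1))"
    unfolding triangle_mark.simps k_def[symmetric] sk k1 using h by (simp add: power2_eq_square)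
  moreover have "moebius (side_frame n q S2) (Complex 0 h) = - of_real h / Complex h 1"
  proof -
    have "of_real (1 / h) * Complex 0 h + of_real h = Complex h 1"
      using h by (simp add: complex_eq_iff)
    thus ?thesis by (simp add: moebius_def Let_def flip: h_def)
  qed
  moreover have "- of_real h / Complex h 1 = Complex (- (h\<^sup>2 / (h\<^sup>2 + 1))) (h / (h\<^sup>2 + 1))"
    by (simp add: complex_eq_iff Re_divide Im_divide power2_eq_square)
  ultimately show ?thesis using True hk by simp
next
  case False
  thus ?thesis using assms
    by (cases s; cases q)
      (auto simp: tile_labels_def integral_labels_def labels_def side_class_def height_def moebius_mat_1
       moebius_def complex_eq_iff Re_divide Im_divide)
qed

text \<open>In the frame of one of its sides a tile lies between the imaginary axis and a vertical
  line at distance \<open>c \<le> n\<close> to its left, above a semicircle of diameter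
  \<open>c\<close>; height \<open>n\<close> clears the semicircle. This one witness for all frames
  later decides on which side of a geodesic a tile lies.\<close>

lemma inner_point:
  assumes "n \<ge> 1"
  shows "moebius (side_frame n q s) (Complex (-1/2) n) \<in> ideal_triangle"
proof (cases s)
  case S3
  have "(real n) * real n \<ge> 1 * 1" using assms by (intro mult_mono) auto
  thus ?thesis using S3 assms by (auto simp: moebius_mat_1 ideal_triangle_iff power2_eq_square)
next
  case S1
  let ?z = "moebius (side_frame n q s) (Complex (-1/2) n)"
  have up: "?z \<in> upper" using assms by (intro moebius_upper) (auto simp: upper_def)
  have z: "?z = (- Complex (-1/2) n - 1) / Complex (-1/2) n" using S1 by (simp add: moebius_def)
  have d: "(Re (Complex (-1/2) n))\<^sup>2 + (Im (Complex (-1/2) n))\<^sup>2 = 1/4 + (real n)\<^sup>2"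
    by (simp add: power2_eq_square)
  have Re: "Re ?z = (1/4 - (real n)\<^sup>2) / (1/4 + (real n)\<^sup>2)"
    unfolding z Re_divide d by (simp add: power2_eq_square)
  have Im: "Im ?z = real n / (1/4 + (real n)\<^sup>2)"
    unfolding z Im_divide d by (simp add: power2_eq_square)
  have n2: "(real n)\<^sup>2 \<ge> 1" using assms by simp
  have p: "1/4 + (real n)\<^sup>2 > 0" using n2 by linarith
  have "-1 \<le> Re ?z" "Re ?z \<le> 0" unfolding Re using p n2 by (simp_all add: field_simps)
  moreover have "(Re ?z)\<^sup>2 + (Im ?z)\<^sup>2 + Re ?z = ((1/4 - (real n)\<^sup>2)\<^sup>2 + (real n)\<^sup>2 +
     (1/4 - (real n)\<^sup>2) * (1/4 + (real n)\<^sup>2)) / (1/4 + (real n)\<^sup>2)\<^sup>2"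
    unfolding Re Im using p by (simp add: power_divide add_divide_distrib power2_eq_square)
  moreover have "(1/4 - (real n)\<^sup>2)\<^sup>2 + (real n)\<^sup>2 + (1/4 - (real n)\<^sup>2) * (1/4 + (real n)\<^sup>2)
     = 1/8 + (real n)\<^sup>2 / 2" by (simp add: power2_eq_square algebra_simps)
  ultimately show ?thesis using up by (simp add: ideal_triangle_iff upper_def)
next
  case S2
  let ?z = "moebius (side_frame n q s) (Complex (-1/2) n)"
  define h where "h = height n (side_class q S3)"
  have h: "h > 0" using assms by (simp add: h_def)
  \<comment> \<open>This is the width of the corner at which the frame puts infinity, hence 1 or
    \<open>n\<close>.\<close>
  define k where "k = h\<^sup>2"
  have k: "1 \<le> k" "k \<le> n" using assms unfolding k_def h_def height_square by auto
  have up: "?z \<in> upper" using assms by (intro moebius_upper) (auto simp: upper_def)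
  have ne: "Complex (k - 1/2) n \<noteq> 0" using k by (auto simp: complex_eq_iff)
  have "of_real (1 / h) * Complex (-1/2) n + of_real h = of_real (1 / h) * Complex (k - 1/2) n"
    using h by (simp add: complex_eq_iff k_def field_simps power2_eq_square)
  hence "?z = - of_real h / (of_real (1 / h) * Complex (k - 1/2) n)"
    using S2 by (simp add: moebius_def Let_def flip: h_def)
  also have "\<dots> = - of_real k / Complex (k - 1/2) n"
    using ne h by (simp add: k_def field_simps power2_eq_square)
  finally have z: "?z = - of_real k / Complex (k - 1/2) n" .
  define D where "D = (k - 1/2)\<^sup>2 + (real n)\<^sup>2"
  have D: "D > 0" "D \<ge> k * (k - 1/2)" "D \<ge> k / 2"
  proof -
    have 1: "(k - 1/2)\<^sup>2 \<ge> 0" by simp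
    have 2: "(real n)\<^sup>2 \<ge> k * k" unfolding power2_eq_square using k by (intro mult_mono) auto
    have 3: "k * k \<ge> k * 1" using k by (intro mult_left_mono) auto
    show "D > 0" unfolding D_def using 1 2 3 k by linarith
    show "D \<ge> k * (k - 1/2)" unfolding D_def right_diff_distrib using 1 2 3 k by linarith
    show "D \<ge> k / 2" unfolding D_def using 1 2 3 k by linarith
  qed
  have Re: "Re ?z = - (k * (k - 1/2)) / D" unfolding z Re_divide by (simp add: D_def)
  have Im: "Im ?z = k * n / D" unfolding z Im_divide by (simp add: D_def)
  have "-1 \<le> Re ?z" "Re ?z \<le> 0" unfolding Re using D k by (simp_all add: field_simps)
  moreover have "(Re ?z)\<^sup>2 + (Im ?z)\<^sup>2 = k\<^sup>2 * D / D\<^sup>2"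
    unfolding Re Im by (simp add: D_def power_divide power_mult_distrib add_divide_distrib [symmetric] distrib_left)
  moreover have "k\<^sup>2 * D / D\<^sup>2 = k\<^sup>2 / D" using D by (simp add: power2_eq_square)
  moreover have "k\<^sup>2 / D + Re ?z = k / 2 / D" unfolding Re using D by (simp add: field_simps power2_eq_square)
  ultimately show ?thesis using up D k by (simp add: ideal_triangle_iff upper_def)
qed

section \<open>Gluing\<close>

definition kind :: "tile \<Rightarrow> bool" where
  "kind t \<longleftrightarrow> fst t \<noteq> integral_labels 1"

definition frame :: "nat \<Rightarrow> tile \<Rightarrow> side \<Rightarrow> real^2^2" where
  "frame n t s = snd t ** side_frame n (kind t) s"

definition tclass :: "tile \<Rightarrow> side \<Rightarrow> side" where
  "tclass t s = side_class (kind t) s"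

definition admissible :: "nat \<Rightarrow> tile \<Rightarrow> bool" where
  "admissible n t \<longleftrightarrow> fst t \<in> {integral_labels 1, integral_labels n} \<and> snd t \<in> SL2"

lemma integral_labels_inj: "n \<ge> 2 \<Longrightarrow> integral_labels n s = integral_labels n s' \<Longrightarrow> s = s'"
  using mult_mono[of 2 "real n" 2 "real n"]
  by (cases s; cases s') (auto simp: integral_labels_def labels_def field_simps)

lemma integral_labels_1: "integral_labels 1 s = 1"
  by (cases s) (auto simp: integral_labels_def labels_def)

lemma integral_labels_S1: "integral_labels n S1 = 1"
  by (simp add: integral_labels_def labels_def)

lemma integral_labels_ne: "n \<ge> 2 \<Longrightarrow> integral_labels n \<noteq> integral_labels 1"
  using integral_labels_inj[of n S1 S2] integral_labels_1 by auto

lemma admissible_labels: "admissible n t \<Longrightarrow> fst t = tile_labels n (kind t)"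
  by (auto simp: admissible_def tile_labels_def kind_def)

lemma label_class:
  assumes "n \<ge> 2" "admissible n t"
  shows "fst t s = integral_labels n (tclass t s)"
  using assms by (auto simp: admissible_def tclass_def side_class_def kind_def integral_labels_1 integral_labels_S1
      simp del: One_nat_def)

lemma SL2_frame [simp]: "n \<ge> 1 \<Longrightarrow> admissible n t \<Longrightarrow> frame n t s \<in> SL2"
  by (simp add: frame_def admissible_def)

lemma tile_side_frame:
  assumes "n \<ge> 1" "admissible n t"
  shows "tile_side t s = moebius (frame n t s) ` imag_axis"
  using assms unfolding tile_side_def frame_def admissible_def
  by (simp add: triangle_side_frame[of n s "kind t"] moebius_image_mult imag_axis_upper)

lemma tile_mark_frame:
  assumes "n \<ge> 1" "admissible n t"
  shows "tile_mark t s = moebius (frame n t s) (Complex 0 (height n (tclass t s)))"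
  using assms unfolding tile_mark_def frame_def admissible_labels[OF assms(2)] tclass_def
  by (subst triangle_mark_frame[OF assms(1)], subst moebius_mult) (auto simp: admissible_def upper_def)

lemma frame_inner_point:
  assumes "n \<ge> 1" "admissible n t"
  shows "moebius (frame n t s) (Complex (-1/2) n) \<in> tile_region t"
  using assms inner_point[OF assms(1), of "kind t" s] unfolding tile_region_def frame_def
  by (subst moebius_mult) (auto simp: admissible_def upper_def)

lemma frame_inner_point_side:
  assumes "n \<ge> 1" "admissible n t"
  shows "moebius (frame n t s) (Complex (-1/2) n) \<notin> tile_side t s"
proof -
  have "Complex (-1/2) n \<in> upper" using assms by (simp add: upper_def)
  thus ?thesis using assms unfolding tile_side_frame[OF assms]
    by (subst mem_moebius_image, auto simp: imag_axis_upper moebius_adj, auto simp: imag_axis_def)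
qed

lemma tile_side_subset: "tile_side t s \<subseteq> tile_region t"
  using triangle_side_subset by (auto simp: tile_side_def tile_region_def)

lemma tile_side_disjoint:
  assumes "snd t \<in> SL2" "s \<noteq> s'"
  shows "tile_side t s \<inter> tile_side t s' = {}"
proof -
  have "moebius (adj (snd t)) z \<in> triangle_side s \<inter> triangle_side s'"
    if "z \<in> tile_side t s \<inter> tile_side t s'" for z
    using that assms(1) unfolding tile_side_def by (simp add: mem_moebius_image triangle_side_upper)
  thus ?thesis using triangle_side_disjoint[OF assms(2)] by blast
qed

lemma tile_side_nonempty: "n \<ge> 1 \<Longrightarrow> admissible n t \<Longrightarrow> tile_side t s \<noteq> {}"
  by (auto simp: tile_side_frame imag_axis_def intro!: exI[of _ "Complex 0 1"])

lemma tile_side_inj: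
  assumes "n \<ge> 1" "admissible n t" "tile_side t s \<subseteq> tile_side t s'"
  shows "s = s'"
  using tile_side_disjoint[of t s s'] tile_side_nonempty[OF assms(1,2), of s] assms by (auto simp: admissible_def)

text \<open>The fixed point gives \<open>a = d\<close> and \<open>b = - h^2 c\<close>; two points of
  the axis then suffice for \<open>a * c = 0\<close>, so the matrix is diagonal or
  antidiagonal.\<close>

lemma axis_stabilizer:
  assumes M: "M \<in> SL2" and h: "h > 0" and fix_pt: "moebius M (Complex 0 h) = Complex 0 h"
    and axis: "\<And>z. z \<in> imag_axis \<Longrightarrow> moebius M z \<in> imag_axis"
  shows "M \<doteq> mat 1 \<or> M \<doteq> turn h"
proof -
  obtain a b c d where M': "M = mat2 a b c d" by (rule mat2_cases)
  have det: "a * d - b * c = 1" using M M' by simp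
  have "of_real a * Complex 0 h + of_real b = Complex 0 h * (of_real c * Complex 0 h + of_real d)"
    using fix_pt moebius_denom[OF M, of "Complex 0 h"] h by (simp add: moebius_def M' nonzero_divide_eq_eq)
  hence b: "b = - (h * h * c)" and ad: "a = d" using h by (auto simp: complex_eq_iff)
  have re: "b * d + a * c * y\<^sup>2 = 0" if "y > 0" for y
  proof -
    have ne: "of_real c * Complex 0 y + of_real d \<noteq> (0::complex)"
      using moebius_denom[OF M, of "Complex 0 y"] that M' by simp
    have "Re (moebius M (Complex 0 y)) = 0" using axis[of "Complex 0 y"] that by (simp add: imag_axis_def)
    thus ?thesis using Re_div_eq_0[OF ne, of "of_real a * Complex 0 y + of_real b"] M'
      by (simp add: moebius_def power2_eq_square algebra_simps)
  qed
  have "a * c = 0" using re[of 1] re[of 2] by (simp only: power2_eq_square) linarith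
  thus ?thesis
  proof (elim disjE[OF iffD1[OF mult_eq_0_iff]])
    assume "c = 0"
    hence "a * a = 1" using det b ad by simp
    hence "a = 1 \<or> a = -1" by (simp add: square_eq_1_iff)
    thus ?thesis using \<open>c = 0\<close> b ad M' by (auto simp: pm_eq_def mat_1_mat2)
  next
    assume "a = 0"
    hence "(h * c) * (h * c) = 1" using det b by (simp add: algebra_simps)
    hence "h * c = 1 \<or> h * c = -1" by (simp add: square_eq_1_iff)
    hence "c = 1 / h \<or> c = - (1 / h)" using h by (auto simp: field_simps)
    thus ?thesis using \<open>a = 0\<close> b ad M' h by (auto simp: pm_eq_def turn_def)
  qed
qed

text \<open>The change of frame \<open>M\<close> preserves the side and fixes the mark, so it is
  trivial or the half-turn about the mark. If it were trivial, both tiles would contain the same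
  inner point off the side.\<close>

lemma glued_frame:
  assumes n: "n \<ge> 2" and t: "admissible n t" and t': "admissible n t'" and g: "glued t s t' s'"
  shows "tclass t' s' = tclass t s" "frame n t' s' \<doteq> frame n t s ** turn (height n (tclass t s))"
proof -
  have n1: "n \<ge> 1" using n by simp
  show cl: "tclass t' s' = tclass t s"
    using g integral_labels_inj[OF n] label_class[OF n] t t' unfolding glued_def by metis
  define F F' h where "F = frame n t s" and "F' = frame n t' s'" and "h = height n (tclass t s)"
  have F: "F \<in> SL2" "F' \<in> SL2" using n t t' by (simp_all add: F_def F'_def)
  have h: "h > 0" using n by (simp add: h_def)
  define M where "M = adj F ** F'"
  have M: "M \<in> SL2" using F by (simp add: M_def)
  have FM: "F' = F ** M" using F by (simp add: M_def adj_right_assoc)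
  have fp: "moebius M (Complex 0 h) = Complex 0 h"
  proof -
    have up: "Complex 0 h \<in> upper" using h by (simp add: upper_def)
    have "moebius F (Complex 0 h) = moebius F' (Complex 0 h)"
      using g tile_mark_frame[OF n1 t] tile_mark_frame[OF n1 t'] cl
      unfolding glued_def F_def F'_def h_def by metis
    thus ?thesis using F up unfolding M_def
      by (metis SL2_adj moebius_mult moebius_adj(1))
  qed
  have ax: "moebius M z \<in> imag_axis" if "z \<in> imag_axis" for z
  proof -
    have up: "z \<in> upper" using that imag_axis_upper by blast
    have "moebius F' z \<in> moebius F ` imag_axis"
      using g tile_side_frame[OF n1 t] tile_side_frame[OF n1 t'] that
      unfolding glued_def F_def F'_def by blast
    hence "moebius (adj F) (moebius F' z) \<in> imag_axis"
      using F mem_moebius_image[OF F(1) imag_axis_upper] by blast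
    thus ?thesis using F up by (simp add: M_def moebius_mult)
  qed
  have "\<not> M \<doteq> mat 1"
  proof
    assume "M \<doteq> mat 1"
    hence "F' \<doteq> F" unfolding FM by (metis matrix_mul_rid pm_eq_mult pm_eq_refl)
    hence "moebius F' = moebius F" by (rule moebius_pm_eq)
    hence "moebius F (Complex (-1/2) n) \<in> tile_region t \<inter> tile_region t'"
      using frame_inner_point[OF n1 t, of s] frame_inner_point[OF n1 t', of s'] by (simp add: F_def F'_def)
    hence "moebius F (Complex (-1/2) n) \<in> tile_side t s" using g unfolding glued_def by blast
    thus False using frame_inner_point_side[OF n1 t, of s] by (simp add: F_def)
  qed
  hence "M \<doteq> turn h" using axis_stabilizer[OF M h fp ax] by blast
  thus "frame n t' s' \<doteq> frame n t s ** turn (height n (tclass t s))"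
    using FM pm_eq_mult[OF pm_eq_refl, of M "turn h" F] by (simp add: F_def F'_def h_def)
qed

section \<open>The boundary while tiles are added\<close>

definition boundary :: "tile set \<Rightarrow> (tile \<times> side) set" where
  "boundary J = {(t, s). t \<in> J \<and> (\<forall>t'\<in>J. \<forall>s'. t' \<noteq> t \<longrightarrow> tile_side t' s' \<noteq> tile_side t s)}"

lemma boundary_marks_eq: "boundary_marks J = (\<lambda>(t, s). tile_mark t s) ` boundary J"
  by (auto simp: boundary_marks_def boundary_def)

text \<open>The invariant of the assembly. It concerns all pairs of tiles with a common side, since
  \<open>assembled\<close> itself only relates each new tile to one older tile.\<close>

definition matched :: "nat \<Rightarrow> tile set \<Rightarrow> bool" where
  "matched n J \<longleftrightarrow> (\<forall>t\<in>J. admissible n t) \<and>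
     (\<forall>t\<in>J. \<forall>u\<in>J. \<forall>s s'. t \<noteq> u \<longrightarrow> tile_side t s = tile_side u s' \<longrightarrow>
        frame n u s' \<doteq> frame n t s ** turn (height n (tclass t s)))"

lemma glue_step:
  assumes n: "n \<ge> 2" and J: "matched n J" and t: "t \<in> J" and t': "admissible n t'"
    and g: "glued t s t' s'" and region: "(\<Union>u\<in>J. tile_region u) \<inter> tile_region t' = tile_side t s"
  shows "t' \<notin> J" "(t, s) \<in> boundary J"
    "boundary (insert t' J) = boundary J - {(t, s)} \<union> {(t', x) | x. x \<noteq> s'}"
    "matched n (insert t' J)"
proof -
  have n1: "n \<ge> 1" using n by simp
  have adm: "admissible n u" if "u \<in> J" for u using J that by (simp add: matched_def)
  have side: "tile_side t s = tile_side t' s'" using g by (simp add: glued_def)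
  have fr: "frame n t' s' \<doteq> frame n t s ** turn (height n (tclass t s))"
    using glued_frame[OF n adm[OF t] t' g] by blast
  show notin: "t' \<notin> J"
  proof
    assume "t' \<in> J"
    hence "moebius (frame n t' s') (Complex (-1/2) n) \<in> tile_side t s"
      using frame_inner_point[OF n1 t', of s'] region by auto
    thus False using frame_inner_point_side[OF n1 t', of s'] side by simp
  qed
  \<comment> \<open>A second old tile along this side would have the frame of the new tile up to
    sign, hence contain its inner point, which lies off the side.\<close>
  have bd: "tile_side u x \<noteq> tile_side t s" if "u \<in> J" "u \<noteq> t" for u x
  proof
    assume *: "tile_side u x = tile_side t s"
    hence "frame n u x \<doteq> frame n t s ** turn (height n (tclass t s))"
      using J that t unfolding matched_def by metis
    hence "frame n u x \<doteq> frame n t' s'" using fr pm_eq_sym pm_eq_trans by blast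
    hence "moebius (frame n u x) = moebius (frame n t' s')" by (rule moebius_pm_eq)
    hence "moebius (frame n t' s') (Complex (-1/2) n) \<in> tile_side t s"
      using frame_inner_point[OF n1 t', of s'] frame_inner_point[OF n1 adm[OF that(1)], of x] region that by auto
    thus False using frame_inner_point_side[OF n1 t', of s'] side by simp
  qed
  thus bts: "(t, s) \<in> boundary J" using t by (auto simp: boundary_def)
  \<comment> \<open>A common side lies in the intersection of the regions, which is the glued side,
    and different sides of one tile are disjoint.\<close>
  have new: "u = t \<and> x = s \<and> y = s'" if "u \<in> J" "tile_side u x = tile_side t' y" for u x y
  proof -
    have "tile_side t' y \<subseteq> tile_side t s"
      using region that tile_side_subset[of u x] tile_side_subset[of t' y] by blast
    hence y: "y = s'" using tile_side_inj[OF n1 t'] side by simp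
    hence "tile_side u x = tile_side t s" using that side by simp
    moreover hence "u = t" using bd that by blast
    ultimately show ?thesis using tile_side_inj[OF n1 adm[OF t], of x s] y by simp
  qed
  show "boundary (insert t' J) = boundary J - {(t, s)} \<union> {(t', x) | x. x \<noteq> s'}"
  proof (intro equalityI subsetI)
    fix p assume p: "p \<in> boundary (insert t' J)"
    obtain u x where px: "p = (u, x)" by (cases p)
    show "p \<in> boundary J - {(t, s)} \<union> {(t', x) | x. x \<noteq> s'}"
    proof (cases "u = t'")
      case True
      have "x \<noteq> s'" using p px True t notin side by (auto simp: boundary_def)
      thus ?thesis using px True by auto
    next
      case False
      hence "p \<in> boundary J" "p \<noteq> (t, s)" using p px side by (auto simp: boundary_def)
      thus ?thesis by blast
    qed
  next
    fix p assume p: "p \<in> boundary J - {(t, s)} \<union> {(t', x) | x. x \<noteq> s'}"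
    thus "p \<in> boundary (insert t' J)"
    proof
      assume p: "p \<in> boundary J - {(t, s)}"
      obtain u x where px: "p = (u, x)" by (cases p)
      have "tile_side t' y \<noteq> tile_side u x" for y
        using new[of u x y] p px by (auto simp: boundary_def)
      thus ?thesis using p px by (auto simp: boundary_def)
    next
      assume "p \<in> {(t', x) | x. x \<noteq> s'}"
      then obtain x where px: "p = (t', x)" "x \<noteq> s'" by blast
      have "tile_side u y \<noteq> tile_side t' x" if "u \<in> J" for u y using new[of u y x] that px by blast
      thus ?thesis using px by (auto simp: boundary_def)
    qed
  qed
  show "matched n (insert t' J)"
    unfolding matched_def
  proof (intro conjI ballI allI impI)
    show "admissible n u" if "u \<in> insert t' J" for u using that t' adm[of u] by fastforce
    fix u v x y assume *: "u \<in> insert t' J" "v \<in> insert t' J" "u \<noteq> v" "tile_side u x = tile_side v y"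
    consider "u \<in> J" "v \<in> J" | "u \<in> J" "v = t'" | "u = t'" "v \<in> J" using * by auto
    thus "frame n v y \<doteq> frame n u x ** turn (height n (tclass u x))"
    proof cases
      case 1
      thus ?thesis using J * by (auto simp: matched_def)
    next
      case 2
      thus ?thesis using new[of u x y] * fr by simp
    next
      case 3
      hence vy: "v = t" "y = s" "x = s'" using new[of v y x] * by auto
      have cl: "tclass t' s' = tclass t s" using glued_frame[OF n adm[OF t] t' g] by blast
      let ?h = "height n (tclass t s)"
      have "frame n t' s' ** turn ?h \<doteq> frame n t s ** turn ?h ** turn ?h"
        using fr by (simp add: pm_eq_mult)
      also have "frame n t s ** turn ?h ** turn ?h = - frame n t s"
        using n turn_turn[of ?h] by (simp flip: matrix_mul_assoc)
      finally show ?thesis using vy 3 cl pm_eq_sym by simp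
    qed
  qed
qed

lemma assembled_matched:
  assumes "n \<ge> 2" "assembled {integral_labels 1, integral_labels n} J"
  shows "matched n J"
  using assms(2)
proof induction
  case (single k A)
  have "frame n (k, A) s' \<doteq> frame n (k, A) s ** turn x" if "(k, A) \<noteq> (k, A)" for s s' x using that by simp
  thus ?case using single by (auto simp: matched_def admissible_def)
next
  case (glue J t k A s s')
  thus ?case using assms(1) by (intro glue_step(4)[OF assms(1)]) (auto simp: admissible_def)
qed

section \<open>Polygons as pairs of binary trees\<close>

text \<open>A branch is what lies beyond a side, dually a binary tree: either nothing, or a tile of the
  given kind attached along the given side together with the branches beyond its two other sides,
  in clockwise order. A polygon is cut by any of its sides into two branches.\<close>

datatype branch = Leaf side | Node bool side branch branch

fun bclass :: "branch \<Rightarrow> side" where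
  "bclass (Leaf c) = c"
| "bclass (Node q s b1 b2) = side_class q s"

fun wf_branch :: "branch \<Rightarrow> bool" where
  "wf_branch (Leaf c) \<longleftrightarrow> True"
| "wf_branch (Node q s b1 b2) \<longleftrightarrow> bclass b1 = side_class q (nx s) \<and>
     bclass b2 = side_class q (nx (nx s)) \<and> wf_branch b1 \<and> wf_branch b2"

fun kinds :: "branch \<Rightarrow> bool set" where
  "kinds (Leaf c) = {}"
| "kinds (Node q s b1 b2) = insert q (kinds b1 \<union> kinds b2)"

text \<open>The \<open>width\<close> is the horocyclic length of all the corners of the tiles in a branch; unrolling
  the horocycle at one vertex through the whole boundary places the marks of the boundary sides at
  the integer positions \<open>leaves\<close>.\<close>

fun width :: "nat \<Rightarrow> branch \<Rightarrow> int" where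
  "width n (Leaf c) = 0"
| "width n (Node q s b1 b2) = int (corner n q s) + width n b1 + int (corner n q (nx s)) +
     width n b2 + int (corner n q (nx (nx s)))"

fun leaves :: "nat \<Rightarrow> int \<Rightarrow> branch \<Rightarrow> (side \<times> int) set" where
  "leaves n x (Leaf c) = {(c, x)}"
| "leaves n x (Node q s b1 b2) = leaves n (x + int (corner n q s)) b1 \<union>
     leaves n (x + int (corner n q s) + width n b1 + int (corner n q (nx s))) b2"

text \<open>\<open>F\<close> is the frame of the entry side seen from the near side. Passing to the
  far side and running along it to the next vertex takes two half-turns, which cancel up to sign; so
  the first far side is reached by a shift alone. The list follows the boundary.\<close>

fun leaf_frames :: "nat \<Rightarrow> real^2^2 \<Rightarrow> branch \<Rightarrow> (side \<times> (real^2^2)) list" where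
  "leaf_frames n F (Leaf c) = [(c, F)]"
| "leaf_frames n F (Node q s b1 b2) = (let F1 = F ** shift (corner n q s) in
     leaf_frames n F1 b1 @
     leaf_frames n (F1 ** turn (height n (side_class q (nx s))) ** shift (corner n q (nx s))) b2)"

definition glued_frames :: "nat \<Rightarrow> real^2^2 \<Rightarrow> bool \<Rightarrow> side \<Rightarrow> (side \<times> (real^2^2)) list" where
  "glued_frames n G q s = (let G1 = G ** shift (corner n q s) in
     [(side_class q (nx s), G1), (side_class q (nx (nx s)),
       G1 ** turn (height n (side_class q (nx s))) ** shift (corner n q (nx s)))])"

text \<open>Growth is local: one entry of the list is replaced by two, and the frames before and
  after it are not affected.\<close>

lemma leaf_frames_grow:
  assumes "wf_branch b" "leaf_frames n F b = xs @ (c, G) # ys" "side_class q s = c"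
  shows "\<exists>b'. wf_branch b' \<and> bclass b' = bclass b \<and> kinds b' = insert q (kinds b) \<and>
     leaf_frames n F b' = xs @ glued_frames n G q s @ ys"
  using assms(1,2)
proof (induction b arbitrary: F xs ys)
  case (Leaf d)
  hence "xs = []" "ys = []" "d = c" "G = F" by (auto simp: Cons_eq_append_conv)
  thus ?case using assms(3)
    by (intro exI[of _ "Node q s (Leaf (side_class q (nx s))) (Leaf (side_class q (nx (nx s))))"])
      (simp add: Let_def glued_frames_def)
next
  case (Node p r b1 b2)
  define F1 where "F1 = F ** shift (corner n p r)"
  define F2 where "F2 = F1 ** turn (height n (side_class p (nx r))) ** shift (corner n p (nx r))"
  have split: "leaf_frames n F1 b1 @ leaf_frames n F2 b2 = xs @ (c, G) # ys"
    using Node.prems(2) by (simp add: Let_def F1_def F2_def)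
  then consider us where "leaf_frames n F1 b1 = xs @ (c, G) # us" "ys = us @ leaf_frames n F2 b2"
    | us where "xs = leaf_frames n F1 b1 @ us" "leaf_frames n F2 b2 = us @ (c, G) # ys"
    by (auto simp: append_eq_append_conv2 Cons_eq_append_conv append_eq_Cons_conv)
  thus ?case
  proof cases
    case 1
    then obtain b' where "wf_branch b' \<and> bclass b' = bclass b1 \<and> kinds b' = insert q (kinds b1) \<and>
     leaf_frames n F1 b' = xs @ glued_frames n G q s @ us"
      using Node.IH(1) Node.prems(1) by fastforce
    thus ?thesis using Node.prems(1) 1
      by (intro exI[of _ "Node p r b' b2"]) (auto simp: Let_def F1_def F2_def)
  next
    case 2
    then obtain b' where "wf_branch b' \<and> bclass b' = bclass b2 \<and> kinds b' = insert q (kinds b2) \<and>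
     leaf_frames n F2 b' = us @ glued_frames n G q s @ ys"
      using Node.IH(2) Node.prems(1) by fastforce
    thus ?thesis using Node.prems(1) 2
      by (intro exI[of _ "Node p r b1 b'"]) (auto simp: Let_def F1_def F2_def)
  qed
qed

definition polygon :: "branch \<Rightarrow> branch \<Rightarrow> bool" where
  "polygon b b' \<longleftrightarrow> wf_branch b \<and> wf_branch b' \<and> bclass b' = bclass b"

text \<open>\<open>b\<close> lies beyond the cut as seen from \<open>F\<close>, and
  \<open>b'\<close> as seen from the other side, whence the half-turn.\<close>

definition polygon_frames :: "nat \<Rightarrow> real^2^2 \<Rightarrow> branch \<Rightarrow> branch \<Rightarrow> (side \<times> (real^2^2)) list" where
  "polygon_frames n F b b' = leaf_frames n F b @ leaf_frames n (F ** turn (height n (bclass b))) b'"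

lemma polygon_frames_grow:
  assumes "polygon b b'" "polygon_frames n F b b' = xs @ (c, G) # ys" "side_class q s = c"
  shows "\<exists>d d'. polygon d d' \<and> kinds d \<union> kinds d' = insert q (kinds b \<union> kinds b') \<and>
     polygon_frames n F d d' = xs @ glued_frames n G q s @ ys"
proof -
  let ?F = "F ** turn (height n (bclass b))"
  have wf: "wf_branch b" "wf_branch b'" using assms(1) by (auto simp: polygon_def)
  consider us where "leaf_frames n F b = xs @ (c, G) # us" "ys = us @ leaf_frames n ?F b'"
    | us where "xs = leaf_frames n F b @ us" "leaf_frames n ?F b' = us @ (c, G) # ys"
    using assms(2) unfolding polygon_frames_def
    by (auto simp: append_eq_append_conv2 Cons_eq_append_conv append_eq_Cons_conv)
  thus ?thesis
  proof cases
    case 1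
    from leaf_frames_grow[OF wf(1) this(1) assms(3)] obtain d where
      "wf_branch d" "bclass d = bclass b" "kinds d = insert q (kinds b)"
      "leaf_frames n F d = xs @ glued_frames n G q s @ us" by blast
    thus ?thesis using assms(1) 1
      by (intro exI[of _ d] exI[of _ b']) (simp add: polygon_def polygon_frames_def)
  next
    case 2
    from leaf_frames_grow[OF wf(2) this(2) assms(3)] obtain d where
      "wf_branch d" "bclass d = bclass b'" "kinds d = insert q (kinds b')"
      "leaf_frames n ?F d = us @ glued_frames n G q s @ ys" by blast
    thus ?thesis using assms(1) 2
      by (intro exI[of _ b] exI[of _ d]) (simp add: polygon_def polygon_frames_def)
  qed
qed

definition same_frame :: "nat \<Rightarrow> tile \<times> side \<Rightarrow> side \<times> (real^2^2) \<Rightarrow> bool" where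
  "same_frame n p r \<longleftrightarrow> tclass (fst p) (snd p) = fst r \<and> frame n (fst p) (snd p) \<doteq> snd r"

lemma frame_nx:
  assumes "n \<ge> 1"
  shows "frame n t (nx s) \<doteq> frame n t s ** turn (height n (tclass t s)) ** shift (corner n (kind t) s)"
  using side_frame_nx[OF assms, of "kind t" s] pm_eq_mult[OF pm_eq_refl]
  unfolding frame_def tclass_def by (metis matrix_mul_assoc)

lemma tile_sides_frames:
  assumes "n \<ge> 1" "frame n t s \<doteq> G ** turn (height n (tclass t s))"
  shows "frame n t (nx s) \<doteq> G ** shift (corner n (kind t) s)"
    "frame n t (nx (nx s)) \<doteq> G ** shift (corner n (kind t) s) **
      turn (height n (tclass t (nx s))) ** shift (corner n (kind t) (nx s))"
proof -
  let ?h = "height n (tclass t s)"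
  have "frame n t s ** turn ?h ** shift (corner n (kind t) s) \<doteq>
      G ** turn ?h ** turn ?h ** shift (corner n (kind t) s)"
    by (intro pm_eq_mult pm_eq_refl assms(2))
  also have "G ** turn ?h ** turn ?h ** shift (corner n (kind t) s) = - (G ** shift (corner n (kind t) s))"
    using assms(1) by (simp add: turn_turn flip: matrix_mul_assoc[of G])
  finally show 1: "frame n t (nx s) \<doteq> G ** shift (corner n (kind t) s)"
    using frame_nx[OF assms(1), of t s] pm_eq_trans by simp
  show "frame n t (nx (nx s)) \<doteq> G ** shift (corner n (kind t) s) **
      turn (height n (tclass t (nx s))) ** shift (corner n (kind t) (nx s))"
    by (rule pm_eq_trans[OF frame_nx[OF assms(1)]]) (intro pm_eq_mult 1 pm_eq_refl)
qed

definition framing :: "nat \<Rightarrow> tile set \<Rightarrow> (side \<times> (real^2^2)) list \<Rightarrow> bool" where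
  "framing n J L \<longleftrightarrow> (\<exists>ps. distinct ps \<and> set ps = boundary J \<and> list_all2 (same_frame n) ps L)"

lemma side_cases: "s = r \<or> s = nx r \<or> s = nx (nx r)"
  by (cases r; cases s) auto

lemma nx_ne [simp]: "nx s \<noteq> s" "nx (nx s) \<noteq> s" "s \<noteq> nx s" "s \<noteq> nx (nx s)"
  by (cases s; simp)+

lemma assembled_polygon:
  assumes n: "n \<ge> 2" and "assembled {integral_labels 1, integral_labels n} J"
  shows "\<exists>F b b'. F \<in> SL2 \<and> polygon b b' \<and> kinds b \<union> kinds b' = kind ` J \<and>
    framing n J (polygon_frames n F b b')"
  using assms(2)
proof induction
  case (single k A)
  define t where "t = (k, A)"
  have n1: "n \<ge> 1" using n by simp
  have adm: "admissible n t" using single by (auto simp: admissible_def t_def)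
  \<comment> \<open>A single tile is cut along its side \<open>S1\<close>: nothing lies beyond it,
    and the tile itself is the other branch.\<close>
  define F where "F = frame n t S1"
  define b' where "b' = Node (kind t) S1 (Leaf (tclass t S3)) (Leaf (tclass t S2))"
  have "F \<doteq> (F ** turn (height n (tclass t S1))) ** turn (height n (tclass t S1))"
    using n by (simp add: turn_turn flip: matrix_mul_assoc[of F])
  note fr = tile_sides_frames[OF n1 this[unfolded F_def]]
  have "list_all2 (same_frame n) [(t, S1), (t, S3), (t, S2)] (polygon_frames n F (Leaf (tclass t S1)) b')"
    using fr by (simp add: same_frame_def polygon_frames_def b'_def Let_def tclass_def F_def)
  moreover have "boundary {t} = {(t, S1), (t, S2), (t, S3)}"
    using side_cases[of _ S1] by (auto simp: boundary_def)
  ultimately have "framing n {t} (polygon_frames n F (Leaf (tclass t S1)) b')"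
    unfolding framing_def by (intro exI[of _ "[(t, S1), (t, S3), (t, S2)]"]) auto
  moreover have "polygon (Leaf (tclass t S1)) b'" by (simp add: polygon_def b'_def tclass_def)
  moreover have "kinds (Leaf (tclass t S1)) \<union> kinds b' = kind ` {t}" by (simp add: b'_def)
  moreover have "F \<in> SL2" using adm n by (simp add: F_def)
  ultimately show ?case unfolding t_def by blast
next
  case (glue J t k A s s')
  define t' where "t' = (k, A)"
  have n1: "n \<ge> 1" using n by simp
  have adm: "admissible n t'" using glue by (auto simp: admissible_def t'_def)
  have J: "matched n J" using assembled_matched[OF n glue(1)] .
  have tadm: "admissible n t" using J glue(2) by (auto simp: matched_def)
  note g = glue(5)[folded t'_def]
  note step = glue_step[OF n J glue(2) adm g glue(6)[folded t'_def]]
  obtain F b b' ps where IH: "F \<in> SL2" "polygon b b'" "kinds b \<union> kinds b' = kind ` J"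
    "distinct ps" "set ps = boundary J" "list_all2 (same_frame n) ps (polygon_frames n F b b')"
    using glue.IH unfolding framing_def by blast
  \<comment> \<open>The glued side was a boundary side, so it is a leaf of one of the two trees, and
    the tree grows there.\<close>
  obtain us vs where ps: "ps = us @ (t, s) # vs"
    using step(2) IH(5) by (metis split_list)
  obtain xs c G ys where L: "polygon_frames n F b b' = xs @ (c, G) # ys"
      "list_all2 (same_frame n) us xs" "same_frame n (t, s) (c, G)" "list_all2 (same_frame n) vs ys"
    using IH(6) unfolding ps by (auto simp: list_all2_append1 list_all2_Cons1)
  have c: "c = tclass t s" "frame n t s \<doteq> G" using L(3) by (auto simp: same_frame_def)
  note gf = glued_frame[OF n tadm adm g]
  have "side_class (kind t') s' = c" using gf(1) c by (simp add: tclass_def)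
  then obtain d d' where d: "polygon d d'" "kinds d \<union> kinds d' = insert (kind t') (kinds b \<union> kinds b')"
     "polygon_frames n F d d' = xs @ glued_frames n G (kind t') s' @ ys"
    using polygon_frames_grow[OF IH(2) L(1)] by blast
  have "frame n t' s' \<doteq> G ** turn (height n (tclass t' s'))"
    using gf pm_eq_mult[OF c(2) pm_eq_refl] pm_eq_trans by metis
  note fr = tile_sides_frames[OF n1 this]
  let ?ps = "us @ (t', nx s') # (t', nx (nx s')) # vs"
  have "list_all2 (same_frame n) ?ps (polygon_frames n F d d')"
    unfolding d(3) glued_frames_def using L fr
    by (auto intro!: list_all2_appendI simp: same_frame_def tclass_def Let_def)
  moreover have "set ?ps = boundary (insert t' J)"
  proof -
    have "set us \<union> set vs = boundary J - {(t, s)}" using IH(4,5) unfolding ps by auto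
    moreover have "{(t', x) |x. x \<noteq> s'} = {(t', nx s'), (t', nx (nx s'))}"
      using side_cases[of _ s'] by auto
    ultimately show ?thesis unfolding step(3) by auto
  qed
  moreover have "distinct ?ps"
  proof -
    have "(t', x) \<notin> boundary J" for x using step(1) by (auto simp: boundary_def)
    thus ?thesis using IH(4,5) unfolding ps by auto
  qed
  ultimately have "framing n (insert t' J) (polygon_frames n F d d')"
    unfolding framing_def by blast
  moreover have "kinds d \<union> kinds d' = kind ` insert t' J" using d(2) IH(3) by simp
  ultimately show ?case using IH(1) d(1) unfolding t'_def by blast
qed

section \<open>The group of a polygon\<close>

text \<open>The identity is exact, not only up to sign. In the computation \<open>N\<close> is the
  squared modulus of the denominator of the Moebius map.\<close>

lemma half_turn_matrix_moebius:
  assumes "G \<in> SL2" "z \<in> upper"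
  shows "half_turn_matrix (moebius G z) = G ** half_turn_matrix z ** adj G"
proof -
  obtain a b c d where G: "G = mat2 a b c d" by (rule mat2_cases)
  have det: "a * d - b * c = 1" using assms G by simp
  define x y where "x = Re z" and "y = Im z"
  have y: "y > 0" using assms by (simp add: y_def upper_def)
  define N where "N = (c * x + d)\<^sup>2 + (c * y)\<^sup>2"
  have N: "N > 0"
    using moebius_denom[OF assms(1), of z] assms(2) G unfolding N_def x_def y_def
    by (auto simp: sum_power2_gt_zero_iff complex_eq_iff upper_def)
  have Re: "Re (moebius G z) = ((a * x + b) * (c * x + d) + a * c * y\<^sup>2) / N"
    by (simp add: moebius_def G Re_divide N_def x_def y_def power2_eq_square)
  have "Im (moebius G z) = (a * y * (c * x + d) - (a * x + b) * (c * y)) / N"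
    by (simp add: moebius_def G Im_divide N_def x_def y_def power2_eq_square)
  also have "a * y * (c * x + d) - (a * x + b) * (c * y) = (a * d - b * c) * y" by (simp add: algebra_simps)
  finally have Im: "Im (moebius G z) = y / N" using det by simp
  have abs: "(Re (moebius G z))\<^sup>2 + (Im (moebius G z))\<^sup>2 = ((a * x + b)\<^sup>2 + (a * y)\<^sup>2) / N"
  proof -
    have "((a * x + b) * (c * x + d) + a * c * y\<^sup>2)\<^sup>2 + ((a * d - b * c) * y)\<^sup>2 = ((a * x + b)\<^sup>2 + (a * y)\<^sup>2) * N"
      unfolding N_def by (simp add: algebra_simps power2_eq_square)
    hence "((a * x + b) * (c * x + d) + a * c * y\<^sup>2)\<^sup>2 + y\<^sup>2 = ((a * x + b)\<^sup>2 + (a * y)\<^sup>2) * N"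
      using det by simp
    thus ?thesis unfolding Re Im power_divide
      using N by (simp add: power2_eq_square flip: add_divide_distrib)
  qed
  have "half_turn_matrix (moebius G z) = mat2 (((a * x + b) * (c * x + d) + a * c * y\<^sup>2) / y)
     (- ((a * x + b)\<^sup>2 + (a * y)\<^sup>2) / y) (N / y) (- ((a * x + b) * (c * x + d) + a * c * y\<^sup>2) / y)"
    unfolding half_turn_matrix_def minus_divide_left[symmetric] abs unfolding Re Im using N y by simp
  also have "\<dots> = G ** half_turn_matrix z ** adj G"
    unfolding half_turn_matrix_def G N_def x_def[symmetric] y_def[symmetric] using y
    by (simp add: field_simps power2_eq_square)
  finally show ?thesis .
qed

definition leaf_turn :: "nat \<Rightarrow> side \<times> int \<Rightarrow> real^2^2" where
  "leaf_turn n p = crossing (height n (fst p)) (snd p) (snd p)"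

definition leaf_group :: "nat \<Rightarrow> (side \<times> int) set \<Rightarrow> (real^2^2) set" where
  "leaf_group n Y = mgen (leaf_turn n ` Y)"

definition polygon_leaves :: "nat \<Rightarrow> int \<Rightarrow> branch \<Rightarrow> branch \<Rightarrow> (side \<times> int) set" where
  "polygon_leaves n x b b' = leaves n x b \<union> leaves n (x + width n b) b'"

lemma SL2_leaf_turn [simp]: "n \<ge> 1 \<Longrightarrow> leaf_turn n p \<in> SL2"
  by (simp add: leaf_turn_def)

lemma matrix_group_leaf_group: "n \<ge> 1 \<Longrightarrow> matrix_group (leaf_group n Y)"
  unfolding leaf_group_def by (rule matrix_group_mgen) auto

lemma leaf_group_mem: "p \<in> Y \<Longrightarrow> leaf_turn n p \<in> leaf_group n Y"
  unfolding leaf_group_def by (rule mgen.incl) simp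

lemma leaf_group_subset:
  "matrix_group G \<Longrightarrow> \<forall>p\<in>Y. leaf_turn n p \<in> G \<Longrightarrow> leaf_group n Y \<subseteq> G"
  unfolding leaf_group_def by (intro mgen_subset) auto

lemma jigsaw_group_framing:
  assumes n: "n \<ge> 1" and adm: "\<forall>t\<in>J. admissible n t" and fr: "framing n J L"
  shows "jigsaw_group J = psl ` mgen ((\<lambda>(c, G). G ** turn (height n c) ** adj G) ` set L)"
    and "\<forall>(c, G)\<in>set L. G \<in> SL2"
proof -
  obtain ps where ps: "set ps = boundary J" "list_all2 (same_frame n) ps L"
    using fr by (auto simp: framing_def)
  have up: "Complex 0 (height n c) \<in> upper" for c using n by (simp add: upper_def)
  have L: "G \<in> SL2 \<and> half_turn (tile_mark t s) = psl (G ** turn (height n c) ** adj G)"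
    if "same_frame n (t, s) (c, G)" "(t, s) \<in> boundary J" for t s c G
  proof -
    have t: "admissible n t" using adm that(2) by (auto simp: boundary_def)
    have c: "tclass t s = c" "frame n t s \<doteq> G" using that(1) by (auto simp: same_frame_def)
    have F: "frame n t s \<in> SL2" using n t by simp
    have G: "G \<in> SL2" using c(2) matrix_group_pm_eq[OF matrix_group_SL2] F by blast
    have cr: "half_turn_matrix (Complex 0 (height n c)) = turn (height n c)"
      using n by (simp add: half_turn_matrix_Complex crossing_def shift_def flip: mat_1_mat2)
    have "half_turn (tile_mark t s) = psl (half_turn_matrix (moebius (frame n t s) (Complex 0 (height n c))))"
      unfolding half_turn_def tile_mark_frame[OF n t] c(1) ..
    also have "\<dots> = psl (half_turn_matrix (moebius G (Complex 0 (height n c))))"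
      using moebius_pm_eq[OF c(2)] by simp
    also have "\<dots> = psl (G ** turn (height n c) ** adj G)"
      unfolding half_turn_matrix_moebius[OF G up] cr ..
    finally show ?thesis using G by blast
  qed
  have zip: "set ps = fst ` set (zip ps L)" "set L = snd ` set (zip ps L)"
    using list_all2_lengthD[OF ps(2)] by (metis map_fst_zip set_map, metis map_snd_zip set_map)
  have zipL: "same_frame n p r \<and> p \<in> boundary J" if "(p, r) \<in> set (zip ps L)" for p r
    using that ps list_all2_lengthD[OF ps(2)] by (auto simp: list_all2_iff dest: set_zip_leftD)
  have "half_turn ` boundary_marks J = (\<lambda>p. half_turn (case fst p of (t, s) \<Rightarrow> tile_mark t s)) ` set (zip ps L)"
    unfolding boundary_marks_eq ps(1)[symmetric] zip(1) image_image ..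
  also have "\<dots> = (\<lambda>p. psl (case snd p of (c, G) \<Rightarrow> G ** turn (height n c) ** adj G)) ` set (zip ps L)"
    by (rule image_cong[OF refl]) (use L zipL in \<open>fastforce split: prod.splits\<close>)
  also have "\<dots> = psl ` ((\<lambda>(c, G). G ** turn (height n c) ** adj G) ` set L)"
    unfolding zip(2) image_image ..
  finally have eq: "half_turn ` boundary_marks J = psl ` ((\<lambda>(c, G). G ** turn (height n c) ** adj G) ` set L)" .
  show SL: "\<forall>(c, G)\<in>set L. G \<in> SL2" unfolding zip(2) using L zipL by fastforce
  show "jigsaw_group J = psl ` mgen ((\<lambda>(c, G). G ** turn (height n c) ** adj G) ` set L)"
    unfolding jigsaw_group_def eq using SL n by (intro generate_psl) auto
qed

text \<open>The relation of one tile, checked for each kind and side: crossing its two far sides in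
  succession amounts to crossing the near side. It allows the elimination of inner sides.\<close>

lemma crossing_tile:
  assumes "n \<ge> 1" and "y1 = x1 + real (corner n q (nx s))"
  shows "crossing (height n (side_class q (nx s))) x x1 ** crossing (height n (side_class q (nx (nx s)))) y1 y
    \<doteq> crossing (height n (side_class q s)) (x - corner n q s) (y + corner n q (nx (nx s)))"
proof -
  have "sqrt (real n) * sqrt (real n) = real n" by simp
  thus ?thesis using assms
    by (cases s; cases q)
      (auto simp: crossing_mat2 pm_eq_def corner_def height_def side_class_def field_simps)
qed

lemma crossing_crossing:
  "h \<noteq> 0 \<Longrightarrow> crossing h x y ** crossing h y z = - shift (x - z)"
  by (simp add: crossing_mat2 shift_def field_simps)

text \<open>By \<open>crossing_tile\<close>, the crossing of the entry side is a product of
  half-turns at the leaves beyond it. For a leaf the width is 0 and the crossing is its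
  half-turn.\<close>

lemma branch_crossing:
  assumes n: "n \<ge> 1" and G: "matrix_group G"
    and "wf_branch b" "\<forall>p\<in>leaves n x b. leaf_turn n p \<in> G"
  shows "crossing (height n (bclass b)) x (x + width n b) \<in> G"
  using assms(3,4)
proof (induction b arbitrary: x)
  case (Node q s b1 b2)
  define x1 where "x1 = x + int (corner n q s)"
  define x2 where "x2 = x1 + width n b1 + int (corner n q (nx s))"
  have "\<forall>p\<in>leaves n x1 b1. leaf_turn n p \<in> G" "\<forall>p\<in>leaves n x2 b2. leaf_turn n p \<in> G"
    using Node.prems(2) by (auto simp: x1_def x2_def)
  hence "crossing (height n (side_class q (nx s))) x1 (x1 + width n b1) \<in> G"
    "crossing (height n (side_class q (nx (nx s)))) x2 (x2 + width n b2) \<in> G"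
    using Node.IH(1)[of x1] Node.IH(2)[of x2] Node.prems(1) by auto
  hence "crossing (height n (side_class q (nx s))) x1 (x1 + width n b1) **
    crossing (height n (side_class q (nx (nx s)))) x2 (x2 + width n b2) \<in> G"
    by (rule matrix_groupD(5)[OF G])
  also have "?this \<longleftrightarrow> ?case"
    using crossing_tile[OF n, of "real_of_int x2" "x1 + width n b1" q s "real_of_int x1" "x2 + width n b2"]
    by (intro matrix_group_pm_eq[OF G]) (simp add: x1_def x2_def algebra_simps)
  finally show ?case .
qed (auto simp: leaf_turn_def)

text \<open>The frame of a leaf is \<open>A ** g\<close> followed by a shift to its position, where
  \<open>g\<close> collects the crossings of the branches already passed. As \<open>g\<close> lies
  in \<open>G\<close>, conjugation by it does not affect membership in \<open>G\<close>, and only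
  the position matters. \<open>G\<close> is kept general in order to obtain both inclusions between
  the two groups.\<close>

lemma leaf_frames_leaves:
  assumes n: "n \<ge> 1" and G: "matrix_group G" and A: "A \<in> SL2"
    and "wf_branch b" "F \<doteq> A ** g ** shift x" "g \<in> G"
  shows "(\<forall>(c, F')\<in>set (leaf_frames n F b). adj A ** (F' ** turn (height n c) ** adj F') ** A \<in> G) \<longleftrightarrow>
    (\<forall>p\<in>leaves n x b. leaf_turn n p \<in> G)"
  using assms(4-)
proof (induction b arbitrary: x F g)
  case (Leaf c)
  let ?H = "turn (height n c)"
  have g: "g \<in> SL2" using Leaf G by (auto dest: matrix_groupD)
  have "adj A ** (F ** ?H ** adj F) ** A \<doteq>
      adj A ** (A ** g ** shift x ** ?H ** adj (A ** g ** shift x)) ** A"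
    using Leaf by (intro pm_eq_mult pm_eq_adj pm_eq_refl) auto
  also have "\<dots> = (adj A ** A) ** g ** crossing (height n c) x x ** adj g ** (adj A ** A)"
    by (simp add: adj_mult adj_shift crossing_def matrix_mul_assoc)
  also have "\<dots> = g ** crossing (height n c) x x ** adj g" using A by (simp add: adj_left)
  finally have "adj A ** (F ** ?H ** adj F) ** A \<in> G \<longleftrightarrow> g ** crossing (height n c) x x ** adj g \<in> G"
    by (rule matrix_group_pm_eq[OF G])
  also have "\<dots> \<longleftrightarrow> crossing (height n c) x x \<in> G"
  proof
    assume "g ** crossing (height n c) x x ** adj g \<in> G"
    hence "adj g ** (g ** crossing (height n c) x x ** adj g) ** g \<in> G"
      using Leaf G by (auto intro: matrix_groupD)
    also have "adj g ** (g ** crossing (height n c) x x ** adj g) ** g =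
      (adj g ** g) ** crossing (height n c) x x ** (adj g ** g)" by (simp add: matrix_mul_assoc)
    finally show "crossing (height n c) x x \<in> G" using g by (simp add: adj_left)
  qed (use Leaf G in \<open>auto intro: matrix_groupD\<close>)
  finally show ?case by (simp add: leaf_turn_def)
next
  case (Node q s b1 b2)
  define x1 where "x1 = x + int (corner n q s)"
  define x2 where "x2 = x1 + width n b1 + int (corner n q (nx s))"
  define F1 where "F1 = F ** shift (corner n q s)"
  define h where "h = height n (side_class q (nx s))"
  define F2 where "F2 = F1 ** turn h ** shift (corner n q (nx s))"
  let ?P = "\<lambda>F b. \<forall>(c, F')\<in>set (leaf_frames n F b). adj A ** (F' ** turn (height n c) ** adj F') ** A \<in> G"
  let ?Q = "\<lambda>x b. \<forall>p\<in>leaves n x b. leaf_turn n p \<in> G"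
  have F1: "F1 \<doteq> A ** g ** shift x1"
  proof -
    have "F1 \<doteq> A ** g ** shift x ** shift (corner n q s)"
      unfolding F1_def using Node by (intro pm_eq_mult pm_eq_refl) auto
    thus ?thesis by (simp add: x1_def shift_add flip: matrix_mul_assoc)
  qed
  have 1: "?P F1 b1 \<longleftrightarrow> ?Q x1 b1" using Node F1 by auto
  \<comment> \<open>The crossing of \<open>b1\<close> enters the frames of \<open>b2\<close>, so its
    membership in \<open>G\<close>, which comes from the leaves of \<open>b1\<close>, has to be
    known first.\<close>
  have 2: "?P F2 b2 \<longleftrightarrow> ?Q x2 b2" if "?Q x1 b1"
  proof (rule Node.IH(2))
    show "wf_branch b2" using Node by simp
    have cr: "crossing h x1 (x1 + width n b1) \<in> G"
      using branch_crossing[OF n G _ that] Node.prems(1) by (simp add: h_def)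
    show "g ** crossing h x1 (x1 + width n b1) \<in> G" using Node cr by (auto intro: matrix_groupD[OF G])
    have "F2 \<doteq> A ** g ** shift x1 ** turn h ** shift (corner n q (nx s))"
      unfolding F2_def using F1 by (intro pm_eq_mult pm_eq_refl) auto
    also have "\<dots> = A ** (g ** crossing h x1 (x1 + width n b1)) ** shift x2"
      by (simp add: crossing_def x2_def shift_add flip: matrix_mul_assoc)
    finally show "F2 \<doteq> A ** (g ** crossing h x1 (x1 + width n b1)) ** shift x2" .
  qed
  have "?P F (Node q s b1 b2) \<longleftrightarrow> ?P F1 b1 \<and> ?P F2 b2"
    by (auto simp: Let_def F1_def F2_def h_def)
  moreover have "?Q x (Node q s b1 b2) \<longleftrightarrow> ?Q x1 b1 \<and> ?Q x2 b2"
    by (auto simp: x1_def x2_def)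
  ultimately show ?case using 1 2 by blast
qed

text \<open>One full turn around the boundary: the crossings of the cut obtained from its two sides
  combine to the translation by the whole horocycle.\<close>

lemma polygon_shift:
  assumes n: "n \<ge> 1" and G: "matrix_group G" and p: "polygon b b'"
    and l: "\<forall>p\<in>polygon_leaves n x b b'. leaf_turn n p \<in> G"
  shows "shift (width n b + width n b') \<in> G"
proof -
  let ?h = "height n (bclass b)"
  have "crossing ?h x (x + width n b) \<in> G" "crossing ?h (x + width n b) (x + width n b + width n b') \<in> G"
    using branch_crossing[OF n G, of b x] branch_crossing[OF n G, of b' "x + width n b"] p l
    by (auto simp: polygon_def polygon_leaves_def)
  hence "crossing ?h x (x + width n b) ** crossing ?h (x + width n b) (x + width n b + width n b') \<in> G"
    by (rule matrix_groupD(5)[OF G])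
  hence "- shift (- real_of_int (width n b + width n b')) \<in> G"
    using n by (simp add: crossing_crossing)
  hence "- (- adj (shift (- real_of_int (width n b + width n b')))) \<in> G"
    using matrix_groupD(3,4)[OF G] by fastforce
  thus ?thesis by (simp add: adj_shift add.commute)
qed

lemma polygon_frames_group:
  assumes n: "n \<ge> 1" and p: "polygon b b'" and F: "F \<in> SL2"
    and SL: "\<forall>(c, G)\<in>set (polygon_frames n F b b'). G \<in> SL2"
  shows "mgen ((\<lambda>(c, G). G ** turn (height n c) ** adj G) ` set (polygon_frames n F b b')) =
    conj_set (F ** shift (- real_of_int x)) (leaf_group n (polygon_leaves n x b b'))" (is "?M = _")
proof -
  let ?A = "F ** shift (- real_of_int x)"
  have A: "?A \<in> SL2" using F by simp
  let ?h = "height n (bclass b)"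
  have M: "matrix_group ?M" using SL n by (intro matrix_group_mgen) auto
  \<comment> \<open>Applied to the leaf group this yields one inclusion, applied to the conjugated
    group of the frames it yields the other.\<close>
  have key: "(\<forall>(c, F')\<in>set (polygon_frames n F b b'). adj ?A ** (F' ** turn (height n c) ** adj F') ** ?A \<in> G) \<longleftrightarrow>
    (\<forall>p\<in>polygon_leaves n x b b'. leaf_turn n p \<in> G)" if G: "matrix_group G" for G
  proof -
    let ?P = "\<lambda>F b. \<forall>(c, F')\<in>set (leaf_frames n F b). adj ?A ** (F' ** turn (height n c) ** adj F') ** ?A \<in> G"
    let ?Q = "\<lambda>x b. \<forall>p\<in>leaves n x b. leaf_turn n p \<in> G"
    have one: "shift 0 = mat 1" by (simp add: shift_def mat_1_mat2)
    have F0: "F = ?A ** shift x" by (simp add: shift_add one flip: matrix_mul_assoc)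
    have 1: "?P F b \<longleftrightarrow> ?Q x b"
      by (rule leaf_frames_leaves[OF n G A, where g = "mat 1"])
        (use p matrix_groupD(2)[OF G] F0 in \<open>auto simp: polygon_def\<close>)
    have 2: "?P (F ** turn ?h) b' \<longleftrightarrow> ?Q (x + width n b) b'" if "?Q x b"
    proof (rule leaf_frames_leaves[OF n G A])
      show "wf_branch b'" using p by (simp add: polygon_def)
      show "crossing ?h x (x + width n b) \<in> G"
        using branch_crossing[OF n G _ that] p by (simp add: polygon_def)
      have "?A ** crossing ?h x (x + width n b) ** shift (x + width n b) =
        (?A ** shift x) ** turn ?h ** (shift (- (x + width n b)) ** shift (x + width n b))"
        by (simp add: crossing_def matrix_mul_assoc)
      also have "\<dots> = F ** turn ?h" unfolding F0[symmetric] shift_add by (simp add: one)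
      finally show "F ** turn ?h \<doteq> ?A ** crossing ?h x (x + width n b) ** shift (x + width n b)"
        by simp
    qed
    have "(\<forall>(c, F')\<in>set (polygon_frames n F b b'). adj ?A ** (F' ** turn (height n c) ** adj F') ** ?A \<in> G)
      \<longleftrightarrow> ?P F b \<and> ?P (F ** turn ?h) b'" by (auto simp: polygon_frames_def)
    thus ?thesis using 1 2 by (auto simp: polygon_leaves_def)
  qed
  show ?thesis
  proof
    let ?L = "leaf_group n (polygon_leaves n x b b')"
    have L: "matrix_group ?L" using n by (rule matrix_group_leaf_group)
    have *: "\<forall>(c, F')\<in>set (polygon_frames n F b b'). adj ?A ** (F' ** turn (height n c) ** adj F') ** ?A \<in> ?L"
      using key[OF L] leaf_group_mem by blast
    show "?M \<subseteq> conj_set ?A ?L"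
    proof (rule mgen_subset[OF conj_set_matrix_group[OF A L]], rule subsetI)
      fix X assume "X \<in> (\<lambda>(c, G). G ** turn (height n c) ** adj G) ` set (polygon_frames n F b b')"
      then obtain c F' where "(c, F') \<in> set (polygon_frames n F b b')" "X = F' ** turn (height n c) ** adj F'"
        by auto
      hence "adj ?A ** X ** ?A \<in> ?L" using * by fast
      thus "X \<in> conj_set ?A ?L" unfolding conj_set_iff[OF A] .
    qed
  next
    have M': "matrix_group (conj_set (adj ?A) ?M)" using A M by (intro conj_set_matrix_group) auto
    have "adj ?A ** (F' ** turn (height n c) ** adj F') ** adj (adj ?A) \<in> conj_set (adj ?A) ?M"
      if "(c, F') \<in> set (polygon_frames n F b b')" for c F'
      unfolding conj_set_def using that by (intro imageI mgen.incl) (auto intro!: rev_image_eqI)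
    hence "\<forall>(c, F')\<in>set (polygon_frames n F b b').
        adj ?A ** (F' ** turn (height n c) ** adj F') ** ?A \<in> conj_set (adj ?A) ?M"
      by (simp only: adj_adj) blast
    hence "leaf_group n (polygon_leaves n x b b') \<subseteq> conj_set (adj ?A) ?M"
      using key[OF M'] leaf_group_subset[OF M'] by blast
    hence "conj_set ?A (leaf_group n (polygon_leaves n x b b')) \<subseteq> conj_set ?A (conj_set (adj ?A) ?M)"
      by (rule conj_set_mono)
    thus "conj_set ?A (leaf_group n (polygon_leaves n x b b')) \<subseteq> ?M"
      unfolding conj_set_conj_set adj_right[OF A] by simp
  qed
qed

lemma framing_group:
  assumes n: "n \<ge> 1" and adm: "\<forall>t\<in>J. admissible n t" and F: "F \<in> SL2" and p: "polygon b b'"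
    and fr: "framing n J (polygon_frames n F b b')"
  shows "jigsaw_group J = psl ` conj_set (F ** shift (- real_of_int x)) (leaf_group n (polygon_leaves n x b b'))"
  using jigsaw_group_framing[OF n adm fr] polygon_frames_group[OF n p F] by simp

lemma jigsaw_polygon:
  assumes n: "n \<ge> 2" and J: "jigsaw n J"
  obtains F b b' where "F \<in> SL2" "polygon b b'" "kinds b \<union> kinds b' = UNIV"
    "\<And>x. jigsaw_group J = psl ` conj_set (F ** shift (- real_of_int x)) (leaf_group n (polygon_leaves n x b b'))"
proof -
  have as: "assembled {integral_labels 1, integral_labels n} J" using J by (simp add: jigsaw_def)
  obtain F b b' where *: "F \<in> SL2" "polygon b b'" "kinds b \<union> kinds b' = kind ` J"
    "framing n J (polygon_frames n F b b')"
    using assembled_polygon[OF n as] by blast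
  have "\<forall>t\<in>J. admissible n t" using assembled_matched[OF n as] by (simp add: matched_def)
  moreover have "kind ` J = UNIV"
  proof -
    obtain A B where "(integral_labels 1, A) \<in> J" "(integral_labels n, B) \<in> J"
      using J by (auto simp: jigsaw_def)
    moreover have "kind (integral_labels 1, A) = False" "kind (integral_labels n, B) = True"
      using integral_labels_ne[OF n] by (auto simp: kind_def)
    ultimately show ?thesis by (force simp: UNIV_bool)
  qed
  ultimately show ?thesis using framing_group[of n J F b b'] n * that by auto
qed

section \<open>Congruences satisfied by arithmetic polygons\<close>

lemma real_int_div_dvd:
  fixes a b :: int
  assumes "b > 0" "real_of_int a / real_of_int b \<in> \<int>"
  shows "b dvd a"
proof -
  obtain k where "real_of_int a / real_of_int b = of_int k" using assms(2) by (elim Ints_cases)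
  hence "real_of_int a = real_of_int (b * k)" using assms(1) by (simp add: field_simps)
  hence "a = b * k" by (simp only: of_int_eq_iff)
  thus ?thesis by simp
qed

text \<open>Half-turns at heights \<open>h\<close>, \<open>k\<close> and distance \<open>w\<close>
  have a product of trace \<open>- (h^2 + k^2 + w^2) / (h k)\<close>. Its square is a fraction with
  denominator \<open>n\<close> or \<open>n^2\<close>, and integrality is the congruence.\<close>

lemma arithmetic_leaf_pair:
  fixes x y :: int
  assumes G: "matrix_group G" and ar: "arithmetic (psl ` G)" and n: "n \<ge> 1"
    and mem: "leaf_turn n (c, x) \<in> G" "leaf_turn n (d, y) \<in> G" and d: "d \<noteq> S1"
  shows "if c = S1 then int n dvd ((x - y)\<^sup>2 + 1)\<^sup>2 else int n dvd (x - y)\<^sup>2"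
proof -
  define h k where "h = height n c" and "k = height n d"
  have hk: "h > 0" "k > 0" using n by (simp_all add: h_def k_def)
  define A where "A = leaf_turn n (c, x) ** leaf_turn n (d, y)"
  have A: "A \<in> G" using matrix_groupD(5)[OF G] mem by (simp add: A_def)
  have tr: "A$1$1 + A$2$2 = - (h\<^sup>2 + k\<^sup>2 + (x - y)\<^sup>2) / (h * k)"
    using hk by (simp add: A_def leaf_turn_def crossing_mat2 field_simps power2_eq_square flip: h_def k_def)
  define a where "a = (if c = S1 then 1 else int n)"
  have h2: "h\<^sup>2 = real_of_int a" and k2: "k\<^sup>2 = real_of_int (int n)"
    using d by (auto simp: h_def k_def height_square a_def)
  have sq: "(A$1$1 + A$2$2)\<^sup>2 = real_of_int ((a + int n + (x - y)\<^sup>2)\<^sup>2) / real_of_int (a * int n)"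
    unfolding tr minus_divide_left[symmetric] power2_minus power_divide power_mult_distrib h2 k2 by simp
  have "(A$1$1 + A$2$2)\<^sup>2 \<in> \<int>"
    by (rule arithmetic_trace_square_integral[OF G ar A]) (simp add: sq)
  hence dvd: "a * int n dvd (a + int n + (x - y)\<^sup>2)\<^sup>2"
    unfolding sq using n by (intro real_int_div_dvd) (auto simp: a_def)
  show ?thesis
  proof (cases "c = S1")
    case True
    have "(1 + int n + (x - y)\<^sup>2)\<^sup>2 = ((x - y)\<^sup>2 + 1)\<^sup>2 + int n * (int n + 2 * (1 + (x - y)\<^sup>2))"
      by (simp add: power2_eq_square algebra_simps)
    thus ?thesis using True dvd by (simp add: a_def dvd_add_left_iff)
  next
    case False
    hence "int n ^ 2 dvd (int n + int n + (x - y)\<^sup>2)\<^sup>2" using dvd by (simp add: a_def power2_eq_square)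
    hence "int n dvd int n + int n + (x - y)\<^sup>2" by (simp only: pow_divides_pow_iff)
    hence "int n dvd (x - y)\<^sup>2" by (simp add: dvd_add_right_iff)
    thus ?thesis using False by simp
  qed
qed

text \<open>Here the trace is \<open>L / sqrt n\<close>.\<close>

lemma arithmetic_leaf_shift:
  fixes L y :: int
  assumes G: "matrix_group G" and ar: "arithmetic (psl ` G)" and n: "n \<ge> 1"
    and mem: "shift L \<in> G" "leaf_turn n (d, y) \<in> G" and d: "d \<noteq> S1"
  shows "int n dvd L\<^sup>2"
proof -
  define k where "k = height n d"
  have k: "k > 0" "k\<^sup>2 = real_of_int (int n)" using n d by (simp_all add: k_def height_square)
  define A where "A = shift L ** leaf_turn n (d, y)"
  have A: "A \<in> G" using matrix_groupD(5)[OF G] mem by (simp add: A_def)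
  have tr: "A$1$1 + A$2$2 = L / k"
    using k by (simp add: A_def leaf_turn_def crossing_mat2 shift_def field_simps flip: k_def)
  have sq: "(A$1$1 + A$2$2)\<^sup>2 = real_of_int (L\<^sup>2) / real_of_int (int n)"
    unfolding tr power_divide k by simp
  have "(A$1$1 + A$2$2)\<^sup>2 \<in> \<int>"
    by (rule arithmetic_trace_square_integral[OF G ar A]) (simp add: sq)
  thus ?thesis unfolding sq using n by (intro real_int_div_dvd) auto
qed

text \<open>Take the least positive \<open>m\<close> with \<open>n dvd m^2\<close>. As gcd commutes
  with squaring, \<open>gcd m x\<close> has the same property, so minimality makes it equal to
  \<open>m\<close>.\<close>

lemma square_root_divisor:
  assumes "n \<ge> 1"
  obtains m :: int where "m > 0" "int n dvd m\<^sup>2" "\<And>x. int n dvd x\<^sup>2 \<Longrightarrow> m dvd x"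
proof -
  define P where "P k \<longleftrightarrow> k > 0 \<and> int n dvd (int k)\<^sup>2" for k :: nat
  have "P n" using assms by (simp add: P_def power2_eq_square)
  define k where "k = (LEAST k. P k)"
  have k: "P k" and least: "\<And>j. P j \<Longrightarrow> k \<le> j"
    unfolding k_def using \<open>P n\<close> by (auto intro: LeastI Least_le)
  have "int k dvd x" if "int n dvd x\<^sup>2" for x
  proof -
    define g where "g = gcd (int k) x"
    have "int n dvd g\<^sup>2" unfolding g_def gcd_exp[symmetric] using that k by (simp del: gcd_exp add: P_def)
    moreover have g: "g > 0" using k by (simp add: g_def P_def)
    ultimately have "P (nat g)" by (simp add: P_def)
    hence "int k \<le> g" using least[of "nat g"] g by linarith
    moreover have "g dvd int k" "g dvd x" by (simp_all add: g_def)
    ultimately have "g = int k" using k by (auto simp: P_def dest: zdvd_imp_le)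
    thus ?thesis using \<open>g dvd x\<close> by simp
  qed
  thus ?thesis using that[of "int k"] k by (simp add: P_def)
qed

lemma leaves_shift: "leaves n (x + k) b = (\<lambda>(c, y). (c, y + k)) ` leaves n x b"
proof (induction b arbitrary: x)
  case (Node q s b1 b2)
  show ?case
    using Node[of "x + int (corner n q s)"]
      Node(2)[of "x + int (corner n q s) + width n b1 + int (corner n q (nx s))"]
    by (simp add: image_Un algebra_simps)
qed auto

definition leaves_cong :: "int \<Rightarrow> (side \<times> int) set \<Rightarrow> bool" where
  "leaves_cong m Y \<longleftrightarrow> (\<forall>(c, y)\<in>Y. if c = S1 then m dvd y\<^sup>2 + 1 else m dvd y)"

text \<open>An n-tile has two sides with label different from 1; whichever side it is entered
  through, one of them leads outwards, and again to a leaf or to an n-tile.\<close>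

lemma leaf_not_S1:
  "wf_branch b \<Longrightarrow> bclass b \<noteq> S1 \<or> True \<in> kinds b \<Longrightarrow> \<exists>d y. (d, y) \<in> leaves n x b \<and> d \<noteq> S1"
proof (induction b arbitrary: x)
  case (Node q s b1 b2)
  let ?x2 = "x + int (corner n q s) + width n b1 + int (corner n q (nx s))"
  have "(bclass b1 \<noteq> S1 \<or> True \<in> kinds b1) \<or> (bclass b2 \<noteq> S1 \<or> True \<in> kinds b2)"
    using Node.prems by (cases q; cases s) (auto simp: side_class_def)
  thus ?case using Node.prems Node.IH(1)[of "x + int (corner n q s)"] Node.IH(2)[of ?x2] by fastforce
qed auto

lemma arithmetic_polygon_cong:
  assumes n: "n \<ge> 2" and p: "polygon b b'" and kinds: "True \<in> kinds b \<union> kinds b'"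
    and ar: "arithmetic (psl ` leaf_group n (polygon_leaves n 0 b b'))"
  obtains m x :: int where "m > 0" "int n dvd m\<^sup>2" "m dvd int n" "m dvd width n b + width n b'"
    "leaves_cong m (leaves n x b)" "leaves_cong m (leaves n (x + width n b) b')"
proof -
  let ?Y = "polygon_leaves n 0 b b'"
  have n1: "n \<ge> 1" using n by simp
  note G = matrix_group_leaf_group[OF n1, of ?Y]
  obtain m where m: "m > 0" "int n dvd m\<^sup>2" "\<And>x. int n dvd x\<^sup>2 \<Longrightarrow> m dvd x"
    using square_root_divisor[OF n1] by blast
  have "\<exists>d y. (d, y) \<in> ?Y \<and> d \<noteq> S1"
    using leaf_not_S1[of b n 0] leaf_not_S1[of b' n "0 + width n b"] kinds p
    unfolding polygon_leaves_def polygon_def by blast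
  then obtain d y where dy: "(d, y) \<in> ?Y" "d \<noteq> S1" by blast
  have "shift (real_of_int (width n b + width n b')) \<in> leaf_group n ?Y"
    using polygon_shift[OF n1 G p, of 0] leaf_group_mem[of _ ?Y n] by auto
  hence "int n dvd (width n b + width n b')\<^sup>2"
    using arithmetic_leaf_shift[OF G ar n1 _ leaf_group_mem[OF dy(1)] dy(2)] by blast
  hence L: "m dvd width n b + width n b'" using m by blast
  \<comment> \<open>Counting positions from the mark \<open>y\<close> of height
    \<open>sqrt n\<close> turns congruences for distances into congruences for positions.\<close>
  have c: "leaves_cong m ((\<lambda>(c, z). (c, z + - y)) ` ?Y)"
    unfolding leaves_cong_def
  proof
    fix p assume "p \<in> (\<lambda>(c, z). (c, z + - y)) ` ?Y"
    then obtain c z where cz: "(c, z) \<in> ?Y" "p = (c, z - y)" by auto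
    have *: "if c = S1 then int n dvd ((z - y)\<^sup>2 + 1)\<^sup>2 else int n dvd (z - y)\<^sup>2"
      using arithmetic_leaf_pair[OF G ar n1 leaf_group_mem[OF cz(1)] leaf_group_mem[OF dy(1)] dy(2)] .
    thus "case p of (c, y) \<Rightarrow> if c = S1 then m dvd y\<^sup>2 + 1 else m dvd y"
      using m(3)[of "(z - y)\<^sup>2 + 1"] m(3)[of "z - y"] cz(2) by (auto split: if_splits)
  qed
  have "(\<lambda>(c, z). (c, z + - y)) ` ?Y = leaves n (0 + - y) b \<union> leaves n (0 + width n b + - y) b'"
    unfolding polygon_leaves_def image_Un leaves_shift by simp
  hence "leaves_cong m (leaves n (- y) b)" "leaves_cong m (leaves n (- y + width n b) b')"
    using c by (auto simp: leaves_cong_def)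
  moreover have "m dvd int n" using m(3)[of "int n"] by (simp add: power2_eq_square)
  ultimately show ?thesis using that m L by blast
qed

section \<open>Branches modulo \<open>m\<close>\<close>

lemma leaves_cong_Un [simp]: "leaves_cong m (X \<union> Y) \<longleftrightarrow> leaves_cong m X \<and> leaves_cong m Y"
  by (auto simp: leaves_cong_def)

lemma leaves_cong_Leaf [simp]:
  "leaves_cong m {(c, y)} \<longleftrightarrow> (if c = S1 then m dvd y\<^sup>2 + 1 else m dvd y)"
  by (simp add: leaves_cong_def)

lemma Node_cong:
  assumes "wf_branch (Node q s b1 b2)" "leaves_cong m (leaves n x (Node q s b1 b2))"
  obtains x1 e1 x2 e2 where "x1 = x + int (corner n q s)" "e1 = x1 + width n b1"
    "x2 = e1 + int (corner n q (nx s))" "e2 = x2 + width n b2"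
    "x + width n (Node q s b1 b2) = e2 + int (corner n q (nx (nx s)))"
    "leaves_cong m (leaves n x1 b1)" "leaves_cong m (leaves n x2 b2)"
  using assms by auto

lemma dvd_lin:
  fixes m :: int
  assumes "m dvd a" "m dvd b" "c = p * a + q * b"
  shows "m dvd c"
  using assms by simp

text \<open>The residues -1 and 1 are those of the ends of an n-tile entered through its label-1
  side: its two other sides sit at 0, one unit away from the ends.\<close>

definition generic_end :: "int \<Rightarrow> branch \<Rightarrow> int \<Rightarrow> int \<Rightarrow> bool" where
  "generic_end m b x e \<longleftrightarrow> (case b of
       Leaf c \<Rightarrow> e = x \<and> (if c = S1 then m dvd x\<^sup>2 + 1 else m dvd x)
     | Node q s b1 b2 \<Rightarrow> side_class q s = S1 \<and> m dvd x + 1 \<and> m dvd e - 1)"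

lemma generic_endE:
  assumes "generic_end m b x e"
  obtains (1) "bclass b = S1" "e = x" "m dvd x\<^sup>2 + 1"
    | (2) "bclass b = S1" "m dvd x + 1" "m dvd e - 1"
    | (3) "bclass b \<noteq> S1" "e = x" "m dvd x"
  using assms by (cases b) (auto simp: generic_end_def split: if_splits)

text \<open>For these \<open>m\<close> the only way to continue is an \<open>n\<close>-tile glued along its side with label 1.\<close>

lemma generic_branch:
  assumes m: "\<not> m dvd 2" "\<not> m dvd 3" "\<not> m dvd 5" and mn: "m dvd int n"
  shows "wf_branch b \<Longrightarrow> leaves_cong m (leaves n x b) \<Longrightarrow> generic_end m b x (x + width n b)"
proof (induction b arbitrary: x)
  case (Leaf c)
  thus ?case by (simp add: generic_end_def)
next
  case (Node q s b1 b2)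
  obtain x1 e1 x2 e2 where *: "x1 = x + int (corner n q s)" "e1 = x1 + width n b1"
    "x2 = e1 + int (corner n q (nx s))" "e2 = x2 + width n b2"
    "x + width n (Node q s b1 b2) = e2 + int (corner n q (nx (nx s)))"
    "leaves_cong m (leaves n x1 b1)" "leaves_cong m (leaves n x2 b2)"
    using Node_cong[OF Node.prems] by blast
  have b1: "generic_end m b1 x1 e1" and b2: "generic_end m b2 x2 e2"
    using Node.IH(1)[OF _ *(6)] Node.IH(2)[OF _ *(7)] Node.prems(1) unfolding *(2)[symmetric] *(4)[symmetric]
    by simp_all
  have cl: "bclass b1 = side_class q (nx s)" "bclass b2 = side_class q (nx (nx s))"
    using Node.prems by auto
  have no: "\<not> m dvd x2 + 1" if "m dvd e1 - 1" "x2 = e1 + 1"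
  proof
    assume "m dvd x2 + 1"
    hence "m dvd 3" by (rule dvd_lin[OF _ that(1), of _ _ 1 "-1"]) (simp add: that)
    thus False using m by simp
  qed
  have no2: "\<not> m dvd x2" if "m dvd e1 - 1" "x2 = e1 + 1"
  proof
    assume "m dvd x2"
    hence "m dvd 2" by (rule dvd_lin[OF _ that(1), of _ _ 1 "-1"]) (simp add: that)
    thus False using m by simp
  qed
  have no3: "\<not> m dvd x2" if "m dvd e1\<^sup>2 + 1" "x2 = e1 + 1"
  proof
    assume "m dvd x2"
    hence "m dvd 2" by (rule dvd_lin[OF _ that(1), of _ _ "- (e1 - 1)" "1"])
      (simp add: that power2_eq_square algebra_simps)
    thus False using m by simp
  qed
  show ?case
  proof (cases q)
    case False
    hence cl: "bclass b1 = S1" "bclass b2 = S1" and x2: "x2 = e1 + 1"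
      using cl * by (auto simp: side_class_def corner_def)
    \<comment> \<open>The facing ends of the far sides of a \<open>(1,1,1)\<close> tile are
      \<open>e1\<close> and \<open>e1 + 1\<close>. Two roots of \<open>y^2 = -1\<close>, or a root
      next to the end of an n-tile, give \<open>m dvd 5\<close>; two n-tiles give
      \<open>m dvd 3\<close>.\<close>
    have False
      using b1
    proof (cases rule: generic_endE)
      case 1
      show False using b2
      proof (cases rule: generic_endE)
        case 11: 1
        have "m dvd 5"
          by (rule dvd_lin[OF 1(3) 11(3), of _ "4 + (2 * x1 - 1)" "- (2 * x1 - 1)"])
            (simp add: x2 1 power2_eq_square algebra_simps)
        thus False using m by simp
      next
        case 12: 2
        have "m dvd 5"
          by (rule dvd_lin[OF 1(3) 12(2), of _ "1" "- (x1 - 2)"])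
            (simp add: x2 1 power2_eq_square algebra_simps)
        thus False using m by simp
      qed (use cl in auto)
    next
      case 2
      show False using b2
      proof (cases rule: generic_endE)
        case 11: 1
        have "m dvd 5"
          by (rule dvd_lin[OF 2(3) 11(3), of _ "- (e1 + 3)" "1"])
            (simp add: x2 power2_eq_square algebra_simps)
        thus False using m by simp
      qed (use cl no[OF 2(3) x2] in auto)
    qed (use cl in auto)
    thus ?thesis ..
  next
    case True
    show ?thesis
    proof (cases s)
      case S1
      hence cl': "bclass b1 \<noteq> S1" "bclass b2 \<noteq> S1" using cl True by (auto simp: side_class_def)
      hence "m dvd x1" "e1 = x1" "m dvd x2" "e2 = x2"
        using b1 b2 by (auto elim: generic_endE)
      thus ?thesis using S1 True *(1,5) by (simp add: generic_end_def side_class_def corner_def)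
    next
      \<comment> \<open>Entered through any other side, an n-tile has an end of its label-1 branch
        next to a side at 0; the end is then 1 or -1 with the wrong sign, or a root of
        \<open>y^2 = -1\<close>, and this forces \<open>m dvd 2\<close>.\<close>
      case S2
      hence "m dvd x2" "x2 = e1 + 1" "bclass b1 = S1"
        using b2 cl True * by (auto elim!: generic_endE simp: side_class_def corner_def)
      thus ?thesis using b1 no2 no3 by (auto elim!: generic_endE)
    next
      case S3
      hence x: "m dvd x1" "e1 = x1" "x2 = e1 + 1" "bclass b2 = S1"
        using b1 cl True * by (auto elim!: generic_endE simp: side_class_def corner_def)
      show ?thesis using b2
      proof (cases rule: generic_endE)
        case 1
        have "m dvd 2" by (rule dvd_lin[OF 1(3) x(1), of _ 1 "- (x1 + 2)"])
            (simp add: x power2_eq_square algebra_simps)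
        thus ?thesis using m by simp
      next
        case 2
        have "m dvd 2" by (rule dvd_lin[OF 2(2) x(1), of _ 1 "- 1"]) (simp add: x)
        thus ?thesis using m by simp
      qed (use x in auto)
    qed
  qed
qed

text \<open>At the cut the end of one branch is the start of the other. A tile ends at 1 and starts
  at -1, a label-1 leaf sits at a root of \<open>y^2 = -1\<close>; these conditions exclude one
  another unless \<open>m dvd 2\<close>, so both branches are leaves.\<close>

lemma generic_polygon:
  assumes m: "\<not> m dvd 2" "\<not> m dvd 3" "\<not> m dvd 5" and mn: "m dvd int n"
    and p: "polygon b b'" and L: "m dvd width n b + width n b'"
    and c: "leaves_cong m (leaves n x b)" "leaves_cong m (leaves n (x + width n b) b')"
  shows "kinds b \<union> kinds b' = {}"
proof -
  define y z where "y = x + width n b" and "z = y + width n b'"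
  have b: "generic_end m b x y" and b': "generic_end m b' y z" and z: "m dvd z - x"
    using generic_branch[OF m mn, of b x] generic_branch[OF m mn, of b' y] p c L
    by (auto simp: polygon_def y_def z_def)
  have *: False if "m dvd y - 1" "m dvd y + 1" for y
    using dvd_lin[OF that, of 2 "-1" 1] m by simp
  have **: False if "m dvd y\<^sup>2 + 1" "m dvd y - 1 \<or> m dvd y + 1" for y
    using that(2)
  proof
    assume 1: "m dvd y - 1"
    show False using dvd_lin[OF that(1) 1, of 2 1 "- (y + 1)"] m by (simp add: power2_eq_square algebra_simps)
  next
    assume 1: "m dvd y + 1"
    show False using dvd_lin[OF that(1) 1, of 2 1 "- (y - 1)"] m by (simp add: power2_eq_square algebra_simps)
  qed
  have zx: "m dvd x - 1" if "m dvd z - 1"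
    using dvd_lin[OF that z, of "x - 1" 1 "-1"] by simp
  consider (LL) c d where "b = Leaf c" "b' = Leaf d"
    | (NL) q s u v d where "b = Node q s u v" "b' = Leaf d"
    | (LN) q s u v d where "b = Leaf d" "b' = Node q s u v"
    | (NN) q s u v q' s' u' v' where "b = Node q s u v" "b' = Node q' s' u' v'"
    by (cases b; cases b') auto
  thus ?thesis
  proof cases
    case NL
    hence "m dvd y - 1" "m dvd y\<^sup>2 + 1" using b b' p by (auto simp: generic_end_def polygon_def)
    thus ?thesis using ** by blast
  next
    case LN
    hence "m dvd y + 1" "m dvd y\<^sup>2 + 1" using b b' p by (auto simp: generic_end_def polygon_def)
    thus ?thesis using ** by blast
  next
    case NN
    hence "m dvd y + 1" "m dvd y - 1" using b b' p by (auto simp: generic_end_def polygon_def)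
    thus ?thesis using * by blast
  qed auto
qed

text \<open>Modulo 2, ends of label-1 sides are odd, the other ends are even, and the long corner is
  even. A \<open>(1,1,1)\<close> tile would have facing odd ends at distance 1.\<close>

lemma even_branch:
  assumes "even n"
  shows "wf_branch b \<Longrightarrow> leaves_cong 2 (leaves n x b) \<Longrightarrow>
    False \<notin> kinds b \<and> (if bclass b = S1 then odd x \<and> odd (x + width n b) else even x \<and> even (x + width n b))"
proof (induction b arbitrary: x)
  case (Node q s b1 b2)
  obtain x1 e1 x2 e2 where *: "x1 = x + int (corner n q s)" "e1 = x1 + width n b1"
    "x2 = e1 + int (corner n q (nx s))" "e2 = x2 + width n b2"
    "x + width n (Node q s b1 b2) = e2 + int (corner n q (nx (nx s)))"
    "leaves_cong 2 (leaves n x1 b1)" "leaves_cong 2 (leaves n x2 b2)"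
    using Node_cong[OF Node.prems] by blast
  have "False \<notin> kinds b1 \<and> (if bclass b1 = S1 then odd x1 \<and> odd e1 else even x1 \<and> even e1)"
    "False \<notin> kinds b2 \<and> (if bclass b2 = S1 then odd x2 \<and> odd e2 else even x2 \<and> even e2)"
    using Node.IH(1)[OF _ *(6)] Node.IH(2)[OF _ *(7)] Node.prems(1) unfolding *(2)[symmetric] *(4)[symmetric]
    by simp_all
  moreover have "bclass b1 = side_class q (nx s)" "bclass b2 = side_class q (nx (nx s))"
    using Node.prems by auto
  ultimately show ?case unfolding *(5) using *(1,3) assms
    by (cases q; cases s) (auto simp: side_class_def corner_def)
qed auto

section \<open>The moduli 3 and 5\<close>

text \<open>\<open>r\<close> and \<open>f\<close> are the residues modulo \<open>m\<close> of the positions of the two ends of a branch.\<close>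

definition residue_pair :: "int \<Rightarrow> side \<Rightarrow> int \<Rightarrow> int \<Rightarrow> bool" where
  "residue_pair m c r f \<longleftrightarrow> (if c = S1 then r = 1 \<and> f = m - 1 \<or> r = m - 1 \<and> f = 1 \<or>
       m = 5 \<and> r = f \<and> (r = 2 \<or> r = 3)
     else r = 0 \<and> f = 0)"

definition residue_step :: "int \<Rightarrow> bool \<Rightarrow> side \<Rightarrow> int \<Rightarrow> int" where
  "residue_step m q s r = (if q \<and> s = S3 then r else if r = m - 1 then 0 else r + 1)"

text \<open>A finite check. The pair \<open>(m - 1, 1)\<close> belongs to an n-tile behind its
  label-1 side, and \<open>(1, m - 1)\<close> to the rest of a star or diamond seen from such a
  tile; \<open>(2, 2)\<close> and \<open>(3, 3)\<close> are the two label-1 sides of a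
  diamond.\<close>

lemma residue_pair_tile:
  assumes m: "m \<in> {3, 5}" "0 \<le> r" "r < m" and steps: "residue_step m q s r = r1"
    "residue_pair m (side_class q (nx s)) r1 f1" "residue_step m q (nx s) f1 = r2"
    "residue_pair m (side_class q (nx (nx s))) r2 f2" "residue_step m q (nx (nx s)) f2 = f"
  shows "residue_pair m (side_class q s) r f"
proof (cases q)
  case False
  have m': "m = 3 \<or> m = 5" using m by simp
  show ?thesis
    using m(2,3) m' steps False unfolding residue_pair_def residue_step_def side_class_def
    by (simp only: simp_thms if_True if_False) smt
next
  case True
  show ?thesis
  proof (cases s)
    case S1
    hence "r1 = 0" "f1 = 0" "f2 = 0" using steps(2,4) True by (simp_all add: residue_pair_def side_class_def)
    thus ?thesis using m steps(1,5) True S1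
      by (auto simp: residue_pair_def residue_step_def side_class_def split: if_splits)
  next
    case S2
    hence "r2 = 0" "f2 = 0" using steps(4) True by (simp_all add: residue_pair_def side_class_def)
    thus ?thesis using m steps(1-3,5) True S2
      by (auto simp: residue_pair_def residue_step_def side_class_def split: if_splits)
  next
    case S3
    hence "r1 = 0" "f1 = 0" using steps(2) True by (simp_all add: residue_pair_def side_class_def)
    thus ?thesis using m steps(1,3-) True S3
      by (auto simp: residue_pair_def residue_step_def side_class_def split: if_splits)
  qed
qed

lemma square_plus_one_mod_3: "\<not> 3 dvd (y::int)\<^sup>2 + 1"
proof -
  have "y mod 3 \<in> {0, 1, 2}" by auto
  hence "(y mod 3)\<^sup>2 mod 3 \<in> {0, 1}" by auto
  hence "y\<^sup>2 mod 3 \<in> {0, 1}" by (simp add: power_mod)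
  moreover have z: "\<not> 3 dvd z + 1" if "z mod 3 \<in> {0, 1}" for z :: int using that by auto presburger+
  ultimately show ?thesis using z[of "y\<^sup>2"] by simp
qed

lemma square_plus_one_mod_5: "5 dvd (y::int)\<^sup>2 + 1 \<Longrightarrow> y mod 5 \<in> {2, 3}"
proof -
  assume *: "5 dvd y\<^sup>2 + 1"
  have "y mod 5 \<in> {0, 1, 2, 3, 4}" by auto
  moreover have "(y mod 5)\<^sup>2 mod 5 = y\<^sup>2 mod 5" by (simp add: power_mod)
  moreover have "y\<^sup>2 mod 5 = 4" using * by presburger
  ultimately show ?thesis by auto
qed

lemma mod_corner:
  assumes "m \<in> {3, 5}" "m dvd int n"
  shows "(y + int (corner n q r)) mod m = residue_step m q r (y mod m)"
  using assms by (auto simp: corner_def residue_step_def) presburger+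

lemma branch_residues:
  assumes m: "m \<in> {3, 5}" and mn: "m dvd int n"
  shows "wf_branch b \<Longrightarrow> leaves_cong m (leaves n x b) \<Longrightarrow>
    residue_pair m (bclass b) (x mod m) ((x + width n b) mod m)"
proof (induction b arbitrary: x)
  case (Leaf c)
  thus ?case using m square_plus_one_mod_3 square_plus_one_mod_5
    by (auto simp: residue_pair_def split: if_splits)
next
  case (Node q s b1 b2)
  obtain x1 e1 x2 e2 where *: "x1 = x + int (corner n q s)" "e1 = x1 + width n b1"
    "x2 = e1 + int (corner n q (nx s))" "e2 = x2 + width n b2"
    "x + width n (Node q s b1 b2) = e2 + int (corner n q (nx (nx s)))"
    "leaves_cong m (leaves n x1 b1)" "leaves_cong m (leaves n x2 b2)"
    using Node_cong[OF Node.prems] by blast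
  have b12: "residue_pair m (side_class q (nx s)) (x1 mod m) (e1 mod m)"
    "residue_pair m (side_class q (nx (nx s))) (x2 mod m) (e2 mod m)"
    using Node.IH(1)[OF _ *(6)] Node.IH(2)[OF _ *(7)] Node.prems(1) unfolding *(2)[symmetric] *(4)[symmetric]
    by simp_all
  show ?case unfolding *(5) bclass.simps
    by (rule residue_pair_tile[OF m _ _ _ b12(1) _ b12(2)])
      (use m mod_corner[OF m mn] *(1,3) in auto)
qed

text \<open>The value \<open>m = 1\<close> would give \<open>n = 1\<close>, parity excludes 2, and
  the generic case leaves 3 and 5. Then \<open>n dvd m^2\<close> leaves two values of
  \<open>n\<close> each.\<close>

lemma arithmetic_polygon_cases:
  assumes n: "n \<ge> 2" and p: "polygon b b'" and kinds: "kinds b \<union> kinds b' = UNIV"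
    and ar: "arithmetic (psl ` leaf_group n (polygon_leaves n 0 b b'))"
  obtains m x where "m = 3 \<and> n \<in> {3, 9} \<or> m = 5 \<and> n \<in> {5, 25}" "m dvd width n b + width n b'"
    "leaves_cong m (leaves n x b)" "leaves_cong m (leaves n (x + width n b) b')"
proof -
  obtain m x :: int where m: "m > 0" "int n dvd m\<^sup>2" "m dvd int n" "m dvd width n b + width n b'"
    "leaves_cong m (leaves n x b)" "leaves_cong m (leaves n (x + width n b) b')"
    using arithmetic_polygon_cong[OF n p _ ar] kinds by blast
  have m1: "m \<noteq> 1"
  proof
    assume "m = 1"
    hence "int n dvd 1" using m(2) by simp
    thus False using n by simp
  qed
  have le: "d \<le> k" if "d dvd k" "k > 0" for d k :: int using that by (rule zdvd_imp_le)
  have "m \<noteq> 2"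
  proof
    assume "m = 2"
    moreover hence "even n" using m(3) by simp
    ultimately have "False \<notin> kinds b" "False \<notin> kinds b'"
      using even_branch[of n b x] even_branch[of n b' "x + width n b"] m p by (auto simp: polygon_def)
    thus False using kinds by auto
  qed
  moreover have "m dvd 2 \<or> m dvd 3 \<or> m dvd 5"
    using generic_polygon[OF _ _ _ m(3) p m(4-6)] kinds by auto
  moreover have "m = 2" if "m dvd 2" using le[OF that] m(1) m1 by simp
  moreover have "m = 3" if "m dvd 3"
    using le[OF that] m(1) m1 that by (cases "m = 2") auto
  moreover have "m = 5" if "m dvd 5"
  proof -
    have "m = 2 \<or> m = 3 \<or> m = 4 \<or> m = 5" using le[OF that] m(1) m1 by linarith
    thus ?thesis using that by auto
  qed
  ultimately have "m = 3 \<or> m = 5" by blast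
  moreover have "n \<in> {3, 9}" if "m = 3"
  proof -
    have "int n dvd int (3 ^ 2)" using that m(2) by simp
    hence "n dvd 3 ^ 2" by (simp only: int_dvd_int_iff)
    then obtain i where "i \<le> 2" "n = 3 ^ i" using divides_primepow_nat[of 3 n 2] by auto
    thus ?thesis using n by (cases "i = 0"; cases "i = 1"; cases "i = 2") auto
  qed
  moreover have "n \<in> {5, 25}" if "m = 5"
  proof -
    have "int n dvd int (5 ^ 2)" using that m(2) by simp
    hence "n dvd 5 ^ 2" by (simp only: int_dvd_int_iff)
    then obtain i where "i \<le> 2" "n = 5 ^ i" using divides_primepow_nat[of 5 n 2] by auto
    thus ?thesis using n by (cases "i = 0"; cases "i = 1"; cases "i = 2") auto
  qed
  ultimately show ?thesis using that[of m x] m by blast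
qed

section \<open>Lifting the residues modulo \<open>m\<close> to residues modulo \<open>n + m\<close>\<close>

text \<open>The number \<open>n + m\<close> is the width of the diamond (\<open>m = 5\<close>) and a third of the width of the star
  (\<open>m = 3\<close>); the lattice points are the positions of the marks of these two jigsaws.\<close>

definition lift :: "int \<Rightarrow> nat \<Rightarrow> side \<Rightarrow> int \<Rightarrow> int" where
  "lift m n c x = (if c = S3 then 0 else int n + x mod m)"

definition lattice_point :: "int \<Rightarrow> nat \<Rightarrow> side \<times> int \<Rightarrow> bool" where
  "lattice_point m n p \<longleftrightarrow> (\<exists>r. int n + m dvd snd p - r \<and>
     (fst p = S3 \<and> r = 0 \<or> fst p = S2 \<and> r = int n \<or> fst p = S1 \<and> m = 5 \<and> r \<in> {int n + 2, int n + 3}))"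

definition valid_residue :: "side \<Rightarrow> int \<Rightarrow> bool" where
  "valid_residue c r \<longleftrightarrow> (c = S1 \<longleftrightarrow> r \<noteq> 0)"

lemma residue_pair_valid:
  "m \<in> {3, 5} \<Longrightarrow> residue_pair m c r f \<Longrightarrow> valid_residue c r \<and> valid_residue c f"
  by (auto simp: residue_pair_def valid_residue_def split: if_splits)

text \<open>Modulo \<open>n + m\<close> one period reads \<open>0, n, n + 1, ..., n + m - 1\<close>:
  the long corner leads from \<open>S3\<close> at 0 to \<open>S2\<close> at \<open>n\<close>, and
  corners of width 1 then pass through the label-1 residues and return to 0. So each step modulo
  \<open>m\<close> lifts.\<close>

lemma lift_corner:
  assumes m: "m \<in> {3, 5}" and mn: "m dvd int n"
    and v: "valid_residue (side_class q s) (x mod m)"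
      "valid_residue (side_class q (nx s)) ((x + int (corner n q s)) mod m)"
    and d: "int n + m dvd z - lift m n (side_class q s) x"
  shows "int n + m dvd z + int (corner n q s) - lift m n (side_class q (nx s)) (x + int (corner n q s))"
proof -
  have "int n + m dvd lift m n (side_class q s) x + int (corner n q s) -
      lift m n (side_class q (nx s)) (x + int (corner n q s))"
    using v m unfolding lift_def mod_corner[OF m mn]
    by (cases q; cases s) (auto simp: valid_residue_def side_class_def residue_step_def corner_def split: if_splits)
  from dvd_add[OF d this] show ?thesis by (simp add: algebra_simps)
qed

lemma nx3 [simp]: "nx (nx (nx s)) = s"
  by (cases s) auto

text \<open>The common step of the three inductions that follow; the induction hypotheses appear as
  assumptions.\<close>

lemma Node_lift:
  assumes m: "m \<in> {3, 5}" and mn: "m dvd int n"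
    and wf: "wf_branch (Node q s b1 b2)" and c: "leaves_cong m (leaves n x (Node q s b1 b2))"
    and d: "int n + m dvd z - lift m n (side_class q s) x"
    and IH1: "\<And>x z. leaves_cong m (leaves n x b1) \<Longrightarrow> int n + m dvd z - lift m n (bclass b1) x \<Longrightarrow>
      int n + m dvd z + width n b1 - lift m n (bclass b1) (x + width n b1)"
    and IH2: "\<And>x z. leaves_cong m (leaves n x b2) \<Longrightarrow> int n + m dvd z - lift m n (bclass b2) x \<Longrightarrow>
      int n + m dvd z + width n b2 - lift m n (bclass b2) (x + width n b2)"
  obtains x1 z1 x2 z2 where "x1 = x + int (corner n q s)" "z1 = z + int (corner n q s)"
    "x2 = x1 + width n b1 + int (corner n q (nx s))" "z2 = z1 + width n b1 + int (corner n q (nx s))"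
    "leaves_cong m (leaves n x1 b1)" "leaves_cong m (leaves n x2 b2)"
    "int n + m dvd z1 - lift m n (bclass b1) x1"
    "int n + m dvd z1 + width n b1 - lift m n (bclass b1) (x1 + width n b1)"
    "int n + m dvd z2 - lift m n (bclass b2) x2"
    "int n + m dvd z2 + width n b2 - lift m n (bclass b2) (x2 + width n b2)"
    "int n + m dvd z + width n (Node q s b1 b2) - lift m n (side_class q s) (x + width n (Node q s b1 b2))"
proof -
  define x1 z1 x2 z2 where xz: "x1 = x + int (corner n q s)" "z1 = z + int (corner n q s)"
    "x2 = x1 + width n b1 + int (corner n q (nx s))" "z2 = z1 + width n b1 + int (corner n q (nx s))"
  have cl: "bclass b1 = side_class q (nx s)" "bclass b2 = side_class q (nx (nx s))" using wf by auto
  have c12: "leaves_cong m (leaves n x1 b1)" "leaves_cong m (leaves n x2 b2)"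
    using c by (auto simp: xz)
  have xE: "x + width n (Node q s b1 b2) = x2 + width n b2 + int (corner n q (nx (nx s)))"
    "z + width n (Node q s b1 b2) = z2 + width n b2 + int (corner n q (nx (nx s)))"
    by (simp_all add: xz)
  have v: "valid_residue (side_class q s) (x mod m)"
      "valid_residue (side_class q s) ((x + width n (Node q s b1 b2)) mod m)"
    using residue_pair_valid[OF m branch_residues[OF m mn wf c]] by auto
  have v1: "valid_residue (bclass b1) (x1 mod m)" "valid_residue (bclass b1) ((x1 + width n b1) mod m)"
    and v2: "valid_residue (bclass b2) (x2 mod m)" "valid_residue (bclass b2) ((x2 + width n b2) mod m)"
    using residue_pair_valid[OF m branch_residues[OF m mn _ c12(1)]]
      residue_pair_valid[OF m branch_residues[OF m mn _ c12(2)]] wf by auto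
  have l1: "int n + m dvd z1 - lift m n (bclass b1) x1"
    using lift_corner[OF m mn v(1) _ d] v1(1) by (simp only: xz cl)
  note l1' = IH1[OF c12(1) l1]
  have l2: "int n + m dvd z2 - lift m n (bclass b2) x2"
    using lift_corner[OF m mn, of q "nx s" "x1 + width n b1" "z1 + width n b1"] v1(2) v2(1) l1'
    by (simp only: xz cl)
  note l2' = IH2[OF c12(2) l2]
  have "int n + m dvd z + width n (Node q s b1 b2) - lift m n (side_class q s) (x + width n (Node q s b1 b2))"
    using lift_corner[OF m mn, of q "nx (nx s)" "x2 + width n b2" "z2 + width n b2"] v2(2) v(2) l2'
    by (simp only: xE cl nx3)
  thus ?thesis using that[of x1 z1 x2 z2] xz c12 l1 l1' l2 l2' by blast
qed

lemma branch_lift: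
  assumes m: "m \<in> {3, 5}" and mn: "m dvd int n"
  shows "wf_branch b \<Longrightarrow> leaves_cong m (leaves n x b) \<Longrightarrow> int n + m dvd z - lift m n (bclass b) x \<Longrightarrow>
    int n + m dvd z + width n b - lift m n (bclass b) (x + width n b)"
proof (induction b arbitrary: x z)
  case (Node q s b1 b2)
  show ?case using Node_lift[OF m mn Node.prems[simplified bclass.simps]] Node.IH Node.prems(1) by auto
qed auto

text \<open>A label-1 leaf is impossible for \<open>m = 3\<close>, since -1 is not a square, and has
  residue 2 or 3 for \<open>m = 5\<close>. So after lifting only the marks of a star or a diamond
  occur.\<close>

lemma branch_lattice:
  assumes m: "m \<in> {3, 5}" and mn: "m dvd int n"
  shows "wf_branch b \<Longrightarrow> leaves_cong m (leaves n x b) \<Longrightarrow> int n + m dvd z - lift m n (bclass b) x \<Longrightarrow>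
    \<forall>p\<in>leaves n z b. lattice_point m n p"
proof (induction b arbitrary: x z)
  case (Leaf c)
  thus ?case using m square_plus_one_mod_3[of x] square_plus_one_mod_5[of x]
    by (cases c) (auto simp: lattice_point_def lift_def split: if_splits)
next
  case (Node q s b1 b2)
  have wf: "wf_branch b1" "wf_branch b2" using Node.prems by auto
  obtain x1 z1 x2 z2 where *: "x1 = x + int (corner n q s)" "z1 = z + int (corner n q s)"
    "x2 = x1 + width n b1 + int (corner n q (nx s))" "z2 = z1 + width n b1 + int (corner n q (nx s))"
    "leaves_cong m (leaves n x1 b1)" "leaves_cong m (leaves n x2 b2)"
    "int n + m dvd z1 - lift m n (bclass b1) x1" "int n + m dvd z2 - lift m n (bclass b2) x2"
    using Node_lift[OF m mn Node.prems[simplified bclass.simps] branch_lift[OF m mn wf(1)] branch_lift[OF m mn wf(2)]]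
    by blast
  show ?case using Node.IH(1)[OF wf(1) *(5,7)] Node.IH(2)[OF wf(2) *(6,8)]
    unfolding *(4,2) leaves.simps by blast
qed

section \<open>Finite index\<close>

lemma residue_unique:
  fixes a b d y :: int
  assumes "d dvd y - a" "d dvd y - b" "0 \<le> a" "a < d" "0 \<le> b" "b < d"
  shows "a = b"
proof -
  have "y mod d = a mod d" "y mod d = b mod d" using assms(1,2) by (simp_all add: mod_eq_dvd_iff)
  thus ?thesis using assms by simp
qed

text \<open>The classes \<open>S3\<close>, \<open>S2\<close>, \<open>S1\<close> occupy the disjoint
  residues 0, \<open>n\<close> and those above \<open>n\<close>, so a lattice point that is an end
  of a side has the class of that side.\<close>

lemma lattice_lift:
  assumes m: "m \<in> {3, 5}" and n: "n \<ge> 1" and l: "lattice_point m n (c, y)" and v: "valid_residue d (x mod m)"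
    and d: "int n + m dvd y - lift m n d x"
  shows "c = d" "c = S1 \<Longrightarrow> m = 5 \<and> x mod m \<in> {2, 3}"
proof -
  obtain r where r: "int n + m dvd y - r"
     "c = S3 \<and> r = 0 \<or> c = S2 \<and> r = int n \<or> c = S1 \<and> m = 5 \<and> r \<in> {int n + 2, int n + 3}"
    using l by (auto simp: lattice_point_def)
  have xm: "0 \<le> x mod m" "x mod m < m" using m by auto
  have "r = lift m n d x"
    using r m xm by (intro residue_unique[OF r(1) d]) (auto simp: lift_def)
  define t where "t = x mod m"
  have t: "0 \<le> t" "valid_residue d t" "r = (if d = S3 then 0 else int n + t)"
    using xm v \<open>r = lift m n d x\<close> by (simp_all add: t_def lift_def)
  show "c = d" using r(2) t n
    by (cases d; elim disjE conjE) (auto simp: valid_residue_def)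
  thus "m = 5 \<and> x mod m \<in> {2, 3}" if "c = S1"
    using r(2) t that unfolding t_def[symmetric] by auto
qed

text \<open>Only the long corner contains integers in its interior; modulo \<open>n + m\<close> they
  are \<open>1, ..., n - 1\<close>, where no lattice point lies.\<close>

lemma lattice_corner:
  assumes m: "m \<in> {3, 5}" and l: "lattice_point m n (c, y)"
    and d: "int n + m dvd e - lift m n (side_class q s) x" and y: "e < y" "y < e + int (corner n q s)"
  shows False
proof -
  have s: "q" "s = S3" using y by (auto simp: corner_def split: if_splits)
  obtain r where r: "int n + m dvd y - r" "r = 0 \<or> r = int n \<or> m = 5 \<and> r \<in> {int n + 2, int n + 3}"
    using l by (auto simp: lattice_point_def)
  have "int n + m dvd y - (y - e)" using d s by (simp add: lift_def side_class_def)
  hence "r = y - e"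
    using y s m r by (intro residue_unique[OF r(1)]) (auto simp: corner_def)
  thus False using r(2) y s by (auto simp: corner_def)
qed

text \<open>\<open>G\<close> contains the half-turn at \<open>y\<close> up to a translation by a
  multiple of \<open>d\<close>.\<close>

definition crosses :: "nat \<Rightarrow> (real^2^2) set \<Rightarrow> int \<Rightarrow> side \<Rightarrow> int \<Rightarrow> bool" where
  "crosses n G d c y \<longleftrightarrow> (\<exists>y'. d dvd y' - y \<and> crossing (height n c) y y' \<in> G)"

lemma crossing_sym: "matrix_group G \<Longrightarrow> crossing h x y \<in> G \<Longrightarrow> crossing h y x \<in> G"
  using matrix_groupD(4)[of G "crossing h x y"] adj_crossing matrix_group_pm_eq by blast

text \<open>Descend in the tree to a side, inner or outer, that has the lattice point
  \<open>y\<close> as an end. Its class and residue force the residues of both ends to agree, so the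
  crossing of this side moves \<open>y\<close> by a multiple of \<open>n + m\<close>.\<close>

lemma branch_crosses:
  assumes m: "m \<in> {3, 5}" and mn: "m dvd int n" and n: "n \<ge> 1" and G: "matrix_group G"
  shows "wf_branch b \<Longrightarrow> leaves_cong m (leaves n x b) \<Longrightarrow> int n + m dvd z - lift m n (bclass b) x \<Longrightarrow>
    \<forall>p\<in>leaves n z b. leaf_turn n p \<in> G \<Longrightarrow> z \<le> y \<Longrightarrow> y \<le> z + width n b \<Longrightarrow> lattice_point m n (c, y) \<Longrightarrow>
    crosses n G (int n + m) c y"
proof (induction b arbitrary: x z)
  case (Leaf d)
  have v: "valid_residue d (x mod m)"
    using residue_pair_valid[OF m branch_residues[OF m mn Leaf(1,2)]] by simp
  have "y = z" using Leaf by simp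
  hence "c = d" using lattice_lift(1)[OF m n Leaf(7) v] Leaf by simp
  thus ?case using Leaf \<open>y = z\<close> by (auto simp: crosses_def leaf_turn_def intro!: exI[of _ z])
next
  case (Node q s b1 b2)
  let ?b = "Node q s b1 b2" and ?D = "int n + m"
  have wf: "wf_branch b1" "wf_branch b2" using Node.prems by auto
  have cl: "bclass b1 = side_class q (nx s)" "bclass b2 = side_class q (nx (nx s))" using Node.prems by auto
  obtain x1 z1 x2 z2 where *: "x1 = x + int (corner n q s)" "z1 = z + int (corner n q s)"
    "x2 = x1 + width n b1 + int (corner n q (nx s))" "z2 = z1 + width n b1 + int (corner n q (nx s))"
    "leaves_cong m (leaves n x1 b1)" "leaves_cong m (leaves n x2 b2)"
    "?D dvd z1 - lift m n (bclass b1) x1"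
    "?D dvd z1 + width n b1 - lift m n (bclass b1) (x1 + width n b1)"
    "?D dvd z2 - lift m n (bclass b2) x2"
    "?D dvd z2 + width n b2 - lift m n (bclass b2) (x2 + width n b2)"
    "?D dvd z + width n ?b - lift m n (side_class q s) (x + width n ?b)"
    using Node_lift[OF m mn Node.prems(1-3)[simplified bclass.simps] branch_lift[OF m mn wf(1)] branch_lift[OF m mn wf(2)]]
    by blast
  have zE: "z + width n ?b = z2 + width n b2 + int (corner n q (nx (nx s)))"
    by (simp add: *)
  have leaf: "\<forall>p\<in>leaves n z1 b1. leaf_turn n p \<in> G" "\<forall>p\<in>leaves n z2 b2. leaf_turn n p \<in> G"
    using Node.prems(4) unfolding *(4,2) by auto
  have cr: "crossing (height n (side_class q s)) z (z + width n ?b) \<in> G"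
    using branch_crossing[OF n G Node.prems(1,4)] by simp
  have rp: "residue_pair m (side_class q s) (x mod m) ((x + width n ?b) mod m)"
    using branch_residues[OF m mn Node.prems(1,2)] by simp
  note v = residue_pair_valid[OF m rp]
  have ends: "?D dvd width n ?b" if "x mod m = (x + width n ?b) mod m"
  proof -
    have eq: "lift m n (side_class q s) (x + width n ?b) = lift m n (side_class q s) x"
      unfolding lift_def that ..
    show ?thesis using dvd_diff[OF *(11) Node.prems(3)] unfolding eq bclass.simps
      by (simp del: width.simps)
  qed
  consider "y = z" | "z < y" "y < z1" | "z1 \<le> y" "y \<le> z1 + width n b1" | "z1 + width n b1 < y" "y < z2"
    | "z2 \<le> y" "y \<le> z2 + width n b2" | "z2 + width n b2 < y" "y < z + width n ?b" | "y = z + width n ?b"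
    using Node.prems(5,6) by linarith
  thus ?case
  proof cases
    case 1
    have c: "c = side_class q s" "c = S1 \<Longrightarrow> m = 5 \<and> x mod m \<in> {2, 3}"
      using lattice_lift[OF m n Node.prems(7) conjunct1[OF v]] Node.prems(3) 1 by auto
    hence "x mod m = (x + width n ?b) mod m"
      using rp by (auto simp: residue_pair_def split: if_splits)
    from ends[OF this] have "?D dvd (z + width n ?b) - y" using 1 by (simp del: width.simps)
    thus ?thesis unfolding crosses_def using cr unfolding 1 c(1) by blast
  next
    case 2
    thus ?thesis using lattice_corner[OF m Node.prems(7,3)[simplified bclass.simps]] *(2) by auto
  next
    case 3
    thus ?thesis using Node.IH(1)[OF wf(1) *(5,7) leaf(1) _ _ Node.prems(7)] by blast
  next
    case 4
    thus ?thesis using lattice_corner[OF m Node.prems(7) *(8)[unfolded cl]] *(4) by auto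
  next
    case 5
    thus ?thesis using Node.IH(2)[OF wf(2) *(6,9) leaf(2) _ _ Node.prems(7)] by blast
  next
    case 6
    thus ?thesis using lattice_corner[OF m Node.prems(7) *(10)[unfolded cl]] zE by auto
  next
    case 7
    have c: "c = side_class q s" "c = S1 \<Longrightarrow> m = 5 \<and> (x + width n ?b) mod m \<in> {2, 3}"
      using lattice_lift[OF m n Node.prems(7) conjunct2[OF v]] *(11) 7 by auto
    hence "x mod m = (x + width n ?b) mod m"
      using rp by (auto simp: residue_pair_def split: if_splits)
    from ends[OF this] have "?D dvd z - y" using 7 by (simp del: width.simps)
    thus ?thesis unfolding crosses_def using crossing_sym[OF G cr] unfolding 7 c(1) by blast
  qed
qed

lemma shift_int_mult:
  assumes G: "matrix_group G" and L: "shift (real_of_int L) \<in> G"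
  shows "shift (real_of_int (k * L)) \<in> G"
proof -
  have nat: "shift (real_of_int (int j * L)) \<in> G" for j
  proof (induction j)
    case 0
    show ?case using matrix_groupD(2)[OF G] by (simp add: shift_def mat_1_mat2)
  next
    case (Suc j)
    from matrix_groupD(5)[OF G L this] show ?case by (simp add: shift_add algebra_simps)
  qed
  show ?thesis
  proof (cases "k \<ge> 0")
    case True
    thus ?thesis using nat[of "nat k"] by simp
  next
    case False
    thus ?thesis using matrix_groupD(4)[OF G nat[of "nat (- k)"]] by (simp add: adj_shift)
  qed
qed

lemma crossing_shift: "crossing h (x + a) (y + b) = shift a ** crossing h x y ** shift (- b)"
proof -
  have "shift a ** crossing h x y ** shift (- b) = (shift a ** shift x) ** turn h ** (shift (- y) ** shift (- b))"
    by (simp add: crossing_def matrix_mul_assoc)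
  thus ?thesis by (simp add: crossing_def shift_add add.commute)
qed

text \<open>\<open>x\<close> is a starting position adapted to the congruences modulo
  \<open>m\<close>, and \<open>z\<close> is its lift modulo \<open>n + m\<close>, from which all
  marks become lattice points.\<close>

definition standard_polygon :: "int \<Rightarrow> nat \<Rightarrow> int \<Rightarrow> branch \<Rightarrow> branch \<Rightarrow> bool" where
  "standard_polygon m n z b b' \<longleftrightarrow> polygon b b' \<and> kinds b \<union> kinds b' \<noteq> {} \<and>
     (\<exists>x. int n + m dvd z - lift m n (bclass b) x \<and> m dvd width n b + width n b' \<and>
     leaves_cong m (leaves n x b) \<and> leaves_cong m (leaves n (x + width n b) b'))"

lemma width_nonneg: "width n b \<ge> 0"
  by (induction b) auto

lemma width_pos: "kinds b \<noteq> {} \<Longrightarrow> n \<ge> 1 \<Longrightarrow> width n b > 0"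
  using width_nonneg by (cases b) (auto simp: corner_def add_nonneg_pos add_pos_nonneg)

lemma standard_polygon_width:
  assumes "standard_polygon m n z b b'" "n \<ge> 1"
  shows "width n b + width n b' > 0"
  using assms width_nonneg[of n b] width_nonneg[of n b'] width_pos[of b n] width_pos[of b' n]
  unfolding standard_polygon_def by fastforce

lemma polygon_lattice:
  assumes m: "m \<in> {3, 5}" and mn: "m dvd int n" and s: "standard_polygon m n z b b'"
  shows "\<forall>p\<in>polygon_leaves n z b b'. lattice_point m n p"
proof -
  obtain x where *: "int n + m dvd z - lift m n (bclass b) x"
     "leaves_cong m (leaves n x b)" "leaves_cong m (leaves n (x + width n b) b')" "polygon b b'"
    using s by (auto simp: standard_polygon_def)
  have "int n + m dvd z + width n b - lift m n (bclass b') (x + width n b)"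
    using branch_lift[OF m mn _ *(2,1)] *(4) by (simp add: polygon_def)
  thus ?thesis using branch_lattice[OF m mn _ *(2,1)] branch_lattice[OF m mn _ *(3), of "z + width n b"] *(4)
    unfolding polygon_leaves_def polygon_def by blast
qed

text \<open>The two branches cover one period \<open>L\<close>, which is a multiple of
  \<open>n + m\<close> and a translation in \<open>G\<close>; so \<open>y\<close> can be moved into
  this period and found in one of the trees.\<close>

lemma polygon_crosses:
  assumes m: "m \<in> {3, 5}" and mn: "m dvd int n" and n: "n \<ge> 1" and G: "matrix_group G"
    and s: "standard_polygon m n z b b'"
    and leaf: "\<forall>p\<in>polygon_leaves n z b b'. leaf_turn n p \<in> G" and l: "lattice_point m n (c, y)"
  shows "crosses n G (int n + m) c y"
proof -
  let ?D = "int n + m"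
  obtain x where *: "int n + m dvd z - lift m n (bclass b) x" "m dvd width n b + width n b'"
     "leaves_cong m (leaves n x b)" "leaves_cong m (leaves n (x + width n b) b')" "polygon b b'"
    using s by (auto simp: standard_polygon_def)
  define L where "L = width n b + width n b'"
  have L: "L > 0"
    using standard_polygon_width[OF s n] by (simp add: L_def)
  have wf: "wf_branch b" "wf_branch b'" "bclass b' = bclass b" using *(5) by (auto simp: polygon_def)
  have mid: "?D dvd z + width n b - lift m n (bclass b') (x + width n b)"
    using branch_lift[OF m mn wf(1) *(3,1)] wf by simp
  have "?D dvd z + width n b + width n b' - lift m n (bclass b') (x + width n b + width n b')"
    using branch_lift[OF m mn wf(2) *(4) mid] .
  moreover have "lift m n (bclass b') (x + width n b + width n b') = lift m n (bclass b) x"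
  proof -
    obtain k where "width n b + width n b' = m * k" using *(2) by blast
    hence "x + width n b + width n b' = x + m * k" by simp
    thus ?thesis unfolding lift_def wf(3) by (simp only: mod_mult_self2)
  qed
  ultimately have "?D dvd (z + width n b + width n b' - lift m n (bclass b) x) - (z - lift m n (bclass b) x)"
    by (intro dvd_diff[OF _ *(1)]) simp
  hence DL: "?D dvd L" by (simp add: L_def)
  define k where "k = (y - z) div L"
  define y0 where "y0 = y - k * L"
  have y0: "z \<le> y0" "y0 < z + L"
    using L pos_mod_bound[of L "y - z"] pos_mod_sign[of L "y - z"]
    unfolding y0_def k_def minus_mult_div_eq_mod[symmetric] by (simp_all add: algebra_simps)
  have "?D dvd k * L" using DL by simp
  have l0: "lattice_point m n (c, y0)"
  proof -
    obtain r where r: "?D dvd y - r"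
       "c = S3 \<and> r = 0 \<or> c = S2 \<and> r = int n \<or> c = S1 \<and> m = 5 \<and> r \<in> {int n + 2, int n + 3}"
      using l by (auto simp: lattice_point_def)
    have "?D dvd (y - r) - k * L" using r(1) \<open>?D dvd k * L\<close> by (rule dvd_diff)
    hence "?D dvd y0 - r" by (simp add: y0_def algebra_simps)
    thus ?thesis using r(2) by (auto simp: lattice_point_def)
  qed
  have leaf': "\<forall>p\<in>leaves n z b. leaf_turn n p \<in> G" "\<forall>p\<in>leaves n (z + width n b) b'. leaf_turn n p \<in> G"
    using leaf by (auto simp: polygon_leaves_def)
  have "crosses n G ?D c y0"
  proof (cases "y0 \<le> z + width n b")
    case True
    thus ?thesis using branch_crosses[OF m mn n G wf(1) *(3,1) leaf'(1) y0(1) _ l0] by blast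
  next
    case False
    thus ?thesis using branch_crosses[OF m mn n G wf(2) *(4) mid leaf'(2) _ _ l0] y0(2) by (simp add: L_def)
  qed
  then obtain y' where y': "?D dvd y' - y0" "crossing (height n c) y0 y' \<in> G" by (auto simp: crosses_def)
  have "shift (real_of_int (k * L)) \<in> G"
    using polygon_shift[OF n G *(5) leaf] by (intro shift_int_mult[OF G]) (simp add: L_def)
  hence "shift (real_of_int (k * L)) ** crossing (height n c) y0 y' \<in> G"
    using y'(2) by (rule matrix_groupD(5)[OF G])
  also have "shift (real_of_int (k * L)) ** crossing (height n c) y0 y' = crossing (height n c) y y'"
    using crossing_shift[of "height n c" y0 "k * L" y' 0] by (simp add: y0_def shift_def flip: mat_1_mat2)
  finally have "crossing (height n c) y y' \<in> G" .
  moreover have "?D dvd (y' - y0) - k * L" using y'(1) \<open>?D dvd k * L\<close> by (rule dvd_diff)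
  ultimately show ?thesis unfolding crosses_def y0_def by (intro exI[of _ y']) simp
qed

text \<open>The cosets of the translations by multiples of \<open>D = n + m\<close> are carried to
  one another by half-turns at lattice points: a translation followed by the half-turn at
  \<open>y\<close> equals an element crossing at \<open>y + k * D\<close>, followed by another such
  translation.\<close>

lemma polygon_finite_cover:
  assumes m: "m \<in> {3, 5}" and mn: "m dvd int n" and n: "n \<ge> 1"
    and s: "standard_polygon m n z b b'" and Y: "\<forall>p\<in>Y. lattice_point m n p"
  shows "finite_cover (leaf_group n (polygon_leaves n z b b')) (leaf_group n Y)"
proof -
  let ?G = "leaf_group n (polygon_leaves n z b b')"
  define D where "D = int n + m"
  have G: "matrix_group ?G" using n by (rule matrix_group_leaf_group)
  have mem: "\<forall>p\<in>polygon_leaves n z b b'. leaf_turn n p \<in> ?G" by (simp add: leaf_group_mem)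
  define X where "X = {A. \<exists>B\<in>?G. \<exists>k. A = B ** shift (real_of_int (k * D))}"
  have neg: "- A \<in> X" if A: "A \<in> X" for A
  proof -
    obtain B k where "B \<in> ?G" "A = B ** shift (real_of_int (k * D))" using A unfolding X_def by blast
    thus ?thesis using matrix_groupD(3)[OF G] unfolding X_def by (metis (mono_tags, lifting) mem_Collect_eq neg_mult_left)
  qed
  have pm: "A \<in> X" if "B \<in> X" "A \<doteq> B" for A B using that neg by (auto simp: pm_eq_def)
  have turn: "A ** leaf_turn n p \<in> X" if A: "A \<in> X" and p: "p \<in> Y" for A p
  proof -
    obtain c y where cy: "p = (c, y)" by (cases p)
    obtain B k where B: "B \<in> ?G" "A = B ** shift (real_of_int (k * D))" using A unfolding X_def by blast
    have "lattice_point m n (c, y + k * D)"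
    proof -
      have "lattice_point m n (c, y)" using Y p cy by blast
      then obtain r where r: "int n + m dvd y - r"
         "c = S3 \<and> r = 0 \<or> c = S2 \<and> r = int n \<or> c = S1 \<and> m = 5 \<and> r \<in> {int n + 2, int n + 3}"
        by (auto simp: lattice_point_def)
      have "int n + m dvd (y - r) + k * D" using r(1) by (simp add: D_def)
      thus ?thesis using r(2) by (auto simp: lattice_point_def algebra_simps)
    qed
    from polygon_crosses[OF m mn n G s mem this]
    obtain y' where y': "D dvd y' - (y + k * D)" "crossing (height n c) (y + k * D) y' \<in> ?G"
      unfolding crosses_def D_def by auto
    obtain j where j: "y' - (y + k * D) = D * j" using y'(1) by blast
    have "A ** leaf_turn n p = B ** (shift (real_of_int (k * D)) ** crossing (height n c) y y)"
      unfolding B cy leaf_turn_def by (simp add: matrix_mul_assoc)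
    also have "shift (real_of_int (k * D)) ** crossing (height n c) y y =
        crossing (height n c) (y + k * D) y' ** shift (y' - y)"
      by (simp add: crossing_mat2 shift_def add_divide_distrib diff_divide_distrib algebra_simps)
    also have "y' - y = (j + k) * D" using j by (simp add: algebra_simps)
    finally have "A ** leaf_turn n p = (B ** crossing (height n c) (y + k * D) y') ** shift (real_of_int ((j + k) * D))"
      by (simp add: matrix_mul_assoc)
    thus ?thesis using matrix_groupD(5)[OF G B(1) y'(2)] unfolding X_def by blast
  qed
  have adj: "adj (leaf_turn n p) \<doteq> leaf_turn n p" for p
    by (simp add: leaf_turn_def adj_crossing)
  have closed: "(\<forall>A\<in>X. A ** g \<in> X) \<and> (\<forall>A\<in>X. A ** adj g \<in> X)" if "g \<in> leaf_group n Y" for g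
    using that unfolding leaf_group_def
  proof induction
    case (incl g)
    then obtain p where p: "p \<in> Y" "g = leaf_turn n p" by blast
    thus ?case using turn pm[OF turn] pm_eq_mult[OF pm_eq_refl adj] by blast
  next
    case (neg g)
    thus ?case using \<open>\<And>A. A \<in> X \<Longrightarrow> - A \<in> X\<close> by simp
  next
    case (mult g h)
    thus ?case by (simp add: adj_mult matrix_mul_assoc)
  qed auto
  have one: "mat 1 \<in> X"
    unfolding X_def using matrix_groupD(2)[OF G]
    by (auto intro!: bexI[of _ "mat 1"] exI[of _ 0] simp: shift_def mat_1_mat2)
  define L where "L = width n b + width n b'"
  have L: "L > 0"
    using standard_polygon_width[OF s n] by (simp add: L_def)
  have sL: "shift (real_of_int L) \<in> ?G"
    using polygon_shift[OF n G, of b b' z] s leaf_group_mem by (auto simp: standard_polygon_def L_def)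
  have "\<exists>B\<in>?G. \<exists>E\<in>(\<lambda>k. shift (real_of_int (k * D))) ` {0..<L}. g = B ** E" if "g \<in> leaf_group n Y" for g
  proof -
    have "mat 1 ** g \<in> X" using closed[OF that] one by blast
    then obtain B k where B: "B \<in> ?G" "g = B ** shift (real_of_int (k * D))" unfolding X_def by auto
    \<comment> \<open>The translation by \<open>L\<close> lies in the group, so \<open>k\<close>
      matters only modulo \<open>L\<close>.\<close>
    have "shift (real_of_int (k * D)) =
        shift (real_of_int ((D * (k div L)) * L)) ** shift (real_of_int ((k mod L) * D))"
    proof -
      have "k * D = (D * (k div L)) * L + (k mod L) * D"
        using div_mult_mod_eq[of k L] by (metis distrib_right mult.commute mult.left_commute)
      thus ?thesis by (simp only: shift_add of_int_add)
    qed
    hence "g = (B ** shift (real_of_int ((D * (k div L)) * L))) ** shift (real_of_int ((k mod L) * D))"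
      using B(2) by (simp add: matrix_mul_assoc)
    moreover have "k mod L \<in> {0..<L}" using L by simp
    moreover have "B ** shift (real_of_int ((D * (k div L)) * L)) \<in> ?G"
      using matrix_groupD(5)[OF G B(1)] shift_int_mult[OF G sL] by blast
    ultimately show ?thesis by blast
  qed
  thus ?thesis unfolding finite_cover_def
    by (intro exI[of _ "(\<lambda>k. shift (real_of_int (k * D))) ` {0..<L}"]) auto
qed

lemma arithmetic_standard_polygon:
  assumes n: "n \<ge> 2" and p: "polygon b b'" and kinds: "kinds b \<union> kinds b' = UNIV"
    and ar: "\<And>x. arithmetic (psl ` leaf_group n (polygon_leaves n x b b'))"
  obtains m z where "m = 3 \<and> n \<in> {3, 9} \<or> m = 5 \<and> n \<in> {5, 25}" "standard_polygon m n z b b'"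
proof -
  obtain m x where m: "m = 3 \<and> n \<in> {3, 9} \<or> m = 5 \<and> n \<in> {5, 25}" "m dvd width n b + width n b'"
    "leaves_cong m (leaves n x b)" "leaves_cong m (leaves n (x + width n b) b')"
    using arithmetic_polygon_cases[OF n p kinds ar[of 0]] by blast
  moreover have "standard_polygon m n (lift m n (bclass b) x) b b'"
    unfolding standard_polygon_def using p kinds m by (auto intro!: exI[of _ x])
  ultimately show ?thesis using that by blast
qed

section \<open>Groups commensurable with the modular group\<close>

lemma SL2Z_cases:
  assumes "A \<in> SL2Z"
  obtains a b c d :: int where "A = mat2 a b c d" "a * d - b * c = 1"
proof -
  have "\<forall>i j. A $ i $ j \<in> \<int>" using assms by (simp add: SL2Z_def)
  then obtain a b c d :: int where e: "A$1$1 = a" "A$1$2 = b" "A$2$1 = c" "A$2$2 = d"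
    by (metis Ints_cases)
  have "real_of_int (a * d - b * c) = 1" using assms e by (simp add: SL2Z_def SL2_iff)
  hence "a * d - b * c = 1" by linarith
  thus ?thesis using that[of a b c d] e mat2_eta[of A] by metis
qed

text \<open>The Euclidean algorithm on the bottom row of a matrix.\<close>

lemma SL2Z_subset:
  assumes neg: "\<And>A. A \<in> X \<Longrightarrow> - A \<in> X" and shift: "\<And>j::int. shift j \<in> X"
    and right: "\<And>A. \<And>j::int. A \<in> X \<Longrightarrow> A ** shift j \<in> X" "\<And>A. A \<in> X \<Longrightarrow> A ** turn 1 \<in> X"
  shows "SL2Z \<subseteq> X"
proof -
  have "mat2 a b c d \<in> X" if "nat \<bar>c\<bar> = k" "a * d - b * c = 1" for k and a b c d :: int
    using that
  proof (induction k arbitrary: a b c d rule: less_induct)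
    case (less k)
    show ?case
    proof (cases "c = 0")
      case True
      hence "a * d = 1" using less.prems by simp
      hence "a = 1 \<and> d = 1 \<or> a = -1 \<and> d = -1" by (simp add: zmult_eq_1_iff)
      moreover have "- shift (real_of_int (- b)) \<in> X" using shift neg by blast
      ultimately show ?thesis using True shift[of b] by (auto simp: shift_def)
    next
      case False
      define q where "q = d div c"
      define r where "r = d - q * c"
      have r: "\<bar>r\<bar> < \<bar>c\<bar>"
        using False abs_mod_less[of c d] by (simp add: r_def q_def minus_div_mult_eq_mod)
      define b' where "b' = b - q * a"
      have "mat2 b' (- a) r (- c) \<in> X"
      proof (rule less.IH[of "nat \<bar>r\<bar>", simplified of_int_minus])
        show "nat \<bar>r\<bar> < k" using r less.prems(1) by simp
        show "b' * (- c) - (- a) * r = 1" using less.prems(2) by (simp add: b'_def r_def algebra_simps)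
      qed simp
      hence "mat2 b' (- a) r (- c) ** turn 1 ** shift q \<in> X" using right by blast
      moreover have "mat2 b' (- a) r (- c) ** turn 1 ** shift q = - mat2 a b c d"
        by (simp add: turn_def shift_def b'_def r_def algebra_simps)
      ultimately show ?thesis using neg by fastforce
    qed
  qed
  thus ?thesis by (metis SL2Z_cases subsetI)
qed

lemma crossing_cong:
  assumes G: "matrix_group G" and L: "shift (real_of_int L) \<in> G"
    and c: "crossing h (real_of_int x) (real_of_int y) \<in> G" and d: "L dvd x' - x" "L dvd y' - y"
  shows "crossing h (real_of_int x') (real_of_int y') \<in> G"
proof -
  obtain j k where jk: "x' = x + j * L" "y' = y + k * L"
    using d by (metis add_diff_cancel_left' diff_add_cancel dvdE mult.commute add.commute)
  have "shift (real_of_int (j * L)) ** crossing h x y ** shift (real_of_int ((- k) * L)) \<in> G"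
    using matrix_groupD(5)[OF G] shift_int_mult[OF G L] c by blast
  thus ?thesis using crossing_shift[of h x "j * L" y "k * L"] jk by simp
qed

text \<open>The relation of an n-tile with \<open>n = p\<close>: the half-turns at the two ends of
  its long corner combine to the crossing of its label-1 side, in either direction.\<close>

lemma crossing_square:
  assumes "h > 0" "h\<^sup>2 = p"
  shows "crossing h x x ** crossing h (x + p) (x + p) \<doteq> crossing 1 (x - 1) (x + p + 1)"
    "crossing h x x ** crossing h (x - p) (x - p) \<doteq> crossing 1 (x + 1) (x - p - 1)"
  using assms by (auto simp: crossing_mat2 pm_eq_def field_simps power2_eq_square)

section \<open>Enumerating cosets in SL(2,Z)\<close>

lemma finite_cover_int:
  fixes L :: int
  assumes G: "matrix_group G" and L: "L > 0" and sL: "shift (real_of_int L) \<in> G"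
    and u: "u \<in> SL2" "\<And>k. u ** shift (real_of_int (k * L)) ** adj u \<in> G"
  shows "\<exists>B'\<in>G. \<exists>D\<in>(\<lambda>j. u ** shift (real_of_int j)) ` {0..<L}. u ** shift (real_of_int j) = B' ** D"
proof -
  have "u ** shift (real_of_int j) = u ** shift (real_of_int ((j div L) * L)) ** shift (real_of_int (j mod L))"
    by (simp add: shift_add flip: matrix_mul_assoc of_int_add of_int_mult)
  also have "\<dots> = (u ** shift (real_of_int ((j div L) * L)) ** adj u) ** (u ** shift (real_of_int (j mod L)))"
    by (simp add: adj_left_assoc[OF u(1)] flip: matrix_mul_assoc)
  finally show ?thesis using u(2)[of "j div L"] L by (auto intro!: bexI)
qed

lemma SL2Z_shift [simp]: "shift (real_of_int j) \<in> SL2Z"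
  by (simp add: shift_def)

lemma SL2Z_turn [simp]: "turn 1 \<in> SL2Z"
  by (simp add: turn_def)

text \<open>If the right factors are integral, so are the left ones.\<close>

lemma finite_cover_integral_factor:
  assumes "matrix_group G" "finite C" "C \<subseteq> SL2Z" "\<And>A. A \<in> SL2Z \<Longrightarrow> \<exists>B\<in>G. \<exists>D\<in>C. A = B ** D"
  shows "finite_cover (G \<inter> SL2Z) SL2Z"
proof -
  have "\<exists>B\<in>G \<inter> SL2Z. \<exists>D\<in>C. A = B ** D" if A: "A \<in> SL2Z" for A
  proof -
    obtain B D where BD: "B \<in> G" "D \<in> C" "A = B ** D" using assms(4)[OF A] by blast
    have D: "D \<in> SL2Z" "D \<in> SL2" using BD assms(3) by (auto simp: SL2Z_def)
    have "A ** adj D = B" using BD(3) adj_right[OF D(2)] by (simp flip: matrix_mul_assoc)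
    hence "B \<in> SL2Z" using A D matrix_groupD(4,5)[OF matrix_group_SL2Z] by metis
    thus ?thesis using BD by blast
  qed
  moreover have "C \<subseteq> SL2" using assms(3) by (auto simp: SL2Z_def)
  ultimately show ?thesis using assms(2) unfolding finite_cover_def by blast
qed

text \<open>\<open>shift j ** turn 1\<close> equals \<open>crossing 1 j k ** shift k\<close>, so the
  half-turn leads from the coset of \<open>shift j\<close> to that of \<open>shift k\<close>. The
  translations thus represent all cosets, and they matter only modulo \<open>L\<close>.\<close>

lemma finite_cover_SL2Z_one_cusp:
  fixes L :: int
  assumes G: "matrix_group G" and L: "L > 0" and sL: "shift (real_of_int L) \<in> G"
    and cr: "\<And>j::int. \<exists>k::int. crossing 1 j k \<in> G"
  shows "finite_cover (G \<inter> SL2Z) SL2Z"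
proof -
  define X where "X = {A. \<exists>B\<in>G. \<exists>j::int. A = B ** shift j}"
  have "SL2Z \<subseteq> X"
  proof (rule SL2Z_subset)
    show "shift (real_of_int j) \<in> X" for j
      unfolding X_def using matrix_groupD(2)[OF G] by (auto intro!: bexI[of _ "mat 1"])
  next
    fix A assume "A \<in> X"
    then obtain B j where B: "B \<in> G" "A = B ** shift (real_of_int j)" unfolding X_def by blast
    have "- A = (- B) ** shift (real_of_int j)" using B by simp
    thus "- A \<in> X" using matrix_groupD(3)[OF G B(1)] unfolding X_def by blast
    have "A ** shift (real_of_int i) = B ** shift (real_of_int (j + i))" for i
      using B by (simp add: shift_add flip: matrix_mul_assoc)
    thus "A ** shift (real_of_int i) \<in> X" for i using B(1) unfolding X_def by blast
    obtain k :: int where k: "crossing 1 j k \<in> G" using cr by blast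
    have "A ** turn 1 = B ** (crossing 1 j k ** shift k)"
      using B(2) by (simp add: crossing_mat2 shift_def turn_def flip: matrix_mul_assoc)
    hence "A ** turn 1 = (B ** crossing 1 j k) ** shift k" by (simp add: matrix_mul_assoc)
    thus "A ** turn 1 \<in> X" using matrix_groupD(5)[OF G B(1) k] unfolding X_def by blast
  qed
  have "\<exists>B\<in>G. \<exists>D\<in>(\<lambda>j. shift (real_of_int j)) ` {0..<L}. A = B ** D" if A: "A \<in> SL2Z" for A
  proof -
    obtain B j where B: "B \<in> G" "A = B ** shift (real_of_int j)"
      using A \<open>SL2Z \<subseteq> X\<close> unfolding X_def by blast
    obtain B' D where "B' \<in> G" "D \<in> (\<lambda>j. mat 1 ** shift (real_of_int j)) ` {0..<L}"
        "mat 1 ** shift (real_of_int j) = B' ** D"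
      using finite_cover_int[OF G L sL SL2_one, of j] shift_int_mult[OF G sL] by auto
    thus ?thesis using B matrix_groupD(5)[OF G B(1)]
      by (intro bexI[of _ "B ** B'"] bexI[of _ D]) (auto simp: matrix_mul_assoc)
  qed
  thus ?thesis
    by (intro finite_cover_integral_factor[OF G, of "(\<lambda>j. shift (real_of_int j)) ` {0..<L}"]) auto
qed

text \<open>At positions divisible by \<open>p\<close> the half-turn leads to a second family of
  cosets, those of \<open>turn 1 ** shift j\<close>. The two families belong to the cusps infinity
  and 0.\<close>

lemma finite_cover_SL2Z_two_cusps:
  fixes L :: int and p :: nat
  assumes p: "p \<ge> 1" and G: "matrix_group G" and L: "L > 0" and sL: "shift (real_of_int L) \<in> G"
    and tu: "\<And>i::int. crossing (sqrt p) (p * i) (p * i) \<in> G"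
    and cr: "\<And>j::int. \<not> p dvd j \<Longrightarrow> \<exists>k::int. crossing 1 j k \<in> G"
  shows "finite_cover (G \<inter> SL2Z) SL2Z"
proof -
  \<comment> \<open>Up to sign the product of the half-turns of height \<open>sqrt p\<close> at
    \<open>p * i\<close> and at 0; unlike its factors it is always integral.\<close>
  define g where "g i = mat2 (1 + real p * real_of_int i ^ 2) (p * real_of_int i) i 1" for i :: int
  have gG: "g i \<in> G" for i
  proof -
    have "crossing (sqrt p) (p * i) (p * i) ** crossing (sqrt p) (p * (0::int)) (p * (0::int)) \<in> G"
      using matrix_groupD(5)[OF G] tu by blast
    also have "?this \<longleftrightarrow> g i \<in> G"
      using p by (intro matrix_group_pm_eq[OF G])
        (auto simp: crossing_mat2 g_def pm_eq_def field_simps power2_eq_square)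
    finally show ?thesis .
  qed
  have g: "shift (real_of_int (int p * i)) ** turn 1 = g i ** turn 1 ** shift (real_of_int i)" for i
    by (simp add: g_def shift_def turn_def power2_eq_square algebra_simps)
  have gSL: "g i \<in> SL2" for i using gG matrix_groupD(1)[OF G] by blast
  define X where "X = {A. \<exists>B\<in>G. \<exists>j::int. A = B ** shift j \<or> A = B ** turn 1 ** shift j}"
  have "SL2Z \<subseteq> X"
  proof (rule SL2Z_subset)
    show "shift (real_of_int j) \<in> X" for j
      unfolding X_def using matrix_groupD(2)[OF G] by (auto intro!: bexI[of _ "mat 1"])
  next
    fix A assume "A \<in> X"
    then obtain B j where B: "B \<in> G" "A = B ** shift (real_of_int j) \<or> A = B ** turn 1 ** shift (real_of_int j)"
      unfolding X_def by blast
    have "- A = (- B) ** shift (real_of_int j) \<or> - A = (- B) ** turn 1 ** shift (real_of_int j)" using B by auto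
    thus "- A \<in> X" using matrix_groupD(3)[OF G B(1)] unfolding X_def by blast
    have "A ** shift (real_of_int i) = B ** shift (real_of_int (j + i)) \<or>
      A ** shift (real_of_int i) = B ** turn 1 ** shift (real_of_int (j + i))" for i
      using B by (auto simp: shift_add simp flip: matrix_mul_assoc)
    thus "A ** shift (real_of_int i) \<in> X" for i using B(1) unfolding X_def by blast
    show "A ** turn 1 \<in> X"
      using B(2)
    proof
      assume A: "A = B ** shift (real_of_int j)"
      show ?thesis
      proof (cases "int p dvd j")
        case True
        then obtain i where "j = int p * i" by blast
        hence "A ** turn 1 = B ** (g i ** turn 1 ** shift (real_of_int i))"
          using A g[of i] by (simp flip: matrix_mul_assoc)
        hence "A ** turn 1 = (B ** g i) ** turn 1 ** shift (real_of_int i)" by (simp add: matrix_mul_assoc)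
        thus ?thesis using matrix_groupD(5)[OF G B(1) gG[of i]] unfolding X_def by blast
      next
        case False
        then obtain k :: int where k: "crossing 1 j k \<in> G" using cr by blast
        have "A ** turn 1 = B ** (crossing 1 j k ** shift k)"
          using A by (simp add: crossing_mat2 shift_def turn_def flip: matrix_mul_assoc)
        hence "A ** turn 1 = (B ** crossing 1 j k) ** shift k" by (simp add: matrix_mul_assoc)
        thus ?thesis using matrix_groupD(5)[OF G B(1) k] unfolding X_def by blast
      qed
    next
      assume A: "A = B ** turn 1 ** shift (real_of_int j)"
      have "adj (g j) ** (shift (real_of_int (int p * j)) ** turn 1) = turn 1 ** shift (real_of_int j)"
        unfolding g by (simp add: adj_left_assoc[OF gSL] flip: matrix_mul_assoc)
      hence "turn 1 ** shift (real_of_int j) ** turn 1 =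
          adj (g j) ** shift (real_of_int (int p * j)) ** (turn 1 ** turn 1)"
        by (metis matrix_mul_assoc)
      hence "A ** turn 1 = - (B ** adj (g j)) ** shift (real_of_int (int p * j))"
        using A turn_turn[of 1] by (simp flip: matrix_mul_assoc)
      moreover have "- (B ** adj (g j)) \<in> G" using B(1) gG matrix_groupD[OF G] by blast
      ultimately show ?thesis unfolding X_def by blast
    qed
  qed
  \<comment> \<open>A translation at the cusp 0 is expressed through \<open>g\<close> and a
    translation at infinity.\<close>
  have u2: "turn 1 ** shift (real_of_int (k * L)) ** adj (turn 1) \<in> G" for k
  proof -
    have "turn 1 ** shift (real_of_int (k * L)) ** adj (turn 1) =
       adj (g (k * L)) ** shift (real_of_int ((int p * k) * L))"
      by (simp add: g_def shift_def turn_def power2_eq_square algebra_simps)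
    thus ?thesis using matrix_groupD(4,5)[OF G] gG shift_int_mult[OF G sL] by metis
  qed
  let ?C = "(\<lambda>j. mat 1 ** shift (real_of_int j)) ` {0..<L} \<union> (\<lambda>j. turn 1 ** shift (real_of_int j)) ` {0..<L}"
  have "\<exists>B\<in>G. \<exists>D\<in>?C. A = B ** D" if A: "A \<in> SL2Z" for A
  proof -
    obtain B j where B: "B \<in> G" "A = B ** shift (real_of_int j) \<or> A = B ** turn 1 ** shift (real_of_int j)"
      using A \<open>SL2Z \<subseteq> X\<close> unfolding X_def by blast
    have c1: "\<exists>B'\<in>G. \<exists>D\<in>(\<lambda>j. mat 1 ** shift (real_of_int j)) ` {0..<L}.
        mat 1 ** shift (real_of_int j) = B' ** D"
      by (rule finite_cover_int[OF G L sL SL2_one]) (use shift_int_mult[OF G sL] in simp)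
    have c2: "\<exists>B'\<in>G. \<exists>D\<in>(\<lambda>j. turn 1 ** shift (real_of_int j)) ` {0..<L}.
        turn 1 ** shift (real_of_int j) = B' ** D"
      by (rule finite_cover_int[OF G L sL _ u2]) simp
    have "A = B ** (mat 1 ** shift (real_of_int j)) \<or> A = B ** (turn 1 ** shift (real_of_int j))"
      using B(2) by (simp add: matrix_mul_assoc)
    hence "\<exists>B'\<in>G. \<exists>D\<in>?C. A = B ** (B' ** D)"
    proof
      assume "A = B ** (mat 1 ** shift (real_of_int j))"
      thus ?thesis using c1 by (metis UnI1)
    next
      assume "A = B ** (turn 1 ** shift (real_of_int j))"
      thus ?thesis using c2 by (metis UnI2)
    qed
    then obtain B' D where D: "B' \<in> G" "D \<in> ?C" "A = B ** (B' ** D)" by blast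
    hence "A = (B ** B') ** D" by (simp add: matrix_mul_assoc)
    thus ?thesis using D matrix_groupD(5)[OF G B(1) D(1)] by blast
  qed
  moreover have "?C \<subseteq> SL2Z" by (auto intro: matrix_groupD(5)[OF matrix_group_SL2Z])
  ultimately show ?thesis by (intro finite_cover_integral_factor[OF G, of ?C]) auto
qed

section \<open>Gamma^0(p) and its Fricke involution\<close>

definition upper_congruence :: "nat \<Rightarrow> (real^2^2) set" where
  "upper_congruence p = {A \<in> SL2Z. A$1$2 / p \<in> \<int>}"

lemma matrix_group_upper_congruence: "p \<ge> 1 \<Longrightarrow> matrix_group (upper_congruence p)"
proof -
  assume p: "p \<ge> 1"
  have "A ** B \<in> upper_congruence p" if "A \<in> upper_congruence p" "B \<in> upper_congruence p" for A B
  proof -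
    obtain a b c d where A: "A = mat2 a b c d" by (rule mat2_cases)
    obtain x y u v where B: "B = mat2 x y u v" by (rule mat2_cases)
    have "A ** B \<in> SL2Z" using that matrix_groupD(5)[OF matrix_group_SL2Z] by (auto simp: upper_congruence_def)
    moreover have "(A ** B)$1$2 / p = a * (y / p) + (b / p) * v" using A B by (simp add: add_divide_distrib)
    moreover have "a * (y / p) + (b / p) * v \<in> \<int>"
      using that A B by (intro Ints_add Ints_mult) (auto simp: upper_congruence_def)
    ultimately show ?thesis by (simp only: upper_congruence_def mem_Collect_eq)
  qed
  moreover have "- A \<in> upper_congruence p" "adj A \<in> upper_congruence p" if "A \<in> upper_congruence p" for A
  proof -
    obtain a b c d where A: "A = mat2 a b c d" by (rule mat2_cases)
    show "- A \<in> upper_congruence p" "adj A \<in> upper_congruence p"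
      using that matrix_groupD(3,4)[OF matrix_group_SL2Z, of A] A by (auto simp: upper_congruence_def)
  qed
  moreover have "mat 1 \<in> upper_congruence p" by (simp add: upper_congruence_def mat_1_mat2)
  moreover have "upper_congruence p \<subseteq> SL2" by (auto simp: upper_congruence_def SL2Z_def)
  ultimately show ?thesis by (auto simp: matrix_group_def)
qed

text \<open>The Fricke involution \<open>turn (sqrt p)\<close> normalises Gamma^0(p), and the
  half-turns of height \<open>sqrt p\<close> at multiples of \<open>p\<close> lie in its coset. So
  two cosets contain the whole group.\<close>

lemma finite_cover_two_cosets:
  assumes p: "p \<ge> 1" and S: "S \<subseteq> SL2" and w: "turn (sqrt p) \<in> mgen S"
    and gen: "\<And>g. g \<in> S \<Longrightarrow> g \<in> upper_congruence p \<or> (\<exists>i::int. g = crossing (sqrt p) (p * i) (p * i))"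
  shows "finite_cover (mgen S \<inter> SL2Z) (mgen S)"
proof -
  let ?w = "turn (sqrt p)" and ?K = "upper_congruence p"
  note K = matrix_group_upper_congruence[OF p]
  have wSL: "?w \<in> SL2" using p by simp
  have G: "matrix_group (mgen S)" using S by (rule matrix_group_mgen)
  have conj: "?w ** g ** adj ?w \<in> ?K" if g: "g \<in> ?K" for g
  proof -
    obtain a b c d where A: "g = mat2 a b c d" by (rule mat2_cases)
    have "?w ** g ** adj ?w = mat2 d (- (p * c)) (- (b / p)) a"
      using p by (simp add: A turn_def field_simps)
    thus ?thesis using g p by (auto simp: A upper_congruence_def algebra_simps)
  qed
  have cr: "crossing (sqrt p) (p * i) (p * i) ** adj ?w \<in> ?K" "?w ** crossing (sqrt p) (p * i) (p * i) \<in> ?K"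
    for i :: int
  proof -
    have "crossing (sqrt p) (p * i) (p * i) ** adj ?w = mat2 (1 + real p * real_of_int i ^ 2) (p * real_of_int i) i 1"
      using p by (simp add: turn_def crossing_mat2 field_simps power2_eq_square)
    moreover have "?w ** crossing (sqrt p) (p * i) (p * i) =
        - mat2 1 (- (p * real_of_int i)) (- real_of_int i) (1 + real p * real_of_int i ^ 2)"
      using p by (simp add: turn_def crossing_mat2 field_simps power2_eq_square)
    ultimately show "crossing (sqrt p) (p * i) (p * i) ** adj ?w \<in> ?K" "?w ** crossing (sqrt p) (p * i) (p * i) \<in> ?K"
      using p by (auto simp: upper_congruence_def power2_eq_square algebra_simps)
  qed
  define X where "X = {A. A \<in> ?K \<or> A ** adj ?w \<in> ?K}"
  have neg: "- A \<in> X" if "A \<in> X" for A using that matrix_groupD(3)[OF K] by (auto simp: X_def)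
  have step1: "A ** g \<in> X" if "A \<in> X" "g \<in> ?K" for A g
  proof -
    have "A ** g ** adj ?w = (A ** adj ?w) ** (?w ** g ** adj ?w)"
      by (simp add: adj_left_assoc[OF wSL] flip: matrix_mul_assoc)
    thus ?thesis using that conj[OF that(2)] matrix_groupD(5)[OF K] by (auto simp: X_def)
  qed
  have step2: "A ** g \<in> X" if "A \<in> X" "g = crossing (sqrt p) (p * i) (p * i)" for A g and i :: int
  proof -
    have "A ** g = (A ** adj ?w) ** (?w ** g)" "A ** g ** adj ?w = A ** (g ** adj ?w)"
      by (simp_all add: adj_left_assoc[OF wSL] flip: matrix_mul_assoc)
    thus ?thesis using that cr[of i] matrix_groupD(5)[OF K] by (auto simp: X_def)
  qed
  have "(\<forall>A\<in>X. A ** g \<in> X) \<and> (\<forall>A\<in>X. A ** adj g \<in> X)" if "g \<in> mgen S" for g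
    using that
  proof induction
    case (incl g)
    consider "g \<in> ?K" | i :: int where "g = crossing (sqrt p) (p * i) (p * i)" using gen[OF incl] by blast
    thus ?case
    proof cases
      case 1
      thus ?thesis using step1 matrix_groupD(4)[OF K] by blast
    next
      case 2
      have "adj g = g \<or> adj g = - g"
        using adj_crossing[of "sqrt p" "p * i" "p * i"] 2 by (simp add: pm_eq_def)
      thus ?thesis using step2[OF _ 2] neg by (auto simp: neg_mult_right)
    qed
  next
    case (neg g)
    thus ?case using \<open>\<And>A. A \<in> X \<Longrightarrow> - A \<in> X\<close> by simp
  next
    case (mult g h)
    thus ?case by (simp add: adj_mult matrix_mul_assoc)
  qed auto
  moreover have "mat 1 \<in> X" using matrix_groupD(2)[OF K] by (simp add: X_def)
  ultimately have sub: "g \<in> X" if "g \<in> mgen S" for g using that by (metis matrix_mul_lid)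
  have KZ: "?K \<subseteq> SL2Z" by (auto simp: upper_congruence_def)
  have "\<exists>B\<in>mgen S \<inter> SL2Z. \<exists>D\<in>{mat 1, ?w}. g = B ** D" if g: "g \<in> mgen S" for g
    using sub[OF g] unfolding X_def
  proof (elim CollectE disjE)
    assume "g \<in> ?K"
    thus ?thesis using g KZ by (intro bexI[of _ g] bexI[of _ "mat 1"]) auto
  next
    assume "g ** adj ?w \<in> ?K"
    thus ?thesis using g w KZ matrix_groupD(4,5)[OF G] adj_left[OF wSL]
      by (intro bexI[of _ "g ** adj ?w"] bexI[of _ ?w]) (auto simp flip: matrix_mul_assoc)
  qed
  thus ?thesis unfolding finite_cover_def using wSL by (intro exI[of _ "{mat 1, ?w}"]) auto
qed

text \<open>A half-turn of height 1 at \<open>y\<close> with \<open>p dvd y^2 + 1\<close> is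
  integral with upper right entry divisible by \<open>p\<close>; the remaining generators lie in the
  coset of the Fricke involution.\<close>

lemma arithmetic_two_cusps:
  fixes L :: int
  assumes p: "p \<ge> 1" and L: "L > 0" and sL: "shift (real_of_int L) \<in> leaf_group p Y"
    and tu: "\<And>i::int. crossing (sqrt p) (p * i) (p * i) \<in> leaf_group p Y"
    and cr: "\<And>j::int. \<not> p dvd j \<Longrightarrow> \<exists>k::int. crossing 1 j k \<in> leaf_group p Y"
    and gen: "\<And>c y. (c, y) \<in> Y \<Longrightarrow> if c = S1 then int p dvd y\<^sup>2 + 1 else int p dvd y"
  shows "arithmetic (psl ` leaf_group p Y)"
proof (rule arithmeticI[of "mat 1"], simp_all only: conj_set_one)
  let ?G = "leaf_group p Y"
  show G: "matrix_group ?G" using p by (rule matrix_group_leaf_group)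
  show "finite_cover (?G \<inter> SL2Z) SL2Z" by (rule finite_cover_SL2Z_two_cusps[OF p G L sL tu cr])
  show "finite_cover (?G \<inter> SL2Z) ?G"
    unfolding leaf_group_def
  proof (rule finite_cover_two_cosets[OF p])
    show "leaf_turn p ` Y \<subseteq> SL2" using p by auto
    show "turn (sqrt (real p)) \<in> mgen (leaf_turn p ` Y)"
      using tu[of 0] by (simp add: crossing_def shift_def leaf_group_def flip: mat_1_mat2)
    fix g assume "g \<in> leaf_turn p ` Y"
    then obtain c y where cy: "(c, y) \<in> Y" "g = leaf_turn p (c, y)" by auto
    show "g \<in> upper_congruence p \<or> (\<exists>i::int. g = crossing (sqrt p) (p * i) (p * i))"
    proof (cases "c = S1")
      case True
      then obtain k where k: "y\<^sup>2 + 1 = int p * k" using gen[OF cy(1)] by auto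
      hence k': "(real_of_int y)\<^sup>2 + 1 = real p * real_of_int k"
        by (metis of_int_1 of_int_add of_int_mult of_int_of_nat_eq of_int_power)
      have "g = mat2 y (- (p * real_of_int k)) 1 (- real_of_int y)"
        using True cy k' by (simp add: leaf_turn_def crossing_mat2 height_def power2_eq_square)
      moreover have "g \<in> SL2" using cy p by simp
      ultimately show ?thesis using p by (simp add: upper_congruence_def)
    next
      case False
      then obtain k where "y = int p * k" using gen[OF cy(1)] by auto
      thus ?thesis using False cy by (auto simp: leaf_turn_def height_def)
    qed
  qed
qed simp

text \<open>Meant for square \<open>n\<close> with \<open>s^2 = sqrt n\<close>: the scaling brings
  the marks of height \<open>sqrt n\<close> to height 1 and the generators into SL(2,Z).\<close>

lemma arithmetic_one_cusp:
  fixes L :: int and s :: real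
  assumes n: "n \<ge> 1" and s: "s > 0" and L: "L > 0"
    and sL: "shift (real_of_int L) \<in> conj_set (mat2 (1 / s) 0 0 s) (leaf_group n Y)"
    and cr: "\<And>j::int. \<exists>k::int. crossing 1 j k \<in> conj_set (mat2 (1 / s) 0 0 s) (leaf_group n Y)"
    and gen: "\<And>p. p \<in> Y \<Longrightarrow> mat2 (1 / s) 0 0 s ** leaf_turn n p ** adj (mat2 (1 / s) 0 0 s) \<in> SL2Z"
  shows "arithmetic (psl ` leaf_group n Y)"
proof -
  let ?F = "mat2 (1 / s) 0 0 s"
  have F: "?F \<in> SL2" using s by simp
  have G: "matrix_group (leaf_group n Y)" using n by (rule matrix_group_leaf_group)
  note GF = conj_set_matrix_group[OF F G]
  have aF: "adj ?F \<in> SL2" using F by (rule SL2_adj)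
  have "leaf_group n Y \<subseteq> conj_set (adj ?F) SL2Z"
    using gen by (intro leaf_group_subset conj_set_matrix_group[OF aF] matrix_group_SL2Z ballI)
      (simp only: conj_set_iff[OF aF] adj_adj)
  hence "conj_set ?F (leaf_group n Y) \<subseteq> conj_set (?F ** adj ?F) SL2Z"
    unfolding conj_set_conj_set[symmetric] by (rule conj_set_mono)
  hence sub: "conj_set ?F (leaf_group n Y) \<subseteq> SL2Z" unfolding adj_right[OF F] by simp
  have "finite_cover K K" if "matrix_group K" for K
    unfolding finite_cover_def using that by (intro exI[of _ "{mat 1}"]) auto
  thus ?thesis
    using finite_cover_SL2Z_one_cusp[OF GF L sL cr] GF sub
    by (intro arithmeticI[OF F G]) (auto simp: Int_absorb2)
qed

section \<open>Arithmetic examples\<close>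

definition lone_branch :: branch where
  "lone_branch = Node True S1 (Leaf S3) (Leaf S2)"

definition diamond_branch :: branch where
  "diamond_branch = Node False S3 (Leaf S1) (Leaf S1)"

definition star_branch :: branch where
  "star_branch = Node False S3 lone_branch lone_branch"

lemma lone_polygon:
  "polygon lone_branch diamond_branch" "polygon lone_branch star_branch" "polygon (Leaf S1) lone_branch"
  by (simp_all add: polygon_def lone_branch_def diamond_branch_def star_branch_def side_class_def)

abbreviation diamond_leaves :: "nat \<Rightarrow> (side \<times> int) set" where
  "diamond_leaves n \<equiv> {(S3, 0), (S2, int n), (S1, int n + 2), (S1, int n + 3)}"

abbreviation star_leaves :: "nat \<Rightarrow> (side \<times> int) set" where
  "star_leaves n \<equiv> {(S3, 0), (S2, int n), (S3, int n + 3), (S2, 2 * int n + 3),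
     (S3, 2 * int n + 6), (S2, 3 * int n + 6)}"

abbreviation weierstrass_leaves :: "nat \<Rightarrow> (side \<times> int) set" where
  "weierstrass_leaves n \<equiv> {(S3, 0), (S2, int n), (S1, - 1)}"

text \<open>The start at -1 puts the \<open>S3\<close> mark of the n-tile at 0, as in
  \<open>lattice_point\<close>.\<close>

lemma lone_leaves:
  "polygon_leaves n (-1) lone_branch diamond_branch = diamond_leaves n"
  "polygon_leaves n (-1) lone_branch star_branch = star_leaves n"
  "polygon_leaves n (-1) (Leaf S1) lone_branch = weierstrass_leaves n"
  by (auto simp: polygon_leaves_def lone_branch_def diamond_branch_def star_branch_def corner_def)

lemma lone_shift:
  assumes "n \<ge> 1"
  shows "shift (real_of_int (int n + 5)) \<in> leaf_group n (diamond_leaves n)"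
    "shift (real_of_int (3 * int n + 9)) \<in> leaf_group n (star_leaves n)"
    "shift (real_of_int (int n + 2)) \<in> leaf_group n (weierstrass_leaves n)"
proof -
  have *: "shift (real_of_int (width n b + width n b')) \<in> leaf_group n (polygon_leaves n (-1) b b')"
    if "polygon b b'" for b b'
    using polygon_shift[OF assms matrix_group_leaf_group[OF assms, of "polygon_leaves n (-1) b b'"] that, of "-1"]
    by (simp add: leaf_group_mem)
  show "shift (real_of_int (int n + 5)) \<in> leaf_group n (diamond_leaves n)"
    "shift (real_of_int (3 * int n + 9)) \<in> leaf_group n (star_leaves n)"
    "shift (real_of_int (int n + 2)) \<in> leaf_group n (weierstrass_leaves n)"
    using *[OF lone_polygon(1)] *[OF lone_polygon(2)] *[OF lone_polygon(3)] unfolding lone_leaves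
    by (simp_all add: lone_branch_def diamond_branch_def star_branch_def corner_def algebra_simps)
qed

lemma leaf_crossing_mem:
  "(c, y) \<in> Y \<Longrightarrow> crossing (height n c) (real_of_int y) (real_of_int y) \<in> leaf_group n Y"
  using leaf_group_mem[of "(c, y)" Y n] by (simp add: leaf_turn_def)

lemma diamond_lattice:
  assumes n: "n \<ge> 1" and l: "lattice_point 5 n p"
  shows "leaf_turn n p \<in> leaf_group n (diamond_leaves n)"
proof -
  let ?G = "leaf_group n (diamond_leaves n)"
  obtain c y where p: "p = (c, y)" by (cases p)
  obtain r where r: "int n + 5 dvd y - r" "(c, r) \<in> diamond_leaves n"
    using l by (auto simp: lattice_point_def p)
  show ?thesis
    using crossing_cong[OF matrix_group_leaf_group[OF n] lone_shift(1)[OF n] leaf_crossing_mem[OF r(2)] r(1) r(1)]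
    by (simp add: p leaf_turn_def)
qed

text \<open>The three n-tiles of the star make its period three times that of the lattice;
  \<open>k mod 3\<close> selects the tile.\<close>

lemma star_lattice:
  assumes n: "n \<ge> 1" and l: "lattice_point 3 n p"
  shows "leaf_turn n p \<in> leaf_group n (star_leaves n)"
proof -
  obtain c y where p: "p = (c, y)" by (cases p)
  obtain r where r: "int n + 3 dvd y - r" "c = S3 \<and> r = 0 \<or> c = S2 \<and> r = int n"
    using l by (auto simp: lattice_point_def p)
  obtain k where k: "y - r = (int n + 3) * k" using r(1) by blast
  define t where "t = r + (int n + 3) * (k mod 3)"
  have "y - t = (int n + 3) * (k - k mod 3)" using k by (simp add: t_def algebra_simps)
  also have "k - k mod 3 = 3 * (k div 3)" by (simp add: minus_mod_eq_mult_div)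
  also have "(int n + 3) * (3 * (k div 3)) = (3 * int n + 9) * (k div 3)" by (simp add: algebra_simps)
  finally have d: "3 * int n + 9 dvd y - t" by (rule dvdI)
  have "k mod 3 \<in> {0, 1, 2}" by auto
  hence "(c, t) \<in> star_leaves n" using r(2) by (auto simp: t_def algebra_simps)
  thus ?thesis
    using crossing_cong[OF matrix_group_leaf_group[OF n] lone_shift(2)[OF n] leaf_crossing_mem d d]
    by (simp add: p leaf_turn_def)
qed

text \<open>Half-turns at consecutive multiples of \<open>p\<close> combine to the crossing of a
  label-1 side with its ends just outside of them.\<close>

lemma level_neighbours:
  fixes p :: nat
  assumes p: "p \<ge> 1" and G: "matrix_group G"
    and tu: "\<And>i::int. crossing (sqrt p) (p * i) (p * i) \<in> G"
    and j: "int p dvd j + 1 \<or> int p dvd j - 1"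
  shows "\<exists>k::int. crossing 1 j k \<in> G"
  using j
proof
  assume "int p dvd j + 1"
  then obtain i where i: "j + 1 = int p * i" by blast
  have "crossing (sqrt p) (p * i) (p * i) ** crossing (sqrt p) (p * (i + 1)) (p * (i + 1)) \<in> G"
    using matrix_groupD(5)[OF G] tu by blast
  also have "?this \<longleftrightarrow> crossing 1 (real_of_int j) (real_of_int (j + 2 + int p)) \<in> G"
  proof (rule matrix_group_pm_eq[OF G])
    have e: "real_of_int (p * i) = real_of_int (j + 1)" "real_of_int (p * (i + 1)) = real_of_int (j + 1) + p"
      using i by (simp_all add: algebra_simps flip: i)
    show "crossing (sqrt p) (p * i) (p * i) ** crossing (sqrt p) (p * (i + 1)) (p * (i + 1)) \<doteq>
        crossing 1 (real_of_int j) (real_of_int (j + 2 + int p))"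
      using crossing_square(1)[of "sqrt p" p "real_of_int (j + 1)"] p unfolding e by (simp add: algebra_simps)
  qed
  finally show ?thesis by blast
next
  assume "int p dvd j - 1"
  then obtain i where i: "j - 1 = int p * i" by blast
  have "crossing (sqrt p) (p * i) (p * i) ** crossing (sqrt p) (p * (i - 1)) (p * (i - 1)) \<in> G"
    using matrix_groupD(5)[OF G] tu by blast
  also have "?this \<longleftrightarrow> crossing 1 (real_of_int j) (real_of_int (j - 2 - int p)) \<in> G"
  proof (rule matrix_group_pm_eq[OF G])
    have e: "real_of_int (p * i) = real_of_int (j - 1)" "real_of_int (p * (i - 1)) = real_of_int (j - 1) - p"
      using i by (simp_all add: algebra_simps flip: i)
    show "crossing (sqrt p) (p * i) (p * i) ** crossing (sqrt p) (p * (i - 1)) (p * (i - 1)) \<doteq>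
        crossing 1 (real_of_int j) (real_of_int (j - 2 - int p))"
      using crossing_square(2)[of "sqrt p" p "real_of_int (j - 1)"] p unfolding e by (simp add: algebra_simps)
  qed
  finally show ?thesis by blast
qed

lemma crossing_ex:
  fixes x y j L :: int
  assumes "matrix_group G" "shift (real_of_int L) \<in> G" "crossing h x y \<in> G" "L dvd j - x"
  shows "\<exists>k::int. crossing h j k \<in> G"
  using crossing_cong[OF assms(1,2,3,4), of y] by auto

section \<open>Examples with prime \<open>n\<close>\<close>

lemma arithmetic_weierstrass_2: "arithmetic (psl ` leaf_group 2 (weierstrass_leaves 2))"
proof -
  let ?G = "leaf_group 2 (weierstrass_leaves 2)"
  have G: "matrix_group ?G" by (rule matrix_group_leaf_group) simp
  have L: "shift (real_of_int 4) \<in> ?G" using lone_shift(3)[of 2] by simp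
  have tu: "crossing (sqrt (real 2)) (real_of_int (int 2 * i)) (real_of_int (int 2 * i)) \<in> ?G" for i
  proof -
    have "4 dvd 2 * i - 0 \<or> 4 dvd 2 * i - 2" by presburger
    thus ?thesis
      using crossing_cong[OF G L leaf_crossing_mem[of S3 0], of "2 * i" "2 * i"]
        crossing_cong[OF G L leaf_crossing_mem[of S2 2], of "2 * i" "2 * i"]
      by (auto simp: height_def)
  qed
  have cr: "\<exists>k::int. crossing 1 j k \<in> ?G" if "\<not> int 2 dvd j" for j :: int
    using that by (intro level_neighbours[OF _ G tu]) auto
  show ?thesis by (rule arithmetic_two_cusps[of 2 4 "weierstrass_leaves 2", OF _ _ L tu cr]) auto
qed

text \<open>The marks fill all multiples of 3 modulo the period 18, and every other integer is
  adjacent to a multiple of 3.\<close>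

lemma arithmetic_star_3: "arithmetic (psl ` leaf_group 3 (star_leaves 3))"
proof -
  let ?G = "leaf_group 3 (star_leaves 3)"
  have G: "matrix_group ?G" by (rule matrix_group_leaf_group) simp
  have L: "shift (real_of_int 18) \<in> ?G" using lone_shift(2)[of 3] by simp
  have tu: "crossing (sqrt (real 3)) (real_of_int (int 3 * i)) (real_of_int (int 3 * i)) \<in> ?G" for i
  proof -
    define r where "r = i mod 6"
    define c where "c = (if even r then S3 else S2)"
    have "18 dvd 3 * i - 3 * r" unfolding r_def by presburger
    moreover have "r = 0 \<or> r = 1 \<or> r = 2 \<or> r = 3 \<or> r = 4 \<or> r = 5" unfolding r_def by presburger
    hence "(c, 3 * r) \<in> star_leaves 3" "c \<noteq> S1" by (auto simp: c_def)
    ultimately show ?thesis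
      using crossing_cong[OF G L leaf_crossing_mem[of c "3 * r"], of "3 * i" "3 * i"] by (simp add: height_def)
  qed
  have cr: "\<exists>k::int. crossing 1 j k \<in> ?G" if "\<not> int 3 dvd j" for j :: int
  proof -
    have "3 dvd j + 1 \<or> 3 dvd j - 1" using that by simp presburger
    thus ?thesis by (intro level_neighbours[OF _ G tu]) auto
  qed
  show ?thesis by (rule arithmetic_two_cusps[of 3 18 "star_leaves 3", OF _ _ L tu cr]) auto
qed

text \<open>Apart from the neighbours of multiples of 5, the residues 2, 3, 7, 8 modulo 10 have to
  be reached. Marks exist at 7 and 8. As \<open>-2 + i\<close> has modulus \<open>sqrt 5\<close>,
  the half-turn of this height at 0 takes it to \<open>2 + i\<close>; the one at 5 likewise takes
  \<open>7 + i\<close> to \<open>3 + i\<close>.\<close>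

lemma arithmetic_diamond_5: "arithmetic (psl ` leaf_group 5 (diamond_leaves 5))"
proof -
  let ?G = "leaf_group 5 (diamond_leaves 5)"
  have G: "matrix_group ?G" by (rule matrix_group_leaf_group) simp
  have L: "shift (real_of_int 10) \<in> ?G" using lone_shift(1)[of 5] by simp
  have tu: "crossing (sqrt (real 5)) (real_of_int (int 5 * i)) (real_of_int (int 5 * i)) \<in> ?G" for i
  proof -
    have "10 dvd 5 * i - 0 \<or> 10 dvd 5 * i - 5" by presburger
    thus ?thesis
      using crossing_cong[OF G L leaf_crossing_mem[of S3 0], of "5 * i" "5 * i"]
        crossing_cong[OF G L leaf_crossing_mem[of S2 5], of "5 * i" "5 * i"]
      by (auto simp: height_def)
  qed
  have A: "crossing 1 7 7 \<in> ?G" "crossing 1 8 8 \<in> ?G"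
    using leaf_crossing_mem[of S1 7 "diamond_leaves 5" 5] leaf_crossing_mem[of S1 8 "diamond_leaves 5" 5]
    by (simp_all add: height_def)
  have W: "crossing (sqrt 5) 0 0 \<in> ?G" "crossing (sqrt 5) 5 5 \<in> ?G"
    using tu[of 0] tu[of 1] by simp_all
  have "crossing 1 (-2) (-2) \<in> ?G"
    using crossing_cong[OF G L, of 1 8 8 "-2" "-2"] A(2) by simp
  hence "crossing (sqrt 5) 0 0 ** crossing 1 (-2) (-2) ** crossing (sqrt 5) 0 0 \<in> ?G"
    using W(1) by (intro matrix_groupD(5)[OF G])
  also have "?this \<longleftrightarrow> crossing 1 2 2 \<in> ?G"
    by (intro matrix_group_pm_eq[OF G]) (auto simp: crossing_mat2 pm_eq_def field_simps)
  finally have A2: "crossing 1 2 2 \<in> ?G" .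
  have "crossing (sqrt 5) 5 5 ** crossing 1 7 7 ** crossing (sqrt 5) 5 5 \<in> ?G"
    using W(2) A(1) by (intro matrix_groupD(5)[OF G])
  also have "?this \<longleftrightarrow> crossing 1 3 3 \<in> ?G"
    by (intro matrix_group_pm_eq[OF G]) (auto simp: crossing_mat2 pm_eq_def field_simps)
  finally have A3: "crossing 1 3 3 \<in> ?G" .
  have cr: "\<exists>k::int. crossing 1 j k \<in> ?G" if "\<not> int 5 dvd j" for j :: int
  proof (cases "5 dvd j + 1 \<or> 5 dvd j - 1")
    case True
    thus ?thesis by (intro level_neighbours[OF _ G tu]) auto
  next
    case False
    define r where "r = j mod 10"
    have "10 dvd j - r" unfolding r_def by presburger
    moreover have "r = 2 \<or> r = 3 \<or> r = 7 \<or> r = 8" using False that unfolding r_def by simp presburger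
    hence "crossing 1 r r \<in> ?G" using A A2 A3 by auto
    ultimately show ?thesis using crossing_ex[OF G L] by blast
  qed
  show ?thesis by (rule arithmetic_two_cusps[of 5 10 "diamond_leaves 5", OF _ _ L tu cr]) auto
qed

section \<open>Examples with square \<open>n\<close>, after rescaling\<close>

lemma scale_crossing:
  assumes "s > 0"
  shows "mat2 (1 / s) 0 0 s ** crossing h x y ** adj (mat2 (1 / s) 0 0 s) = crossing (h / s\<^sup>2) (x / s\<^sup>2) (y / s\<^sup>2)"
  using assms by (simp add: crossing_mat2 power2_eq_square field_simps)

lemma scale_shift:
  assumes "s > 0"
  shows "mat2 (1 / s) 0 0 s ** shift x ** adj (mat2 (1 / s) 0 0 s) = shift (x / s\<^sup>2)"
  using assms by (simp add: shift_def power2_eq_square field_simps)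

lemma conj_set_crossing:
  "s > 0 \<Longrightarrow> crossing h x y \<in> G \<Longrightarrow> crossing (h / s\<^sup>2) (x / s\<^sup>2) (y / s\<^sup>2) \<in> conj_set (mat2 (1 / s) 0 0 s) G"
  unfolding scale_crossing[symmetric] conj_set_def by blast

lemma conj_set_shift:
  "s > 0 \<Longrightarrow> shift x \<in> G \<Longrightarrow> shift (x / s\<^sup>2) \<in> conj_set (mat2 (1 / s) 0 0 s) G"
  unfolding scale_shift[symmetric] conj_set_def by blast

lemma crossing_pair:
  fixes a :: int
  assumes G: "matrix_group G" and c: "crossing 1 a a \<in> G" "crossing 1 (a - 1) (a - 1) \<in> G"
  shows "crossing 1 (a + 1) (a - 2) \<in> G" "crossing 1 (a - 2) (a + 1) \<in> G"
proof -
  have "crossing 1 a a ** crossing 1 (a - 1) (a - 1) \<in> G" using matrix_groupD(5)[OF G] c by blast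
  thus "crossing 1 (a + 1) (a - 2) \<in> G"
    using crossing_square(2)[of 1 1 "real_of_int a"] matrix_group_pm_eq[OF G] by simp
  thus "crossing 1 (a - 2) (a + 1) \<in> G" by (rule crossing_sym[OF G])
qed

lemma arithmetic_weierstrass_1: "arithmetic (psl ` leaf_group 1 (weierstrass_leaves 1))"
proof (rule arithmetic_one_cusp[of 1 1 3])
  let ?Y = "weierstrass_leaves 1"
  let ?C = "conj_set (mat2 (1 / 1) 0 0 1) (leaf_group 1 ?Y)"
  have C: "?C = leaf_group 1 ?Y" by (simp flip: mat_1_mat2)
  have G: "matrix_group (leaf_group 1 ?Y)" by (rule matrix_group_leaf_group) simp
  have L: "shift (real_of_int 3) \<in> leaf_group 1 ?Y" using lone_shift(3)[of 1] by simp
  thus "shift (real_of_int 3) \<in> ?C" unfolding C .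
  show "\<exists>k::int. crossing 1 j k \<in> ?C" for j :: int
  proof -
    have "3 dvd j - 0 \<or> 3 dvd j - 1 \<or> 3 dvd j - (-1)" by presburger
    moreover have "crossing 1 0 0 \<in> leaf_group 1 ?Y" "crossing 1 1 1 \<in> leaf_group 1 ?Y"
      "crossing 1 (-1) (-1) \<in> leaf_group 1 ?Y"
      using leaf_crossing_mem[of S3 0 ?Y 1] leaf_crossing_mem[of S2 1 ?Y 1] leaf_crossing_mem[of S1 "-1" ?Y 1]
      by (simp_all add: height_def)
    ultimately show ?thesis unfolding C
      using crossing_cong[OF G L, of 1 0 0 j j] crossing_cong[OF G L, of 1 1 1 j j]
        crossing_cong[OF G L, of 1 "-1" "-1" j j] by auto
  qed
  show "mat2 (1 / 1) 0 0 1 ** leaf_turn 1 p ** adj (mat2 (1 / 1) 0 0 1) \<in> SL2Z" if "p \<in> ?Y" for p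
    using that by (auto simp: leaf_turn_def height_def crossing_mat2)
qed auto

text \<open>Divided by 2, the marks of height 1 lie at 0 and 2 modulo 3; residue 1 comes from the
  adjacent pair -1, 0. The label-1 mark becomes \<open>(-1 + i) / 2\<close>, whose half-turn is
  integral.\<close>

lemma arithmetic_weierstrass_4: "arithmetic (psl ` leaf_group 4 (weierstrass_leaves 4))"
proof (rule arithmetic_one_cusp[of 4 "sqrt 2" 3])
  let ?Y = "weierstrass_leaves 4" and ?F = "mat2 (1 / sqrt 2) 0 0 (sqrt 2)"
  let ?C = "conj_set ?F (leaf_group 4 ?Y)"
  have s: "sqrt 2 > 0" by simp
  have four: "sqrt 4 = (2::real)" using real_sqrt_abs[of 2] by simp
  have G: "matrix_group ?C" by (intro conj_set_matrix_group matrix_group_leaf_group) auto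
  show L: "shift (real_of_int 3) \<in> ?C" using conj_set_shift[OF s lone_shift(3)[of 4]] by simp
  have c: "crossing 1 0 0 \<in> ?C" "crossing 1 2 2 \<in> ?C"
    using conj_set_crossing[OF s leaf_crossing_mem[of S3 0 ?Y 4]] conj_set_crossing[OF s leaf_crossing_mem[of S2 4 ?Y 4]]
    by (simp_all add: height_def four)
  have "crossing 1 (-1) (-1) \<in> ?C" using crossing_cong[OF G L, of 1 2 2 "-1" "-1"] c by simp
  hence "crossing 1 1 (-2) \<in> ?C" using crossing_pair(1)[OF G, of 0] c by simp
  show "\<exists>k::int. crossing 1 j k \<in> ?C" for j :: int
  proof -
    have "3 dvd j - 0 \<or> 3 dvd j - 1 \<or> 3 dvd j - 2" by presburger
    thus ?thesis
      using crossing_ex[OF G L, of 1 0 0 j] crossing_ex[OF G L, of 1 1 "-2" j]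
        crossing_ex[OF G L, of 1 2 2 j] c \<open>crossing 1 1 (-2) \<in> ?C\<close> by auto
  qed
  show "?F ** leaf_turn 4 p ** adj ?F \<in> SL2Z" if "p \<in> ?Y" for p
    unfolding leaf_turn_def scale_crossing[OF s] using that
    by (auto simp: height_def crossing_mat2 four)
qed auto

text \<open>Divided by 3, the marks lie at 0, 3, 4, 7, 8, 11 modulo 12. An adjacent pair
  \<open>a - 1\<close>, \<open>a\<close> supplies crossings at \<open>a + 1\<close> and
  \<open>a - 2\<close>, which are the missing residues.\<close>

lemma arithmetic_star_9: "arithmetic (psl ` leaf_group 9 (star_leaves 9))"
proof (rule arithmetic_one_cusp[of 9 "sqrt 3" 12])
  let ?Y = "star_leaves 9" and ?F = "mat2 (1 / sqrt 3) 0 0 (sqrt 3)"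
  let ?C = "conj_set ?F (leaf_group 9 ?Y)"
  have s: "sqrt 3 > 0" by simp
  have nine: "sqrt 9 = (3::real)" using real_sqrt_abs[of 3] by simp
  have G: "matrix_group ?C" by (intro conj_set_matrix_group matrix_group_leaf_group) auto
  show L: "shift (real_of_int 12) \<in> ?C" using conj_set_shift[OF s lone_shift(2)[of 9]] by simp
  have c: "crossing 1 (real_of_int y) (real_of_int y) \<in> ?C" if "y \<in> {0, 3, 4, 7, 8, 11}" for y
  proof -
    define d where "d = (if y \<in> {0, 4, 8} then S3 else S2)"
    have "(d, 3 * y) \<in> ?Y" "d \<noteq> S1" using that by (auto simp: d_def)
    thus ?thesis using conj_set_crossing[OF s leaf_crossing_mem[of d "3 * y" ?Y 9]]
      by (simp add: height_def nine)
  qed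
  have c': "crossing 1 (real_of_int y) (real_of_int y) \<in> ?C" if "12 dvd y - y'" "y' \<in> {0, 3, 4, 7, 8, 11}" for y y'
    using crossing_cong[OF G L c[OF that(2)] that(1) that(1)] .
  show "\<exists>k::int. crossing 1 j k \<in> ?C" for j :: int
  proof -
    define r where "r = j mod 12"
    have r: "12 dvd j - r" "r \<in> {0..11}" unfolding r_def by (auto simp: dvd_minus_mod)
    have "r = 0 \<or> r = 1 \<or> r = 2 \<or> r = 3 \<or> r = 4 \<or> r = 5 \<or> r = 6 \<or> r = 7 \<or> r = 8 \<or> r = 9 \<or> r = 10 \<or> r = 11"
      unfolding r_def by presburger
    moreover have "\<exists>k::int. crossing 1 j k \<in> ?C" if "r \<in> {0, 3, 4, 7, 8, 11}"
      using c'[OF r(1) that] by blast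
    moreover have "\<exists>k::int. crossing 1 j k \<in> ?C" if "r = a + 1" "a \<in> {0, 4, 8}" for a
    proof -
      have "12 dvd (j - 1) - a" "12 dvd (j - 1 - 1) - (if a = 0 then 11 else a - 1)" using r(1) that by (auto, presburger)
      hence "crossing 1 (j - 1) (j - 1) \<in> ?C" "crossing 1 ((j - 1) - 1) ((j - 1) - 1) \<in> ?C"
        using c'[of "j - 1" a] c'[of "j - 1 - 1" "if a = 0 then 11 else a - 1"] that by auto
      from crossing_pair(1)[OF G, of "j - 1"] this show ?thesis by (intro exI[of _ "j - 1 - 2"]) simp
    qed
    \<comment> \<open>Here 12 represents the residue 0, so that \<open>a - 2\<close> stays between 0
      and 11.\<close>
    moreover have "\<exists>k::int. crossing 1 j k \<in> ?C" if "r = a - 2" "a \<in> {4, 8, 12}" for a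
    proof -
      have "12 dvd (j + 2) - (if a = 12 then 0 else a)" "12 dvd (j + 2 - 1) - (a - 1)" using r(1) that by (auto, presburger)
      hence "crossing 1 (j + 2) (j + 2) \<in> ?C" "crossing 1 ((j + 2) - 1) ((j + 2) - 1) \<in> ?C"
        using c'[of "j + 2" "if a = 12 then 0 else a"] c'[of "j + 2 - 1" "a - 1"] that by auto
      from crossing_pair(2)[OF G, of "j + 2"] this show ?thesis by (intro exI[of _ "j + 2 + 1"]) simp
    qed
    ultimately show ?thesis by fastforce
  qed
  show "?F ** leaf_turn 9 p ** adj ?F \<in> SL2Z" if "p \<in> ?Y" for p
    unfolding leaf_turn_def scale_crossing[OF s] using that
    by (auto simp: height_def crossing_mat2 nine)
qed auto

lemma arithmetic_diamond_25: "arithmetic (psl ` leaf_group 25 (diamond_leaves 25))"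
proof (rule arithmetic_one_cusp[of 25 "sqrt 5" 6])
  let ?Y = "diamond_leaves 25" and ?F = "mat2 (1 / sqrt 5) 0 0 (sqrt 5)"
  let ?C = "conj_set ?F (leaf_group 25 ?Y)"
  have s: "sqrt 5 > 0" by simp
  have tf: "sqrt 25 = (5::real)" using real_sqrt_abs[of 5] by simp
  have G: "matrix_group ?C" by (intro conj_set_matrix_group matrix_group_leaf_group) auto
  show L: "shift (real_of_int 6) \<in> ?C" using conj_set_shift[OF s lone_shift(1)[of 25]] by simp
  have c: "crossing 1 0 0 \<in> ?C" "crossing 1 5 5 \<in> ?C"
    using conj_set_crossing[OF s leaf_crossing_mem[of S3 0 ?Y 25]] conj_set_crossing[OF s leaf_crossing_mem[of S2 25 ?Y 25]]
    by (simp_all add: height_def tf)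
  have e: "crossing (1 / 5) (27 / 5) (27 / 5) \<in> ?C" "crossing (1 / 5) (28 / 5) (28 / 5) \<in> ?C"
    using conj_set_crossing[OF s leaf_crossing_mem[of S1 27 ?Y 25]] conj_set_crossing[OF s leaf_crossing_mem[of S1 28 ?Y 25]]
    by (simp_all add: height_def)
  have L': "shift 6 \<in> ?C" "shift (- 6) \<in> ?C"
    using L matrix_groupD(4)[OF G L] by (simp_all add: adj_shift)
  have "crossing 1 (-1) (-1) \<in> ?C" using crossing_cong[OF G L, of 1 5 5 "-1" "-1"] c by simp
  hence p: "crossing 1 1 (-2) \<in> ?C" "crossing 1 (-2) 1 \<in> ?C" using crossing_pair[OF G, of 0] c by simp_all
  \<comment> \<open>Moved by the period, the mark \<open>(28 + i) / 5\<close> becomes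
    \<open>(-2 + i) / 5\<close>, and the half-turn about \<open>i\<close> takes this to
    \<open>2 + i\<close>.\<close>
  have "crossing 1 0 0 ** (shift (- 6) ** crossing (1 / 5) (28 / 5) (28 / 5) ** shift 6) ** crossing 1 0 0 \<in> ?C"
    using c L' e by (intro matrix_groupD(5)[OF G])
  also have "?this \<longleftrightarrow> crossing 1 2 2 \<in> ?C"
    by (intro matrix_group_pm_eq[OF G]) (simp add: crossing_mat2 shift_def pm_eq_def)
  finally have c2: "crossing 1 2 2 \<in> ?C" .
  \<comment> \<open>The half-turn about \<open>i\<close> takes \<open>(-3 + i) / 5\<close> to
    \<open>(3 + i) / 2\<close>, and \<open>crossing 1 (-2) 1\<close> takes this to
    \<open>-3 + i\<close>.\<close>
  have "crossing 1 (-2) 1 ** (crossing 1 0 0 ** (shift (- 6) ** crossing (1 / 5) (27 / 5) (27 / 5) ** shift 6) **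
      crossing 1 0 0) ** crossing 1 1 (-2) \<in> ?C"
    using c p L' e by (intro matrix_groupD(5)[OF G])
  also have "?this \<longleftrightarrow> crossing 1 (-3) (-3) \<in> ?C"
    by (intro matrix_group_pm_eq[OF G]) (simp add: crossing_mat2 shift_def pm_eq_def)
  finally have c3: "crossing 1 (-3) (-3) \<in> ?C" .
  show "\<exists>k::int. crossing 1 j k \<in> ?C" for j :: int
  proof -
    have "6 dvd j - 0 \<or> 6 dvd j - 1 \<or> 6 dvd j - 2 \<or> 6 dvd j - (-3) \<or> 6 dvd j - (-2) \<or> 6 dvd j - 5" by presburger
    thus ?thesis
      using crossing_ex[OF G L, of 1 0 0 j] crossing_ex[OF G L, of 1 1 "-2" j]
        crossing_ex[OF G L, of 1 2 2 j] crossing_ex[OF G L, of 1 "-3" "-3" j]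
        crossing_ex[OF G L, of 1 "-2" 1 j] crossing_ex[OF G L, of 1 5 5 j] c c2 c3 p by auto
  qed
  show "?F ** leaf_turn 25 p ** adj ?F \<in> SL2Z" if "p \<in> ?Y" for p
    unfolding leaf_turn_def scale_crossing[OF s] using that
    by (auto simp: height_def crossing_mat2 tf)
qed auto

section \<open>The Weierstrass groups\<close>

lemma UNIV_side: "UNIV = {S1, S2, S3}"
proof -
  have "s \<in> {S1, S2, S3}" for s by (cases s) auto
  thus ?thesis by blast
qed

text \<open>The mark on \<open>[-1,0]\<close> is the image of \<open>n + i h\<close> with
  \<open>h = sqrt n\<close> under the half-turn about the mark \<open>i h\<close> of
  \<open>[0,\<infinity>]\<close>. So one generator is replaced by a conjugate under another.\<close>

lemma weierstrass_group_eq: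
  assumes n: "n \<ge> 1"
  shows "weierstrass_group 1 (1 / real n) (real n) = psl ` leaf_group n (weierstrass_leaves n)"
proof -
  define h where "h = sqrt (real n)"
  have h: "h > 0" "h * h = n" using n by (simp_all add: h_def)
  define m2 where "m2 = half_turn_matrix (triangle_mark (integral_labels n) S2)"
  have up: "Complex 0 h \<in> upper" using h by (simp add: upper_def)
  have "triangle_mark (integral_labels n) S2 = moebius (side_frame n True S2) (Complex 0 h)"
    using triangle_mark_frame[OF n, of True S2] by (simp add: tile_labels_def side_class_def height_def h_def)
  hence "m2 = side_frame n True S2 ** crossing h 0 0 ** adj (side_frame n True S2)"
    unfolding m2_def using n h up half_turn_matrix_moebius[of "side_frame n True S2" "Complex 0 h"]
    by (simp add: half_turn_matrix_Complex del: side_frame.simps)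
  also have "\<dots> = crossing h 0 0 ** crossing h n n ** adj (crossing h 0 0)"
    using h n by (simp add: Let_def height_def side_class_def crossing_mat2 field_simps flip: h_def)
  finally have m2: "m2 = crossing h 0 0 ** crossing h n n ** adj (crossing h 0 0)" .
  have c: "crossing h 0 0 \<in> SL2" "crossing h n n \<in> SL2" using h by auto
  hence m2': "adj (crossing h 0 0) ** m2 ** crossing h 0 0 = crossing h n n"
    unfolding m2 by (metis adj_left adj_left_assoc matrix_mul_assoc matrix_mul_rid)
  have sides: "range f = {f S1, f S2, f S3}" for f :: "side \<Rightarrow> 'a"
    by (simp add: UNIV_side)
  let ?X = "{crossing 1 (-1) (-1), m2, crossing h 0 0}"
  let ?L = "leaf_group n (weierstrass_leaves n)"
  have X: "?X \<subseteq> SL2" using c m2 h by auto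
  have "(\<lambda>s. half_turn (triangle_mark (labels 1 (1 / real n) (real n)) s)) ` UNIV = psl ` ?X"
    unfolding sides
    using h by (simp add: half_turn_def labels_def half_turn_matrix_Complex m2_def integral_labels_def h_def)
  hence "weierstrass_group 1 (1 / real n) (real n) = psl ` mgen ?X"
    unfolding weierstrass_group_def by (simp only: generate_psl[OF X])
  also have "mgen ?X = ?L"
  proof
    have L: "matrix_group ?L" using n by (rule matrix_group_leaf_group)
    have "crossing 1 (-1) (-1) \<in> ?L" "crossing h n n \<in> ?L" "crossing h 0 0 \<in> ?L"
      using leaf_crossing_mem[of S1 "-1" "weierstrass_leaves n" n] leaf_crossing_mem[of S2 "int n" "weierstrass_leaves n" n]
        leaf_crossing_mem[of S3 0 "weierstrass_leaves n" n] by (simp_all add: height_def h_def)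
    thus "mgen ?X \<subseteq> ?L" using matrix_groupD(4,5)[OF L] by (intro mgen_subset[OF L]) (auto simp: m2)
    have M: "matrix_group (mgen ?X)" using X by (rule matrix_group_mgen)
    have in_X: "crossing 1 (-1) (-1) \<in> mgen ?X" "m2 \<in> mgen ?X" "crossing h 0 0 \<in> mgen ?X"
      by (auto intro: mgen.incl)
    hence "crossing h n n \<in> mgen ?X"
      unfolding m2'[symmetric] using matrix_groupD(4,5)[OF M] by blast
    thus "?L \<subseteq> mgen ?X"
      using in_X by (intro leaf_group_subset[OF M]) (auto simp: leaf_turn_def height_def h_def)
  qed
  finally show ?thesis .
qed

text \<open>The label-1 mark at -1 and the mark of height \<open>sqrt n\<close> at 0 have distance
  1, which gives \<open>n dvd 4\<close>.\<close>

theorem arithmetic_weierstrass_iff: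
  assumes n: "n \<ge> 1"
  shows "arithmetic (weierstrass_group 1 (1 / real n) (real n)) \<longleftrightarrow> n \<in> {1, 2, 4}"
proof
  assume "arithmetic (weierstrass_group 1 (1 / real n) (real n))"
  hence ar: "arithmetic (psl ` leaf_group n (weierstrass_leaves n))" unfolding weierstrass_group_eq[OF n] .
  have "int n dvd ((- 1 - 0)\<^sup>2 + 1)\<^sup>2"
    using arithmetic_leaf_pair[OF matrix_group_leaf_group[OF n] ar n, of S1 "-1" S3 0]
    by (simp add: leaf_group_mem)
  hence "int n dvd int (2 ^ 2)" by simp
  hence "n dvd 2 ^ 2" by (simp only: int_dvd_int_iff)
  then obtain i where "i \<le> 2" "n = 2 ^ i" using divides_primepow_nat[of 2 n 2] by auto
  thus "n \<in> {1, 2, 4}" by (cases "i = 0"; cases "i = 1"; cases "i = 2") auto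
next
  assume "n \<in> {1, 2, 4}"
  thus "arithmetic (weierstrass_group 1 (1 / real n) (real n))"
    unfolding weierstrass_group_eq[OF n]
    using arithmetic_weierstrass_1 arithmetic_weierstrass_2 arithmetic_weierstrass_4 by auto
qed

section \<open>The star and diamond jigsaws\<close>

text \<open>The map from \<open>z\<close> to \<open>-1 / (z + 1)\<close> is a rotation of order 3.
  The frames of a \<open>(1,1,1)\<close> tile are its powers, so the three sides of the central tile
  can be treated like \<open>[0,\<infinity>]\<close>.\<close>

lemma triangle_rotation:
  "moebius (mat2 0 (-1) 1 1) ` ideal_triangle = ideal_triangle"
proof (subst set_eq_iff, rule allI)
  fix z
  have S: "mat2 0 (-1) 1 1 \<in> SL2" by simp
  have "z \<in> moebius (mat2 0 (-1) 1 1) ` ideal_triangle \<longleftrightarrow>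
      Im z > 0 \<and> moebius (mat2 1 1 (-1) 0) z \<in> ideal_triangle"
    using mem_moebius_image[OF S ideal_triangle_upper, of z] by (simp add: upper_def)
  also have "\<dots> \<longleftrightarrow> z \<in> ideal_triangle"
  proof (cases "Im z > 0")
    case True
    define w where "w = moebius (mat2 1 1 (-1) 0) z"
    define N where "N = (Re z)\<^sup>2 + (Im z)\<^sup>2"
    have N: "N > 0" using True by (simp add: N_def add_nonneg_pos)
    have w: "w = - ((z + 1) / z)" by (simp add: w_def moebius_def)
    have "Re ((z + 1) / z) = (N + Re z) / N"
      by (simp add: Re_divide N_def power2_eq_square algebra_simps)
    hence Re: "Re w = - (N + Re z) / N" unfolding w uminus_complex.sel by (simp only: minus_divide_left)
    have Im: "Im w = Im z / N" unfolding w by (simp add: Im_divide N_def power2_eq_square algebra_simps)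
    have eq: "(Re w)\<^sup>2 + (Im w)\<^sup>2 + Re w = (Re z + 1) / N"
    proof -
      have "(N + Re z)\<^sup>2 + (Im z)\<^sup>2 - (N + Re z) * N = N * (Re z + 1)"
        by (simp add: N_def power2_eq_square algebra_simps)
      hence "((N + Re z)\<^sup>2 + (Im z)\<^sup>2 - (N + Re z) * N) / N\<^sup>2 = (Re z + 1) / N"
        using N by (simp add: power2_eq_square)
      moreover have "(N + Re z)\<^sup>2 / N\<^sup>2 + (Im z)\<^sup>2 / N\<^sup>2 + - ((N + Re z) / N) =
          ((N + Re z)\<^sup>2 + (Im z)\<^sup>2 - (N + Re z) * N) / N\<^sup>2"
        using N by (simp add: field_simps power2_eq_square)
      ultimately show ?thesis unfolding Re Im minus_divide_left[symmetric] power2_minus power_divide by simp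
    qed
    have "Im w > 0" "-1 \<le> Re w \<longleftrightarrow> Re z \<le> 0" "Re w \<le> 0 \<longleftrightarrow> N + Re z \<ge> 0"
      "(Re w)\<^sup>2 + (Im w)\<^sup>2 + Re w \<ge> 0 \<longleftrightarrow> Re z \<ge> -1"
      unfolding eq unfolding Re Im using True N by (auto simp: field_simps)
    thus ?thesis using True unfolding ideal_triangle_iff w_def[symmetric] N_def by auto
  qed (auto simp: ideal_triangle_def)
  finally show "z \<in> moebius (mat2 0 (-1) 1 1) ` ideal_triangle \<longleftrightarrow> z \<in> ideal_triangle" .
qed

lemma side_frame_False: "side_frame n False S2 = mat2 0 (-1) 1 1"
  by (simp add: side_class_def height_def)

lemma triangle_side_rotation:
  assumes "n \<ge> 1"
  shows "moebius (side_frame n False s) ` ideal_triangle = ideal_triangle"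
proof (cases s)
  case S1
  have "side_frame n False S1 = mat2 0 (-1) 1 1 ** mat2 0 (-1) 1 1" by simp
  hence "moebius (side_frame n False S1) ` ideal_triangle =
      moebius (mat2 0 (-1) 1 1) ` (moebius (mat2 0 (-1) 1 1) ` ideal_triangle)"
    using moebius_image_mult[OF _ _ ideal_triangle_upper, of "mat2 0 (-1) 1 1" "mat2 0 (-1) 1 1"]
    by (simp del: mat2_mult side_frame.simps)
  thus ?thesis using S1 triangle_rotation by simp
next
  case S2
  thus ?thesis using triangle_rotation by (simp only: side_frame_False)
next
  case S3
  have "moebius (mat 1) = (\<lambda>z. z)" by (simp add: moebius_mat_1 fun_eq_iff)
  thus ?thesis using S3 by simp
qed

lemma moebius_inj: "A \<in> SL2 \<Longrightarrow> inj_on (moebius A) upper"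
  by (rule inj_on_inverseI[of _ "moebius (adj A)"]) (simp add: moebius_adj)

section \<open>The tiles of the star and the diamond\<close>

definition center_tile :: tile where
  "center_tile = (integral_labels 1, mat 1)"

text \<open>The shift by 1 moves the side \<open>S1\<close> of the n-tile to the imaginary axis, and
  the frame carries it on to the side \<open>s\<close> of the central tile.\<close>

definition outer_tile :: "nat \<Rightarrow> side \<Rightarrow> tile" where
  "outer_tile n s = (integral_labels n, side_frame n False s ** shift 1)"

lemma admissible_tiles: "n \<ge> 1 \<Longrightarrow> admissible n center_tile" "n \<ge> 1 \<Longrightarrow> admissible n (outer_tile n s)"
  by (simp_all add: admissible_def center_tile_def outer_tile_def del: side_frame.simps)

lemma kind_tiles: "kind center_tile = False" "n \<ge> 2 \<Longrightarrow> kind (outer_tile n s) = True"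
  using integral_labels_ne[of n] by (simp_all add: kind_def center_tile_def outer_tile_def)

lemma center_region: "tile_region center_tile = ideal_triangle"
proof -
  have "moebius (mat 1) = (\<lambda>z. z)" by (simp add: moebius_mat_1 fun_eq_iff)
  thus ?thesis by (simp add: tile_region_def center_tile_def)
qed

lemma center_side: "tile_side center_tile s = triangle_side s"
proof -
  have "moebius (mat 1) = (\<lambda>z. z)" by (simp add: moebius_mat_1 fun_eq_iff)
  thus ?thesis by (simp add: tile_side_def center_tile_def)
qed

lemma shift_image: "moebius (shift 1) ` X = (\<lambda>z. z + 1) ` X"
  by (rule image_cong) (simp_all add: moebius_def shift_def)

lemma outer_region:
  assumes "n \<ge> 1"
  shows "tile_region (outer_tile n s) = moebius (side_frame n False s) ` ((\<lambda>z. z + 1) ` ideal_triangle)"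
  using assms unfolding tile_region_def outer_tile_def
  by (simp add: moebius_image_mult ideal_triangle_upper shift_image del: side_frame.simps)

lemma outer_glued:
  assumes n: "n \<ge> 2"
  shows "glued center_tile s (outer_tile n s) S1"
proof -
  let ?F = "side_frame n False s"
  have n1: "n \<ge> 1" using n by simp
  have F: "?F \<in> SL2" using n1 by (rule SL2_side_frame)
  have shift_mem: "x \<in> (\<lambda>z. z + 1) ` X \<longleftrightarrow> x - 1 \<in> X" for x :: complex and X
    by (force simp: image_iff)
  have up: "triangle_side S1 \<subseteq> upper" by (rule triangle_side_upper)
  have "tile_side (outer_tile n s) S1 = moebius ?F ` ((\<lambda>z. z + 1) ` triangle_side S1)"
    using F up unfolding tile_side_def outer_tile_def
    by (simp add: moebius_image_mult shift_image del: side_frame.simps triangle_side.simps)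
  also have "(\<lambda>z. z + 1) ` triangle_side S1 = imag_axis"
    by (auto simp: shift_mem imag_axis_def)
  also have "moebius ?F ` imag_axis = triangle_side s" using triangle_side_frame[OF n1] by simp
  finally have side: "tile_side center_tile s = tile_side (outer_tile n s) S1" by (simp add: center_side)
  have "tile_mark center_tile s = moebius ?F (Complex 0 1)"
    using triangle_mark_frame[OF n1, of False s]
    by (simp add: tile_mark_def center_tile_def moebius_mat_1 tile_labels_def side_class_def height_def del: side_frame.simps)
  moreover have "tile_mark (outer_tile n s) S1 = moebius ?F (moebius (shift 1) (Complex (-1) 1))"
    using F by (simp add: tile_mark_def outer_tile_def moebius_mult upper_def integral_labels_S1 del: side_frame.simps)
  moreover have "moebius (shift 1) (Complex (-1) 1) = Complex 0 1"
    by (simp add: moebius_def shift_def complex_eq_iff)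
  ultimately have mark: "tile_mark center_tile s = tile_mark (outer_tile n s) S1" by simp
  have "tile_region center_tile \<inter> tile_region (outer_tile n s) =
      moebius ?F ` ideal_triangle \<inter> moebius ?F ` ((\<lambda>z. z + 1) ` ideal_triangle)"
    unfolding center_region outer_region[OF n1] triangle_side_rotation[OF n1] ..
  also have "\<dots> = moebius ?F ` (ideal_triangle \<inter> (\<lambda>z. z + 1) ` ideal_triangle)"
    by (rule inj_on_image_Int[OF moebius_inj[OF F] ideal_triangle_upper, symmetric])
      (use ideal_triangle_upper in \<open>auto simp: upper_def\<close>)
  also have "ideal_triangle \<inter> (\<lambda>z. z + 1) ` ideal_triangle = imag_axis"
    by (auto simp: shift_mem imag_axis_def ideal_triangle_iff)
  also have "moebius ?F ` imag_axis = triangle_side s" using triangle_side_frame[OF n1] by simp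
  finally have "tile_region center_tile \<inter> tile_region (outer_tile n s) = tile_side center_tile s"
    by (simp add: center_side)
  thus ?thesis using side mark
    by (simp add: glued_def integral_labels_S1 integral_labels_1 center_tile_def outer_tile_def
        del: One_nat_def)
qed

text \<open>An outer tile stays in the half plane beyond its side; the half planes beyond the three
  sides of the triangle are disjoint.\<close>

lemma outer_half_plane:
  assumes n: "n \<ge> 1" and z: "z \<in> tile_region (outer_tile n s)"
  shows "Im z > 0 \<and> (case s of S1 \<Rightarrow> Re z \<le> -1 | S2 \<Rightarrow> (Re z)\<^sup>2 + (Im z)\<^sup>2 + Re z \<le> 0 | S3 \<Rightarrow> Re z \<ge> 0)"
proof -
  let ?F = "side_frame n False s"
  have F: "?F \<in> SL2" using n by (rule SL2_side_frame)
  have "(\<lambda>z. z + 1) ` ideal_triangle \<subseteq> upper" using ideal_triangle_upper by (auto simp: upper_def)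
  hence z': "z \<in> upper" "moebius (adj ?F) z \<in> (\<lambda>z. z + 1) ` ideal_triangle"
    using z mem_moebius_image[OF F] unfolding outer_region[OF n] by blast+
  hence Re: "Re (moebius (adj ?F) z) \<ge> 0" and Im: "Im z > 0" by (auto simp: ideal_triangle_iff upper_def)
  show ?thesis
  proof (cases s)
    case S1
    have "(Re z + 1)\<^sup>2 + (Im z)\<^sup>2 > 0" using Im by (simp add: add_nonneg_pos)
    moreover have "Re (moebius (adj ?F) z) = - (Re z + 1) / ((Re z + 1)\<^sup>2 + (Im z)\<^sup>2)"
      using S1 by (simp add: moebius_def Re_divide power2_eq_square algebra_simps)
    ultimately show ?thesis using Re Im S1 by (simp add: zero_le_divide_iff)
  next
    case S2
    have "(Re z)\<^sup>2 + (Im z)\<^sup>2 > 0" using Im by (simp add: add_nonneg_pos)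
    moreover have "moebius (adj ?F) z = - ((z + 1) / z)"
      using S2 by (simp add: side_frame_False moebius_def del: side_frame.simps)
    moreover have "Re ((z + 1) / z) = ((Re z)\<^sup>2 + (Im z)\<^sup>2 + Re z) / ((Re z)\<^sup>2 + (Im z)\<^sup>2)"
      by (simp add: Re_divide power2_eq_square algebra_simps)
    ultimately have "((Re z)\<^sup>2 + (Im z)\<^sup>2 + Re z) / ((Re z)\<^sup>2 + (Im z)\<^sup>2) \<le> 0" "(Re z)\<^sup>2 + (Im z)\<^sup>2 > 0"
      using Re by simp_all
    thus ?thesis using Im S2 by (simp add: divide_le_0_iff)
  next
    case S3
    thus ?thesis using Re Im by (simp add: moebius_mat_1)
  qed
qed

lemma outer_disjoint:
  assumes n: "n \<ge> 1" and s: "s \<noteq> s'"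
  shows "tile_region (outer_tile n s) \<inter> tile_region (outer_tile n s') = {}"
proof -
  have 12: False if "(x::real) \<le> -1" "x\<^sup>2 + y\<^sup>2 + x \<le> 0" "y > 0" for x y
  proof -
    have "x * (x + 1) \<ge> 0" using that(1) by (simp add: mult_nonpos_nonpos)
    moreover have "y\<^sup>2 > 0" using that(3) by simp
    ultimately show False using that(2) by (simp add: power2_eq_square algebra_simps)
  qed
  have 23: False if "(x::real) \<ge> 0" "x\<^sup>2 + y\<^sup>2 + x \<le> 0" "y > 0" for x y
  proof -
    have "y\<^sup>2 > 0" "x\<^sup>2 \<ge> 0" using that(3) by simp_all
    thus False using that(1,2) by linarith
  qed
  show ?thesis
    using outer_half_plane[OF n, of _ s] outer_half_plane[OF n, of _ s'] s 12 23
    by (cases s; cases s') fastforce+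
qed

lemma glue_outer:
  assumes n: "n \<ge> 2" and J: "J = insert center_tile (outer_tile n ` X)" and s: "s \<notin> X"
    and as: "assembled {integral_labels 1, integral_labels n} J"
  shows "assembled {integral_labels 1, integral_labels n} (insert (outer_tile n s) J)"
    "boundary (insert (outer_tile n s) J) =
      boundary J - {(center_tile, s)} \<union> {(outer_tile n s, S2), (outer_tile n s, S3)}"
proof -
  have n1: "n \<ge> 1" using n by simp
  note g = outer_glued[OF n, of s]
  have "(\<Union>u\<in>J. tile_region u) \<inter> tile_region (outer_tile n s) =
      tile_region center_tile \<inter> tile_region (outer_tile n s)"
  proof -
    have "tile_region (outer_tile n a) \<inter> tile_region (outer_tile n s) = {}" if "a \<in> X" for a
      using that s by (intro outer_disjoint[OF n1]) auto
    thus ?thesis unfolding J by blast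
  qed
  hence r: "(\<Union>u\<in>J. tile_region u) \<inter> tile_region (outer_tile n s) = tile_side center_tile s"
    using g by (simp add: glued_def)
  have c: "center_tile \<in> J" by (simp add: J)
  have SL: "side_frame n False s ** shift 1 \<in> SL2" using n1 by (simp del: side_frame.simps)
  show "assembled {integral_labels 1, integral_labels n} (insert (outer_tile n s) J)"
    using assembled.glue[OF as c _ SL g[unfolded outer_tile_def] r[unfolded outer_tile_def]]
    by (simp add: outer_tile_def)
  have "x \<noteq> S1 \<longleftrightarrow> x \<in> {S2, S3}" for x by (cases x) auto
  hence "{(outer_tile n s, x) |x. x \<noteq> S1} = {(outer_tile n s, S2), (outer_tile n s, S3)}" by blast
  thus "boundary (insert (outer_tile n s) J) =
      boundary J - {(center_tile, s)} \<union> {(outer_tile n s, S2), (outer_tile n s, S3)}"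
    using glue_step(3)[OF n assembled_matched[OF n as] c admissible_tiles(2)[OF n1] g r] by simp
qed

lemma lone_same_frame:
  assumes n: "n \<ge> 2" and G: "frame n center_tile s \<doteq> G"
  shows "list_all2 (same_frame n) [(outer_tile n s, S3), (outer_tile n s, S2)] (leaf_frames n G lone_branch)"
proof -
  have n1: "n \<ge> 1" using n by simp
  note a = admissible_tiles[OF n1]
  have cl: "tclass center_tile s = S1" "tclass (outer_tile n s) r = r" for r
    using kind_tiles n by (simp_all add: tclass_def side_class_def)
  have "frame n (outer_tile n s) S1 \<doteq> frame n center_tile s ** turn (height n S1)"
    using glued_frame(2)[OF n a(1) a(2) outer_glued[OF n, of s]] by (simp add: cl)
  also have "\<dots> \<doteq> G ** turn (height n S1)" by (intro pm_eq_mult G pm_eq_refl)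
  finally have "frame n (outer_tile n s) S1 \<doteq> G ** turn (height n (tclass (outer_tile n s) S1))"
    by (simp add: cl)
  from tile_sides_frames[OF n1 this] show ?thesis
    using kind_tiles n by (simp add: lone_branch_def Let_def same_frame_def cl side_class_def)
qed

lemma center_same_frame:
  assumes n: "n \<ge> 1"
  shows "frame n center_tile S3 \<doteq> mat 1" "frame n center_tile S2 \<doteq> turn 1 ** shift 1"
    "frame n center_tile S1 \<doteq> turn 1 ** shift 1 ** turn 1 ** shift 1"
proof -
  have cl: "tclass center_tile s = S1" for s
    using kind_tiles by (simp add: tclass_def side_class_def)
  show S3: "frame n center_tile S3 \<doteq> mat 1" by (simp add: frame_def center_tile_def)
  hence "frame n center_tile S3 \<doteq> turn 1 ** turn (height n (tclass center_tile S3))"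
    by (simp add: cl height_def turn_turn)
  from tile_sides_frames[OF n this]
  show "frame n center_tile S2 \<doteq> turn 1 ** shift 1"
    "frame n center_tile S1 \<doteq> turn 1 ** shift 1 ** turn 1 ** shift 1"
    by (simp_all add: cl kind_tiles corner_def height_def)
qed

definition diamond_tiles :: "nat \<Rightarrow> tile set" where
  "diamond_tiles n = {center_tile, outer_tile n S3}"

definition star_tiles :: "nat \<Rightarrow> tile set" where
  "star_tiles n = insert center_tile (range (outer_tile n))"

lemma boundary_center: "boundary {center_tile} = {(center_tile, S1), (center_tile, S2), (center_tile, S3)}"
proof -
  have "boundary {center_tile} = Pair center_tile ` UNIV" by (auto simp: boundary_def)
  thus ?thesis by (simp add: UNIV_side)
qed

lemma assembled_center: "assembled {integral_labels 1, integral_labels n} {center_tile}"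
  unfolding center_tile_def by (rule assembled.single) auto

lemma center_outer_ne: "n \<ge> 2 \<Longrightarrow> center_tile \<noteq> outer_tile n s"
  using integral_labels_ne[of n] by (auto simp: center_tile_def outer_tile_def)

lemma outer_tile_inj:
  assumes "n \<ge> 2" "outer_tile n s = outer_tile n s'"
  shows "s = s'"
proof (rule ccontr)
  assume "s \<noteq> s'"
  moreover have "n \<ge> 1" using assms by simp
  ultimately have "tile_region (outer_tile n s) = {}"
    using outer_disjoint[of n s s'] assms(2) by auto
  thus False using tile_side_subset[of "outer_tile n s" S1]
      tile_side_nonempty[OF \<open>n \<ge> 1\<close> admissible_tiles(2)[OF \<open>n \<ge> 1\<close>], of s S1] by auto
qed

text \<open>The conjugation by \<open>shift 1\<close> makes up for the starting position -1.\<close>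

lemma diamond_group:
  assumes n: "n \<ge> 2"
  shows "jigsaw_group (diamond_tiles n) = psl ` conj_set (shift 1) (leaf_group n (diamond_leaves n))"
proof -
  have n1: "n \<ge> 1" using n by simp
  have J1: "{center_tile} = insert center_tile (outer_tile n ` {})" by simp
  have s: "S3 \<notin> {}" by simp
  note g = glue_outer[OF n J1 s assembled_center]
  have J: "diamond_tiles n = insert (outer_tile n S3) {center_tile}" by (auto simp: diamond_tiles_def)
  have adm: "\<forall>t\<in>diamond_tiles n. admissible n t" by (auto simp: diamond_tiles_def admissible_tiles[OF n1])
  \<comment> \<open>The order along the boundary, which is the order of
    \<open>polygon_frames\<close>.\<close>
  let ?ps = "[(outer_tile n S3, S3), (outer_tile n S3, S2), (center_tile, S2), (center_tile, S1)]"
  have "set ?ps = boundary (diamond_tiles n)"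
    unfolding J g(2) boundary_center by auto
  moreover have "distinct ?ps" using center_outer_ne[OF n] center_outer_ne[OF n, symmetric] by auto
  moreover have "list_all2 (same_frame n) ?ps (polygon_frames n (mat 1) lone_branch diamond_branch)"
  proof -
    have "list_all2 (same_frame n) [(center_tile, S2), (center_tile, S1)]
      (leaf_frames n (mat 1 ** turn (height n (bclass lone_branch))) diamond_branch)"
      using center_same_frame[OF n1] kind_tiles
      by (simp add: diamond_branch_def lone_branch_def Let_def same_frame_def tclass_def side_class_def
          height_def corner_def)
    from list_all2_appendI[OF lone_same_frame[OF n center_same_frame(1)[OF n1]] this]
    show ?thesis by (simp add: polygon_frames_def)
  qed
  ultimately have "framing n (diamond_tiles n) (polygon_frames n (mat 1) lone_branch diamond_branch)"
    unfolding framing_def by blast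
  from framing_group[OF n1 adm SL2_one lone_polygon(1) this, of "-1"]
  show ?thesis by (simp add: lone_leaves)
qed

lemma star_assembled:
  assumes n: "n \<ge> 2"
  shows "assembled {integral_labels 1, integral_labels n} (star_tiles n)"
    "boundary (star_tiles n) = (\<Union>s. {(outer_tile n s, S2), (outer_tile n s, S3)})"
proof -
  have U: "range f = {f S1, f S2, f S3}" for f :: "side \<Rightarrow> 'a" by (simp add: UNIV_side)
  have s: "S3 \<notin> {}" "S2 \<notin> {S3}" "S1 \<notin> {S2, S3}" by simp_all
  have J1: "{center_tile} = insert center_tile (outer_tile n ` {})" by simp
  note g1 = glue_outer[OF n J1 s(1) assembled_center]
  have J2: "{outer_tile n S3, center_tile} = insert center_tile (outer_tile n ` {S3})" by auto
  note g2 = glue_outer[OF n J2 s(2) g1(1)]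
  have J3: "{outer_tile n S2, outer_tile n S3, center_tile} = insert center_tile (outer_tile n ` {S2, S3})" by auto
  note g3 = glue_outer[OF n J3 s(3) g2(1)]
  have J: "star_tiles n = {outer_tile n S1, outer_tile n S2, outer_tile n S3, center_tile}"
    unfolding star_tiles_def U by auto
  show "assembled {integral_labels 1, integral_labels n} (star_tiles n)" unfolding J by (rule g3(1))
  show "boundary (star_tiles n) = (\<Union>s. {(outer_tile n s, S2), (outer_tile n s, S3)})"
    unfolding J g3(2) g2(2) g1(2) boundary_center U using center_outer_ne[OF n] center_outer_ne[OF n, symmetric] by auto
qed

lemma star_group:
  assumes n: "n \<ge> 2"
  shows "jigsaw_group (star_tiles n) = psl ` conj_set (shift 1) (leaf_group n (star_leaves n))"
proof -
  have n1: "n \<ge> 1" using n by simp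
  have U: "range f = {f S1, f S2, f S3}" for f :: "side \<Rightarrow> 'a" by (simp add: UNIV_side)
  have adm: "\<forall>t\<in>star_tiles n. admissible n t" by (auto simp: star_tiles_def admissible_tiles[OF n1])
  let ?qs = "\<lambda>s. [(outer_tile n s, S3), (outer_tile n s, S2)]"
  let ?ps = "?qs S3 @ ?qs S2 @ ?qs S1"
  have "set ?ps = boundary (star_tiles n)"
    unfolding star_assembled(2)[OF n] U by auto
  moreover have "distinct ?ps" using outer_tile_inj[OF n] by auto
  moreover have "list_all2 (same_frame n) ?ps (polygon_frames n (mat 1) lone_branch star_branch)"
  proof -
    have eq: "leaf_frames n (mat 1 ** turn (height n (bclass lone_branch))) star_branch =
      leaf_frames n (turn 1 ** shift 1) lone_branch @ leaf_frames n (turn 1 ** shift 1 ** turn 1 ** shift 1) lone_branch"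
      by (simp add: star_branch_def lone_branch_def Let_def side_class_def height_def corner_def)
    show ?thesis unfolding polygon_frames_def eq
      by (intro list_all2_appendI lone_same_frame[OF n] center_same_frame[OF n1])
  qed
  ultimately have "framing n (star_tiles n) (polygon_frames n (mat 1) lone_branch star_branch)"
    unfolding framing_def by blast
  from framing_group[OF n1 adm SL2_one lone_polygon(2) this, of "-1"]
  show ?thesis by (simp add: lone_leaves)
qed

lemma diamond_jigsaw_tiles:
  assumes "n \<ge> 2"
  shows "diamond_jigsaw n (diamond_tiles n)"
  using diamond_jigsaw_example[OF assms]
  by (simp add: diamond_tiles_def center_tile_def outer_tile_def shift_def)

lemma star_jigsaw_tiles:
  assumes n: "n \<ge> 2"
  shows "star_jigsaw n (star_tiles n)"
proof -
  have "(integral_labels 1, mat 1) \<in> star_tiles n" "(integral_labels n, side_frame n False S3 ** shift 1) \<in> star_tiles n"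
    using rangeI[of "outer_tile n" S3] by (auto simp: star_tiles_def center_tile_def outer_tile_def)
  moreover have "normalized (star_tiles n)"
    using center_region by (auto simp: normalized_def star_tiles_def center_tile_def)
  ultimately have "jigsaw n (star_tiles n)"
    using star_assembled(1)[OF n] unfolding jigsaw_def by blast
  moreover have "star_tiles n = insert (integral_labels 1, mat 1)
      (range (\<lambda>s. (integral_labels n, side_frame n False s ** shift 1)))"
    unfolding star_tiles_def center_tile_def outer_tile_def ..
  moreover have "\<forall>s. \<exists>s'. glued (integral_labels 1, mat 1) s (integral_labels n, side_frame n False s ** shift 1) s'"
    using outer_glued[OF n] unfolding center_tile_def outer_tile_def by blast
  ultimately show ?thesis unfolding star_jigsaw_def
    by (intro conjI exI[of _ "mat 1"] exI[of _ "\<lambda>s. side_frame n False s ** shift 1"])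
qed

section \<open>The classification\<close>

lemma finite_cover_conj:
  assumes F: "F \<in> SL2" and c: "finite_cover K G"
  shows "finite_cover (conj_set F K) (conj_set F G)"
proof -
  obtain C where C: "finite C" "C \<subseteq> SL2" "\<And>A. A \<in> G \<Longrightarrow> \<exists>B\<in>K. \<exists>D\<in>C. A = B ** D"
    using c unfolding finite_cover_def by blast
  have "\<exists>B\<in>conj_set F K. \<exists>D\<in>conj_set F C. A = B ** D" if A: "A \<in> conj_set F G" for A
  proof -
    obtain A' where A': "A' \<in> G" "A = F ** A' ** adj F" using A by (auto simp: conj_set_def)
    obtain B D where BD: "B \<in> K" "D \<in> C" "A' = B ** D" using C(3)[OF A'(1)] by blast
    have "A = (F ** B ** adj F) ** (F ** D ** adj F)"
      using A' BD by (simp add: adj_left_assoc[OF F] flip: matrix_mul_assoc)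
    thus ?thesis using BD by (auto simp: conj_set_def)
  qed
  moreover have "finite (conj_set F C)" "conj_set F C \<subseteq> SL2" using C F by (auto simp: conj_set_def)
  ultimately show ?thesis unfolding finite_cover_def by blast
qed

lemma arithmetic_conj_set_iff:
  assumes F: "F \<in> SL2" and G: "matrix_group G"
  shows "arithmetic (psl ` conj_set F G) \<longleftrightarrow> arithmetic (psl ` G)"
proof
  assume "arithmetic (psl ` G)"
  moreover have "G = conj_set (adj F) (conj_set F G)" using F by (simp add: conj_set_conj_set adj_left)
  ultimately show "arithmetic (psl ` conj_set F G)"
    using arithmetic_conj_set[of "adj F" "conj_set F G"] F conj_set_matrix_group[OF F G] by simp
qed (rule arithmetic_conj_set[OF F G])

lemma finite_index_up_to_conj:
  assumes F: "F \<in> SL2" "F' \<in> SL2" and K: "matrix_group K" and G: "matrix_group G"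
    and sub: "K \<subseteq> G" "finite_cover K G"
  shows "finite_index_subgroup_up_to_conj (psl ` conj_set F K) (psl ` conj_set F' G)"
proof -
  let ?A = "F' ** adj F"
  have A: "?A \<in> SL2" using F by simp
  have "conjugate_by (psl ?A) (psl ` conj_set F K) = psl ` conj_set F' K"
    unfolding conjugate_by_psl[OF A conj_set_matrix_group[OF F(1) K]] conj_set_conj_set
    by (simp add: adj_left[OF F(1)] flip: matrix_mul_assoc)
  moreover have "finite_index_subgroup (psl ` conj_set F' K) (psl ` conj_set F' G)"
    using F K G sub by (intro finite_index_psl conj_set_matrix_group conj_set_mono finite_cover_conj)
  ultimately show ?thesis
    unfolding finite_index_subgroup_up_to_conj_def carrier_PSL2R using A
    by (intro bexI[of _ "psl ?A"] imageI) simp_all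
qed

text \<open>\<open>jigsaw_polygon\<close> leaves the starting position free, so it can be chosen
  afterwards as the lift \<open>z\<close> found from the congruences.\<close>

lemma arithmetic_jigsaw_group:
  assumes n: "n \<ge> 2" and H: "is_jigsaw_group n H" "arithmetic H"
  obtains m z F b b' where "m = 3 \<and> n \<in> {3, 9} \<or> m = 5 \<and> n \<in> {5, 25}" "standard_polygon m n z b b'"
    "F \<in> SL2" "H = psl ` conj_set F (leaf_group n (polygon_leaves n z b b'))"
proof -
  obtain J where J: "jigsaw n J" "H = jigsaw_group J" using H by (auto simp: is_jigsaw_group_def)
  obtain F b b' where *: "F \<in> SL2" "polygon b b'" "kinds b \<union> kinds b' = UNIV"
    "\<And>x. H = psl ` conj_set (F ** shift (- real_of_int x)) (leaf_group n (polygon_leaves n x b b'))"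
    using jigsaw_polygon[OF n J(1)] J(2) by metis
  have SL: "F ** shift (- real_of_int x) \<in> SL2" for x using *(1) by simp
  have G: "matrix_group (leaf_group n Y)" for Y using n by (intro matrix_group_leaf_group) simp
  have "arithmetic (psl ` leaf_group n (polygon_leaves n x b b'))" for x
    using H(2) unfolding *(4)[of x] arithmetic_conj_set_iff[OF SL G] .
  from arithmetic_standard_polygon[OF n *(2,3) this] obtain m z where
    "m = 3 \<and> n \<in> {3, 9} \<or> m = 5 \<and> n \<in> {5, 25}" "standard_polygon m n z b b'" by blast
  thus ?thesis using that SL *(4) by blast
qed

text \<open>The marks of the polygon are lattice points, which gives the inclusion; the polygon
  group crosses at every lattice point up to translations by multiples of \<open>n + m\<close>,
  which gives the finite index.\<close>

lemma jigsaw_subgroup: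
  assumes n: "n \<ge> 2" and m: "m \<in> {3, 5}" "m dvd int n" and s: "standard_polygon m n z b b'"
    and F: "F \<in> SL2" "F' \<in> SL2"
    and lat: "\<And>p. lattice_point m n p \<Longrightarrow> leaf_turn n p \<in> leaf_group n Y" "\<forall>p\<in>Y. lattice_point m n p"
  shows "finite_index_subgroup_up_to_conj
    (psl ` conj_set F (leaf_group n (polygon_leaves n z b b'))) (psl ` conj_set F' (leaf_group n Y))"
proof (rule finite_index_up_to_conj[OF F])
  have n1: "n \<ge> 1" using n by simp
  show G: "matrix_group (leaf_group n (polygon_leaves n z b b'))" "matrix_group (leaf_group n Y)"
    using n1 by (simp_all add: matrix_group_leaf_group)
  show "leaf_group n (polygon_leaves n z b b') \<subseteq> leaf_group n Y"
    using polygon_lattice[OF m s] lat(1) by (intro leaf_group_subset[OF G(2)]) blast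
  show "finite_cover (leaf_group n (polygon_leaves n z b b')) (leaf_group n Y)"
    by (rule polygon_finite_cover[OF m n1 s lat(2)])
qed

lemma diamond_leaves_lattice: "\<forall>p\<in>diamond_leaves n. lattice_point 5 n p"
  by (auto simp: lattice_point_def intro: exI[of _ "int n"] exI[of _ "int n + 2"] exI[of _ "int n + 3"])

lemma star_leaves_lattice: "\<forall>p\<in>star_leaves n. lattice_point 3 n p"
proof -
  have "int n + 3 dvd 2 * int n + 6" "int n + 3 dvd (2 * int n + 3) - int n" "int n + 3 dvd (3 * int n + 6) - int n"
    by (rule dvdI[of _ _ 2], simp, rule dvdI[of _ _ 1], simp, rule dvdI[of _ _ 2], simp)
  thus ?thesis by (auto simp: lattice_point_def intro: exI[of _ "int n"])
qed

theorem theorem1p2: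
  shows
    "(\<forall>n::nat. n \<ge> 2 \<longrightarrow>
        (n \<notin> {3, 5, 9, 25} \<longrightarrow> (\<forall>H. is_jigsaw_group n H \<longrightarrow> \<not> arithmetic H)) \<and>
        (n \<in> {3, 5, 9, 25} \<longrightarrow> (\<exists>H. is_jigsaw_group n H \<and> arithmetic H)) \<and>
        (n \<in> {3, 9} \<longrightarrow>
           (\<exists>S. star_jigsaw n S \<and>
             (\<forall>H. is_jigsaw_group n H \<and> arithmetic H \<longrightarrow>
                finite_index_subgroup_up_to_conj H (jigsaw_group S)))) \<and>
        (n \<in> {5, 25} \<longrightarrow>
           (\<exists>D. diamond_jigsaw n D \<and>
             (\<forall>H. is_jigsaw_group n H \<and> arithmetic H \<longrightarrow>
                finite_index_subgroup_up_to_conj H (jigsaw_group D))))) \<and>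
     (\<forall>n::nat. n \<ge> 1 \<longrightarrow>
        (arithmetic (weierstrass_group 1 (1 / real n) (real n)) \<longleftrightarrow> n \<in> {1, 2, 4}))"
proof (intro conjI allI impI)
  fix n :: nat and H
  assume n: "n \<ge> 2" "n \<notin> {3, 5, 9, 25}" and H: "is_jigsaw_group n H"
  show "\<not> arithmetic H"
  proof
    assume "arithmetic H"
    from arithmetic_jigsaw_group[OF n(1) H this] have "n \<in> {3, 5, 9, 25}" by blast
    thus False using n(2) by blast
  qed
next
  fix n :: nat assume n: "n \<ge> 2" "n \<in> {3, 5, 9, 25}"
  have G: "matrix_group (leaf_group n Y)" for Y using n(1) by (intro matrix_group_leaf_group) simp
  show "\<exists>H. is_jigsaw_group n H \<and> arithmetic H"
  proof (cases "n \<in> {3, 9}")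
    case True
    hence "arithmetic (psl ` leaf_group n (star_leaves n))"
      using arithmetic_star_3 arithmetic_star_9 by auto
    hence "arithmetic (jigsaw_group (star_tiles n))"
      unfolding star_group[OF n(1)] arithmetic_conj_set_iff[OF SL2_shift G] .
    thus ?thesis using star_jigsaw_tiles[OF n(1)] by (auto simp: is_jigsaw_group_def star_jigsaw_def)
  next
    case False
    hence "arithmetic (psl ` leaf_group n (diamond_leaves n))"
      using n(2) arithmetic_diamond_5 arithmetic_diamond_25 by auto
    hence "arithmetic (jigsaw_group (diamond_tiles n))"
      unfolding diamond_group[OF n(1)] arithmetic_conj_set_iff[OF SL2_shift G] .
    thus ?thesis using diamond_jigsaw_tiles[OF n(1)] by (auto simp: is_jigsaw_group_def diamond_jigsaw_def)
  qed
next
  fix n :: nat assume n: "n \<ge> 2" "n \<in> {3, 9}"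
  have "finite_index_subgroup_up_to_conj H (jigsaw_group (star_tiles n))"
    if H: "is_jigsaw_group n H" "arithmetic H" for H
  proof -
    obtain m z F b b' where *: "m = 3 \<and> n \<in> {3, 9} \<or> m = 5 \<and> n \<in> {5, 25}" "standard_polygon m n z b b'"
      "F \<in> SL2" "H = psl ` conj_set F (leaf_group n (polygon_leaves n z b b'))"
      using arithmetic_jigsaw_group[OF n(1) H] .
    \<comment> \<open>The value of \<open>n\<close> decides between the two moduli.\<close>
    hence m: "m = 3" "m \<in> {3, 5}" "m dvd int n" using n(2) by auto
    show ?thesis unfolding star_group[OF n(1)] *(4)
      using star_lattice[of n] star_leaves_lattice n(1)
      by (intro jigsaw_subgroup[OF n(1) m(2,3) *(2,3)]) (auto simp: m(1))
  qed
  thus "\<exists>S. star_jigsaw n S \<and> (\<forall>H. is_jigsaw_group n H \<and> arithmetic H \<longrightarrow>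
          finite_index_subgroup_up_to_conj H (jigsaw_group S))"
    using star_jigsaw_tiles[OF n(1)] by blast
next
  fix n :: nat assume n: "n \<ge> 2" "n \<in> {5, 25}"
  have "finite_index_subgroup_up_to_conj H (jigsaw_group (diamond_tiles n))"
    if H: "is_jigsaw_group n H" "arithmetic H" for H
  proof -
    obtain m z F b b' where *: "m = 3 \<and> n \<in> {3, 9} \<or> m = 5 \<and> n \<in> {5, 25}" "standard_polygon m n z b b'"
      "F \<in> SL2" "H = psl ` conj_set F (leaf_group n (polygon_leaves n z b b'))"
      using arithmetic_jigsaw_group[OF n(1) H] .
    hence m: "m = 5" "m \<in> {3, 5}" "m dvd int n" using n(2) by auto
    show ?thesis unfolding diamond_group[OF n(1)] *(4)
      using diamond_lattice[of n] diamond_leaves_lattice n(1)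
      by (intro jigsaw_subgroup[OF n(1) m(2,3) *(2,3)]) (auto simp: m(1))
  qed
  thus "\<exists>D. diamond_jigsaw n D \<and> (\<forall>H. is_jigsaw_group n H \<and> arithmetic H \<longrightarrow>
          finite_index_subgroup_up_to_conj H (jigsaw_group D))"
    using diamond_jigsaw_tiles[OF n(1)] by blast
next
  fix n :: nat assume "n \<ge> 1"
  thus "arithmetic (weierstrass_group 1 (1 / real n) (real n)) \<longleftrightarrow> n \<in> {1, 2, 4}"
    by (rule arithmetic_weierstrass_iff)
qed

end
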